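(* For every centered convex body $K\subseteq\mathbb{R}^n$, $$\tilde{\Lambda}(K)\leqslant \left(2\sqrt{3}\,L_K\right)^n.$$ Furthermore, $$\left(\sqrt{2}\,L_n\right)^n\leqslant \tilde{\Lambda}(n)\leqslant \left(2\sqrt{3}\,L_n\right)^n,$$ where $L_n=\max_{K\in\mathcal{K}^n}L_K$ is the maximal isotropic constant in $\mathbb{R}^n$.
   Context: A convex body in $\mathbb{R}^n$ is a compact convex set with non-empty interior; $\mathcal{K}^n$ is the set of all convex bodies in $\mathbb{R}^n$. $|\cdot|$ denotes volume (Lebesgue measure) in the corresponding subspace. $K$ is centered if its barycentre $\frac{1}{|K|}\int_K x\,dx$ equals $0$; $\mathcal{K}_c^n$ is the set of centered convex bodies in $\mathbb{R}^n$. For a vector $w\neq 0$, $w^\perp$ is the hyperplane through the origin orthogonal to $w$. For a centered convex body $K\subseteq\mathbb{R}^n$, $$\tilde{\Lambda}(K)=\min\frac{|K|^{n-1}}{\prod_{i=1}^n|K\cap w_i^\perp|},$$ where the minimum is taken over all orthogonal bases $\{w_i\}_{i=1}^n$ of $\mathbb{R}^n$, and $\tilde{\Lambda}(n)=\sup_{K\in\mathcal{K}_c^n}\tilde{\Lambda}(K)$. Isotropic constant: a convex body $K$ is isotropic if $|K|=1$, $K$ is centered, and there is a constant $L_K>0$ such that $\int_K\langle x,\theta\rangle^2dx=L_K^2$ for every $\theta\in S^{n-1}$. Every convex body $K$ has an isotropic image $a+TK$ with $a\in\mathbb{R}^n$, $T\in GL(n)$ (with $T$ unique up to orthogonal transformations),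 and the isotropic constant $L_K$ of $K$ is defined as the isotropic constant of any of its isotropic images. *)

theory Defs
  imports "HOL-Analysis.Analysis"
begin

definition convex_body :: "'a::euclidean_space set \<Rightarrow> bool" where
  "convex_body K \<longleftrightarrow> compact K \<and> convex K \<and> interior K \<noteq> {}"

definition barycentre :: "'a::euclidean_space set \<Rightarrow> 'a" where
  "barycentre K = (1 / measure lborel K) *\<^sub>R (LINT x:K|lborel. x)"

definition centered_convex_body :: "'a::euclidean_space set \<Rightarrow> bool" where
  "centered_convex_body K \<longleftrightarrow> convex_body K \<and> barycentre K = 0"

text \<open>Lebesgue measure of a linear subspace \<open>S\<close>, obtained from an orthonormal basis of \<open>S\<close>
  in the same way as the library obtains \<^const>\<open>lborel\<close> from \<^const>\<open>Basis\<close>. By rotation invariance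
  it does not depend on the basis chosen. On \<open>S = {0}\<close> it is the unit point mass at \<open>0\<close>.\<close>

definition orthonormal_basis_of :: "'a::euclidean_space set \<Rightarrow> 'a set \<Rightarrow> bool" where
  "orthonormal_basis_of S B \<longleftrightarrow> pairwise orthogonal B \<and> (\<forall>b\<in>B. norm b = 1) \<and> span B = S"

definition subspace_lborel :: "'a::euclidean_space set \<Rightarrow> 'a measure" where
  "subspace_lborel S =
    (let B = (SOME B. orthonormal_basis_of S B)
     in distr (\<Pi>\<^sub>M b\<in>B. lborel) borel (\<lambda>f. \<Sum>b\<in>B. f b *\<^sub>R b))"

definition hyperplane_perp :: "'a::euclidean_space \<Rightarrow> 'a set" where
  "hyperplane_perp w = {x. orthogonal w x}"

definition section_volume :: "'a::euclidean_space set \<Rightarrow> 'a \<Rightarrow> real" where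
  "section_volume K w = measure (subspace_lborel (hyperplane_perp w)) (K \<inter> hyperplane_perp w)"

definition orthogonal_basis :: "'a::euclidean_space set \<Rightarrow> bool" where
  "orthogonal_basis W \<longleftrightarrow> pairwise orthogonal W \<and> independent W \<and> span W = UNIV"

text \<open>The minimum and maximum in the next definition and in \<open>max_isotropic_constant\<close> are least and
  greatest elements, not merely an infimum and a supremum: their existence is not built in and has
  to be proved before anything can be derived about them.\<close>

definition Lambda_tilde :: "'a::euclidean_space set \<Rightarrow> real" where
  "Lambda_tilde K =
    (LEAST r. \<exists>W. orthogonal_basis W \<and>
       r = measure lborel K ^ (DIM('a) - 1) / (\<Prod>w\<in>W. section_volume K w))"

definition Lambda_tilde_sup :: "'a::euclidean_space itself \<Rightarrow> real" where
  "Lambda_tilde_sup _ = (SUP K\<in>{K :: 'a set. centered_convex_body K}. Lambda_tilde K)"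

definition isotropic_with :: "'a::euclidean_space set \<Rightarrow> real \<Rightarrow> bool" where
  "isotropic_with K L \<longleftrightarrow>
     centered_convex_body K \<and> measure lborel K = 1 \<and> L > 0 \<and>
     (\<forall>\<theta>\<in>sphere 0 1. (LINT x:K|lborel. (x \<bullet> \<theta>)\<^sup>2) = L\<^sup>2)"

definition isotropic_constant :: "'a::euclidean_space set \<Rightarrow> real" where
  "isotropic_constant K =
    (THE L. \<exists>(a :: 'a) (T :: 'a \<Rightarrow> 'a). linear T \<and> bij T \<and> isotropic_with ((\<lambda>x. a + T x) ` K) L)"

definition max_isotropic_constant :: "'a::euclidean_space itself \<Rightarrow> real" where
  "max_isotropic_constant _ =
    (GREATEST L. \<exists>K :: 'a set. convex_body K \<and> L = isotropic_constant K)"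

end

theory Submission
  imports Defs "HOL-Probability.Distributions" "HOL-Complex_Analysis.Great_Picard"
begin

text \<open>Everything rests on one function of one real variable. Let \<open>K\<close> be a centered convex body in
\<open>n\<close>-space, \<open>u\<close> a unit vector, and \<open>f s\<close> the volume of the section of \<open>K\<close> at height \<open>s\<close>
orthogonal to \<open>u\<close>. By Fubini's theorem \<open>f\<close> has total mass \<open>V = \<bar>K\<bar>\<close>, mean \<open>0\<close> and second moment
\<open>q = \<integral>\<^sub>K \<langle>x, u\<rangle>\<^sup>2 dx\<close>, and by the Brunn-Minkowski inequality it is log-concave. These properties
alone give

  \<open>V\<^sup>3 / 12 \<le> (f 0)\<^sup>2 q \<le> V\<^sup>3 / 2\<close>

(\<open>central_section_bounds\<close>); the extremal densities are the uniform one on the left and the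
two-sided exponential on the right. For the left inequality, \<open>f\<close> lies below the exponential that
is tangent to it at \<open>0\<close>, and among the functions below that bound with the same mass and mean the
one that equals it on an interval and vanishes elsewhere has the smallest second moment. For the
right inequality, \<open>f\<close> is compared on each half line with an exponential that it crosses only once.

The rest is linear algebra. Let \<open>J\<close> be the inertia matrix of \<open>K\<close>. The number
\<open>det J / V\<^bsup>n+2\<^esup>\<close> is an affine invariant, and on an isotropic image it is \<open>L\<^bsup>2n\<^esup>\<close>; hence it is the
\<open>2n\<close>-th power of the isotropic constant. For the upper bound on \<open>Lambda_tilde K\<close>, take the
principal axes of \<open>J\<close> as orthogonal basis: the second moments in these directions multiply to
\<open>det J\<close>, so the product of the left inequalities bounds the product of the section volumes from
below (\<open>principal_axes_section_product\<close>). For the lower bound, take \<open>K\<close> isotropic with the largest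
isotropic constant \<open>L\<close>: all second moments are \<open>L\<^sup>2\<close>, so by the right inequality every central
section has volume at most \<open>1 / (sqrt 2 * L)\<close>, whatever orthogonal basis is chosen
(\<open>isotropic_section_product\<close>).

Two compactness arguments show that the extrema exist. The volume of a central section is upper
semicontinuous in its direction and the orthogonal matrices form a compact set, so a best
orthogonal basis exists (\<open>Lambda_tilde_eq\<close>). Every convex body has an affine image between a fixed
simplex and a fixed cube; bodies in this position have convergent subsequences, along which
volume and inertia matrix converge, so a largest isotropic constant exists
(\<open>max_isotropic_constant_attained\<close>).\<close>

section \<open>Linear images of Lebesgue measure\<close>

lemma nn_integral_lborel_translation:
  fixes g :: "'a::euclidean_space \<Rightarrow> ennreal"
  assumes [measurable]: "g \<in> borel_measurable borel"
  shows "(\<integral>\<^sup>+x. g (a + x) \<partial>lborel) = (\<integral>\<^sup>+x. g x \<partial>lborel)"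
  by (subst (2) lborel_affine[of 1 a]) (simp_all add: nn_integral_density nn_integral_distr)

lemma nn_integral_lborel_real_affine:
  fixes g :: "real \<Rightarrow> ennreal"
  assumes [measurable]: "g \<in> borel_measurable borel" and "c \<noteq> 0"
  shows "ennreal \<bar>c\<bar> * (\<integral>\<^sup>+x. g (a + c * x) \<partial>lborel) = (\<integral>\<^sup>+x. g x \<partial>lborel)"
  using nn_integral_real_affine[of g c a] assms by simp

text \<open>Only translation invariance is used. An auxiliary real variable \<open>r\<close>, integrated over a window of
length one that moves with \<open>x\<close>, turns the integral into a double integral. For fixed \<open>r\<close> a
translation of \<open>x\<close> along \<open>u\<close> makes the window stand still; for fixed \<open>x\<close> an affine substitution
in \<open>r\<close> then absorbs \<open>\<psi> x\<close> and produces the factor \<open>1 + \<kappa>\<close>, which is the determinant of the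
map. The case \<open>\<kappa> = 0\<close> is a shear, \<open>\<kappa> = -2\<close> a reflection.\<close>

lemma nn_integral_rank_one_update:
  fixes g :: "'a::euclidean_space \<Rightarrow> ennreal" and \<psi> :: "'a \<Rightarrow> real"
  assumes [measurable]: "g \<in> borel_measurable borel" "\<psi> \<in> borel_measurable borel"
    and \<psi>: "\<And>x t. \<psi> (x + t *\<^sub>R u) = \<psi> x + \<kappa> * t" and \<kappa>: "1 + \<kappa> \<noteq> 0" and u: "u \<noteq> 0"
  shows "ennreal \<bar>1 + \<kappa>\<bar> * (\<integral>\<^sup>+x. g (x + \<psi> x *\<^sub>R u) \<partial>lborel) = (\<integral>\<^sup>+x. g x \<partial>lborel)"
proof -
  define v where "v = (1 / (u \<bullet> u)) *\<^sub>R u"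
  have uv: "u \<bullet> v = 1" using u by (simp add: v_def)
  let ?J = "\<integral>\<^sup>+x. (\<integral>\<^sup>+r. g (x + r *\<^sub>R u) * indicator {0..1} (x \<bullet> v) \<partial>lborel) \<partial>lborel"
  have main: "ennreal \<bar>1 + \<kappa>\<bar> * (\<integral>\<^sup>+x. g (x + \<psi> x *\<^sub>R u) \<partial>lborel) = ?J"
    if [measurable]: "\<psi> \<in> borel_measurable borel" and \<psi>: "\<And>x t. \<psi> (x + t *\<^sub>R u) = \<psi> x + \<kappa> * t"
        and \<kappa>: "1 + \<kappa> \<noteq> 0" for \<psi> \<kappa>
  proof -
    have "(\<integral>\<^sup>+x. g (x + \<psi> x *\<^sub>R u) \<partial>lborel)
        = (\<integral>\<^sup>+x. (\<integral>\<^sup>+r. g (x + \<psi> x *\<^sub>R u) * indicator {0..1} (x \<bullet> v + r) \<partial>lborel) \<partial>lborel)"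
    proof (rule nn_integral_cong)
      fix x
      have "(\<integral>\<^sup>+r. indicator {0..1} (x \<bullet> v + r) \<partial>lborel) = (\<integral>\<^sup>+r. indicator {0..1::real} r \<partial>lborel)"
        by (rule nn_integral_lborel_translation) measurable
      then show "g (x + \<psi> x *\<^sub>R u) = (\<integral>\<^sup>+r. g (x + \<psi> x *\<^sub>R u) * indicator {0..1} (x \<bullet> v + r) \<partial>lborel)"
        by (simp add: nn_integral_cmult)
    qed
    also have "\<dots> = (\<integral>\<^sup>+r. (\<integral>\<^sup>+x. g (x + \<psi> x *\<^sub>R u) * indicator {0..1} (x \<bullet> v + r) \<partial>lborel) \<partial>lborel)"
      by (rule lborel_pair.Fubini') measurable
    also have "\<dots> = (\<integral>\<^sup>+r. (\<integral>\<^sup>+x. g (x + (\<psi> x - (1 + \<kappa>) * r) *\<^sub>R u) * indicator {0..1} (x \<bullet> v) \<partial>lborel) \<partial>lborel)"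
    proof (rule nn_integral_cong)
      fix r :: real
      have "(\<integral>\<^sup>+x. g (x + \<psi> x *\<^sub>R u) * indicator {0..1} (x \<bullet> v + r) \<partial>lborel)
        = (\<integral>\<^sup>+x. g ((- r *\<^sub>R u + x) + \<psi> (- r *\<^sub>R u + x) *\<^sub>R u) * indicator {0..1} ((- r *\<^sub>R u + x) \<bullet> v + r) \<partial>lborel)"
        by (rule nn_integral_lborel_translation[symmetric]) measurable
      also have "\<dots> = (\<integral>\<^sup>+x. g (x + (\<psi> x - (1 + \<kappa>) * r) *\<^sub>R u) * indicator {0..1} (x \<bullet> v) \<partial>lborel)"
      proof (rule nn_integral_cong)
        fix x
        have "\<psi> (- r *\<^sub>R u + x) = \<psi> x - \<kappa> * r" using \<psi>[of x "- r"] by (simp add: add.commute)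
        moreover have "(- r *\<^sub>R u + x) \<bullet> v + r = x \<bullet> v" by (simp add: inner_diff_left inner_add_left uv)
        moreover have "(- r *\<^sub>R u + x) + (\<psi> x - \<kappa> * r) *\<^sub>R u = x + (\<psi> x - (1 + \<kappa>) * r) *\<^sub>R u"
          by (simp add: algebra_simps)
        ultimately show "g ((- r *\<^sub>R u + x) + \<psi> (- r *\<^sub>R u + x) *\<^sub>R u)
            * indicator {0..1} ((- r *\<^sub>R u + x) \<bullet> v + r)
          = g (x + (\<psi> x - (1 + \<kappa>) * r) *\<^sub>R u) * indicator {0..1} (x \<bullet> v)" by (simp only:)
      qed
      finally show "(\<integral>\<^sup>+x. g (x + \<psi> x *\<^sub>R u) * indicator {0..1} (x \<bullet> v + r) \<partial>lborel)
          = (\<integral>\<^sup>+x. g (x + (\<psi> x - (1 + \<kappa>) * r) *\<^sub>R u) * indicator {0..1} (x \<bullet> v) \<partial>lborel)" .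
    qed
    also have "\<dots> = (\<integral>\<^sup>+x. (\<integral>\<^sup>+r. g (x + (\<psi> x - (1 + \<kappa>) * r) *\<^sub>R u) * indicator {0..1} (x \<bullet> v) \<partial>lborel) \<partial>lborel)"
      by (rule lborel_pair.Fubini') measurable
    moreover have e: "\<bar>- (1 + \<kappa>)\<bar> = \<bar>1 + \<kappa>\<bar>" "\<psi> x + (- (1 + \<kappa>)) * r = \<psi> x - (1 + \<kappa>) * r" for x r
      by (simp_all only: abs_minus_cancel)
    ultimately have "ennreal \<bar>1 + \<kappa>\<bar> * (\<integral>\<^sup>+x. g (x + \<psi> x *\<^sub>R u) \<partial>lborel)
      = (\<integral>\<^sup>+x. ennreal \<bar>- (1 + \<kappa>)\<bar> * (\<integral>\<^sup>+r. g (x + (\<psi> x + (- (1 + \<kappa>)) * r) *\<^sub>R u) * indicator {0..1} (x \<bullet> v) \<partial>lborel) \<partial>lborel)"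
      unfolding e by (simp add: nn_integral_cmult)
    also have "\<dots> = ?J"
      by (intro nn_integral_cong nn_integral_lborel_real_affine[where g="\<lambda>r. g (x + r *\<^sub>R u)
          * indicator {0..1} (x \<bullet> v)" for x])
         (use \<kappa> in auto)
    finally show ?thesis .
  qed
  show ?thesis
    using main[of \<psi> \<kappa>] main[of "\<lambda>_. 0" 0] \<psi> \<kappa> by simp
qed

lemma prod_Basis_vec:
  fixes f :: "real ^ 'n \<Rightarrow> 'b::comm_monoid_mult"
  shows "(\<Prod>b\<in>Basis. f b) = (\<Prod>i\<in>UNIV. f (axis i 1))"
proof -
  have "Basis = range (\<lambda>i. axis i 1 :: real ^ 'n)" by (auto simp: Basis_vec_def)
  moreover have inj: "inj (\<lambda>i. axis i 1 :: real ^ 'n)" by (auto simp: inj_def axis_eq_axis)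
  ultimately show ?thesis using prod.reindex[OF inj, of f] by (simp add: o_def)
qed

lemma sum_Basis_vec:
  fixes f :: "real ^ 'n \<Rightarrow> 'b::comm_monoid_add"
  shows "(\<Sum>b\<in>Basis. f b) = (\<Sum>i\<in>UNIV. f (axis i 1))"
proof -
  have "Basis = range (\<lambda>i. axis i 1 :: real ^ 'n)" by (auto simp: Basis_vec_def)
  moreover have inj: "inj (\<lambda>i. axis i 1 :: real ^ 'n)" by (auto simp: inj_def axis_eq_axis)
  ultimately show ?thesis using sum.reindex[OF inj, of f] by (simp add: o_def)
qed

lemma measurable_matrix_vector_mult [measurable]:
  fixes A :: "real ^ 'n ^ 'm"
  shows "(\<lambda>x. A *v x) \<in> borel_measurable borel"
  by (intro borel_measurable_continuous_onI) (simp add: linear_continuous_on)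

text \<open>Every matrix is a product of elementary ones. An exchange of two coordinates is a reflection and
the addition of one coordinate to another a shear, so both are covered by the previous lemma.\<close>

lemma nn_integral_matrix_vector_mult:
  fixes A :: "real ^ 'n ^ 'n"
  assumes "det A \<noteq> 0" and "g \<in> borel_measurable borel"
  shows "ennreal \<bar>det A\<bar> * (\<integral>\<^sup>+x. g (A *v x) \<partial>lborel) = (\<integral>\<^sup>+x. g x \<partial>lborel)"
proof -
  define P where "P A \<longleftrightarrow> (det A \<noteq> 0 \<longrightarrow> (\<forall>g\<in>borel_measurable borel. ennreal \<bar>det A\<bar> * (\<integral>\<^sup>+x. g (A *v x) \<partial>lborel)
      = (\<integral>\<^sup>+x. g x \<partial>lborel)))" for A :: "real ^ 'n ^ 'n"
  have "P A"
  proof (induction A rule: induct_matrix_elementary_alt)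
    case (1 A B)
    show ?case unfolding P_def
    proof (intro impI ballI)
      fix g :: "real ^ 'n \<Rightarrow> ennreal" assume d: "det (A ** B) \<noteq> 0"
          and [measurable]: "g \<in> borel_measurable borel"
      have "ennreal \<bar>det (A ** B)\<bar> * (\<integral>\<^sup>+x. g ((A ** B) *v x) \<partial>lborel)
          = ennreal \<bar>det A\<bar> * (ennreal \<bar>det B\<bar> * (\<integral>\<^sup>+x. g (A *v (B *v x)) \<partial>lborel))"
        by (simp add: det_mul abs_mult ennreal_mult matrix_vector_mul_assoc mult_ac)
      also have "\<dots> = ennreal \<bar>det A\<bar> * (\<integral>\<^sup>+x. g (A *v x) \<partial>lborel)"
        using 1(2) d by (auto simp: P_def det_mul dest: bspec[where x="\<lambda>x. g (A *v x)"])
      also have "\<dots> = (\<integral>\<^sup>+x. g x \<partial>lborel)"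
        using 1(1) d by (auto simp: P_def det_mul)
      finally show "ennreal \<bar>det (A ** B)\<bar> * (\<integral>\<^sup>+x. g ((A ** B) *v x) \<partial>lborel) = (\<integral>\<^sup>+x. g x \<partial>lborel)" .
    qed
  next
    case (2 A i) then show ?case by (simp add: P_def det_zero_row)
  next
    case (3 A)
    show ?case unfolding P_def
    proof (intro impI ballI)
      fix g :: "real ^ 'n \<Rightarrow> ennreal" assume d: "det A \<noteq> 0" and [measurable]: "g \<in> borel_measurable borel"
      have dA: "det A = (\<Prod>i\<in>UNIV. A $ i $ i)" using 3 by (rule det_diagonal)
      define c where "c b = (A *v b) \<bullet> b" for b
      have ax: "(A *v axis i 1) \<bullet> axis i 1 = A $ i $ i" for i
        by (simp add: matrix_vector_mult_basis column_def inner_axis)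
      have xi: "x \<bullet> axis i 1 = x $ i" for x :: "real ^ 'n" and i by (simp add: inner_axis)
      have ax': "(A *v axis i 1) $ i = A $ i $ i" for i
        by (simp add: matrix_vector_mult_basis column_def)
      have T: "A *v x = 0 + (\<Sum>j\<in>Basis. (c j * (x \<bullet> j)) *\<^sub>R j)" for x
      proof -
        have "(A *v x) $ k = (\<Sum>j\<in>Basis. (c j * (x \<bullet> j)) *\<^sub>R j) $ k" for k
        proof -
          have "(A *v x) $ k = (\<Sum>j\<in>UNIV. if j = k then A $ k $ k * x $ k else 0)"
            unfolding matrix_vector_mult_def vec_lambda_beta by (intro sum.cong refl) (use 3 in auto)
          moreover have "(\<Sum>j\<in>Basis. (c j * (x \<bullet> j)) *\<^sub>R j) $ k
              = (\<Sum>i\<in>UNIV. if i = k then A $ k $ k * x $ k else 0)"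
            unfolding sum_Basis_vec sum_component c_def xi ax'
            by (intro sum.cong) (auto simp: axis_def)
          ultimately show ?thesis by simp
        qed
        then show ?thesis by (simp add: vec_eq_iff)
      qed
      have cn: "c j \<noteq> 0" if "j \<in> Basis" for j
        using that d dA ax by (auto simp: Basis_vec_def c_def)
      have pr: "(\<Prod>j\<in>Basis. \<bar>c j\<bar>) = \<bar>det A\<bar>"
        by (simp add: dA prod_Basis_vec c_def ax abs_prod)
      have "lborel = density (distr lborel borel (\<lambda>x. A *v x)) (\<lambda>_. ennreal \<bar>det A\<bar>)"
        using lborel_affine_euclidean[of c 0, OF cn] unfolding T[symmetric] pr .
      then have "(\<integral>\<^sup>+x. g x \<partial>lborel)
          = (\<integral>\<^sup>+x. g x \<partial>density (distr lborel borel (\<lambda>x. A *v x)) (\<lambda>_. ennreal \<bar>det A\<bar>))"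
        by (rule arg_cong[where f="\<lambda>M. integral\<^sup>N M g"])
      also have "\<dots> = ennreal \<bar>det A\<bar> * (\<integral>\<^sup>+x. g (A *v x) \<partial>lborel)"
        by (simp add: nn_integral_density nn_integral_distr nn_integral_cmult)
      finally show "ennreal \<bar>det A\<bar> * (\<integral>\<^sup>+x. g (A *v x) \<partial>lborel) = (\<integral>\<^sup>+x. g x \<partial>lborel)" by simp
    qed
  next
    case (4 m n)
    let ?A = "(\<chi> i j. mat 1 $ i $ Transposition.transpose m n j) :: real ^ 'n ^ 'n"
    have d: "\<bar>det ?A\<bar> = 1"
      by (simp add: det_permute_columns permutes_swap_id sign_swap_id abs_mult 4)
    have A: "?A *v x = x + (x $ n - x $ m) *\<^sub>R (axis m 1 - axis n 1)" for x
    proof -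
      have "(?A *v x) $ i = x $ Transposition.transpose m n i" for i
      proof -
        have "(?A *v x) $ i = (\<Sum>j\<in>UNIV. if i = Transposition.transpose m n j then x $ j else 0)"
          by (auto simp: matrix_vector_mult_def mat_def intro!: sum.cong)
        also have "\<dots> = (\<Sum>j\<in>UNIV. if j = Transposition.transpose m n i then x $ j else 0)"
          by (intro sum.cong refl) (auto simp: Transposition.transpose_def)
        finally show ?thesis by simp
      qed
      then show ?thesis using 4 by (auto simp: vec_eq_iff axis_def Transposition.transpose_def)
    qed
    show ?case unfolding P_def
    proof (intro impI ballI)
      fix g :: "real ^ 'n \<Rightarrow> ennreal" assume [measurable]: "g \<in> borel_measurable borel"
      \<comment> \<open>The exchange of coordinates is the reflection that maps \<open>axis m 1 - axis n 1\<close> to its negative.\<close>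
      have "ennreal \<bar>1 + (-2)\<bar> * (\<integral>\<^sup>+x. g (x + (x $ n - x $ m) *\<^sub>R (axis m 1 - axis n 1)) \<partial>lborel)
          = (\<integral>\<^sup>+x. g x \<partial>lborel)"
      proof (rule nn_integral_rank_one_update)
        show "(\<lambda>x :: real ^ 'n. x $ n - x $ m) \<in> borel_measurable borel"
          by (intro borel_measurable_continuous_onI continuous_intros)
        show "(x + t *\<^sub>R (axis m 1 - axis n 1)) $ n - (x + t *\<^sub>R (axis m 1 - axis n 1)) $ m
            = x $ n - x $ m + -2 * t" for x :: "real ^ 'n" and t
          using 4 by (simp add: axis_def)
        show "(axis m 1 :: real ^ 'n) - axis n 1 \<noteq> 0" using 4 by (simp add: axis_eq_axis)
      qed auto
      then show "ennreal \<bar>det ?A\<bar> * (\<integral>\<^sup>+x. g (?A *v x) \<partial>lborel) = (\<integral>\<^sup>+x. g x \<partial>lborel)"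
        unfolding d A by simp
    qed
  next
    case (5 m n)
    let ?A = "(\<chi> i j. of_bool (i = m \<and> j = n \<or> i = j)) :: real ^ 'n ^ 'n"
    have eq: "?A = (\<chi> k. if k = m then row m (mat 1) + 1 *s row n (mat 1) else row k (mat 1))"
      using 5 by (auto simp: vec_eq_iff row_def mat_def)
    have d: "det ?A = 1"
      unfolding eq det_row_operation[OF 5] by (rule det_I)
    have A: "?A *v x = x + (x $ n) *\<^sub>R axis m 1" for x
    proof -
      have "(?A *v x) $ i = (x + (x $ n) *\<^sub>R axis m 1) $ i" for i
      proof (cases "i = m")
        case True
        then have "(?A *v x) $ i = (\<Sum>j\<in>UNIV. (if j = n then x $ j else 0) + (if j = m then x $ j else 0))"
          using 5 by (auto simp: matrix_vector_mult_def intro!: sum.cong)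
        then show ?thesis using True by (simp add: sum.distrib axis_def)
      next
        case False
        then have "(?A *v x) $ i = (\<Sum>j\<in>UNIV. (if j = i then x $ j else 0))"
          by (auto simp: matrix_vector_mult_def intro!: sum.cong)
        then show ?thesis using False by (simp add: axis_def)
      qed
      then show ?thesis by (simp add: vec_eq_iff)
    qed
    show ?case unfolding P_def
    proof (intro impI ballI)
      fix g :: "real ^ 'n \<Rightarrow> ennreal" assume [measurable]: "g \<in> borel_measurable borel"
      have "ennreal \<bar>1 + 0\<bar> * (\<integral>\<^sup>+x. g (x + (x $ n) *\<^sub>R axis m 1) \<partial>lborel) = (\<integral>\<^sup>+x. g x \<partial>lborel)"
      proof (rule nn_integral_rank_one_update)
        show "(\<lambda>x :: real ^ 'n. x $ n) \<in> borel_measurable borel"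
          by (intro borel_measurable_continuous_onI continuous_intros)
        show "(x + t *\<^sub>R axis m 1) $ n = x $ n + 0 * t" for x :: "real ^ 'n" and t
          using 5 by (simp add: axis_def)
        show "(axis m 1 :: real ^ 'n) \<noteq> 0" by simp
      qed auto
      then show "ennreal \<bar>det ?A\<bar> * (\<integral>\<^sup>+x. g (?A *v x) \<partial>lborel) = (\<integral>\<^sup>+x. g x \<partial>lborel)"
        unfolding d A by simp
    qed
  qed
  then show ?thesis using assms by (simp add: P_def)
qed

theorem lborel_affine_matrix:
  fixes A :: "real ^ 'n ^ 'n"
  assumes "det A \<noteq> 0"
  shows "lborel = density (distr lborel borel (\<lambda>x. a + A *v x)) (\<lambda>_. ennreal \<bar>det A\<bar>)"
proof (rule measure_eqI)
  fix X :: "(real ^ 'n) set" assume "X \<in> sets lborel"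
  then have [measurable]: "X \<in> sets borel" by simp
  have "emeasure (density (distr lborel borel (\<lambda>x. a + A *v x)) (\<lambda>_. ennreal \<bar>det A\<bar>)) X
     = ennreal \<bar>det A\<bar> * (\<integral>\<^sup>+x. indicator X (a + A *v x) \<partial>lborel)"
    by (simp add: emeasure_density nn_integral_cmult nn_integral_distr del: nn_integral_indicator)
  also have "\<dots> = (\<integral>\<^sup>+x. indicator X (a + x) \<partial>lborel)"
    by (rule nn_integral_matrix_vector_mult[OF assms]) measurable
  also have "\<dots> = (\<integral>\<^sup>+x. indicator X x \<partial>lborel)"
    by (rule nn_integral_lborel_translation) measurable
  finally show "emeasure lborel X
      = emeasure (density (distr lborel borel (\<lambda>x. a + A *v x)) (\<lambda>_. ennreal \<bar>det A\<bar>)) X" by simp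
qed simp

lemma lborel_orthogonal_matrix:
  fixes A :: "real ^ 'n ^ 'n"
  assumes "orthogonal_matrix A"
  shows "distr lborel borel (\<lambda>x. A *v x) = lborel"
proof -
  have "\<bar>det A\<bar> = 1" using det_orthogonal_matrix[OF assms] by auto
  then have "det A \<noteq> 0" and one: "ennreal \<bar>det A\<bar> = 1" by auto
  have "lborel = density (distr lborel borel (\<lambda>x. 0 + A *v x)) (\<lambda>_. ennreal \<bar>det A\<bar>)"
    by (rule lborel_affine_matrix) fact
  then show ?thesis unfolding one density_1 add_0 by (rule sym)
qed

theorem set_integral_affine_image:
  fixes A :: "real ^ 'n ^ 'n" and \<phi> :: "real ^ 'n \<Rightarrow> 'b::{banach, second_countable_topology}"
  assumes A: "det A \<noteq> 0" and K: "compact K" and [measurable]: "\<phi> \<in> borel_measurable borel"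
  shows "(LINT y:(\<lambda>x. a + A *v x) ` K|lborel. \<phi> y) = \<bar>det A\<bar> *\<^sub>R (LINT x:K|lborel. \<phi> (a + A *v x))"
proof -
  have inj: "inj (\<lambda>x. a + A *v x)"
    using A by (simp add: inj_def invertible_det_nz[symmetric] inj_matrix_vector_mult[unfolded inj_def])
  have "compact ((\<lambda>x. a + A *v x) ` K)"
    by (intro compact_continuous_image K continuous_intros linear_continuous_on) auto
  then have [measurable]: "(\<lambda>x. a + A *v x) ` K \<in> sets borel" by (rule borel_compact)
  have ind: "indicator ((\<lambda>x. a + A *v x) ` K) (a + A *v x) = (indicator K x :: real)" for x
    unfolding indicator_def using inj_image_mem_iff[OF inj, of x K] by simp
  show ?thesis
    unfolding set_lebesgue_integral_def
    by (subst lborel_affine_matrix[OF A, of a], subst integral_density)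
       (simp_all add: integral_distr ind scaleR_scaleR[symmetric] del: scaleR_scaleR)
qed

corollary measure_affine_image:
  fixes A :: "real ^ 'n ^ 'n"
  assumes A: "det A \<noteq> 0" and K: "compact K"
  shows "measure lborel ((\<lambda>x. a + A *v x) ` K) = \<bar>det A\<bar> * measure lborel K"
  using set_integral_affine_image[OF assms, of "\<lambda>_. 1::real" a]
  by (simp add: set_lebesgue_integral_def)

section \<open>Hyperplane sections as volumes of slabs\<close>

text \<open>The section at height \<open>s\<close>, thickened to a cylinder of length one in the direction \<open>u\<close>. For a
unit vector \<open>u\<close> the volume of the cylinder is the volume of the section in its hyperplane, so that
Fubini's theorem, the Brunn-Minkowski inequality and semicontinuity can all be applied to Lebesgue
measure of the whole space, without coordinates in the hyperplane.\<close>

definition slab_section :: "'a::euclidean_space set \<Rightarrow> 'a \<Rightarrow> real \<Rightarrow> 'a set" where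
  "slab_section K u s = {x. x + (s - x \<bullet> u) *\<^sub>R u \<in> K \<and> 0 \<le> x \<bullet> u \<and> x \<bullet> u \<le> 1}"

definition section_function :: "'a::euclidean_space set \<Rightarrow> 'a \<Rightarrow> real \<Rightarrow> real" where
  "section_function K u s = measure lborel (slab_section K u s)"

lemma section_function_nonneg: "0 \<le> section_function K u s"
  by (simp add: section_function_def)

text \<open>Closedness jointly in direction, height and point is what makes section volumes semicontinuous in
each of the parameters.\<close>

lemma closed_slab_section_graph:
  assumes "closed K"
  shows "closed {(p, x). x \<in> slab_section K (fst p) (snd p)}"
proof -
  have "{(p, x). x \<in> slab_section K (fst p) (snd p)}
    = (\<lambda>z. snd z + (snd (fst z) - snd z \<bullet> fst (fst z)) *\<^sub>R fst (fst z)) -` K \<inter> {z. 0 \<le> snd z \<bullet> fst (fst z)} \<inter> {z. snd z \<bullet> fst (fst z) \<le> 1}"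
    by (auto simp: slab_section_def)
  also have "closed \<dots>"
    by (intro closed_Int closed_vimage closed_Collect_le assms continuous_intros)
  finally show ?thesis .
qed

lemma closed_slab_section:
  assumes "closed K"
  shows "closed (slab_section K u s)"
proof -
  have "slab_section K u s = (\<lambda>x. ((u, s), x)) -` {(p, x). x \<in> slab_section K (fst p) (snd p)}" by auto
  also have "closed \<dots>" by (intro closed_vimage closed_slab_section_graph assms continuous_intros)
  finally show ?thesis .
qed

lemma slab_section_subset_cball:
  assumes K: "K \<subseteq> cball 0 \<rho>" and u: "norm u = 1"
  shows "slab_section K u s \<subseteq> cball 0 (\<rho> + \<bar>s\<bar> + 1)"
proof
  fix x assume x: "x \<in> slab_section K u s"
  have "x = (x + (s - x \<bullet> u) *\<^sub>R u) - (s - x \<bullet> u) *\<^sub>R u" by simp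
  also have "norm \<dots> \<le> norm (x + (s - x \<bullet> u) *\<^sub>R u) + norm ((s - x \<bullet> u) *\<^sub>R u)" by (rule norm_triangle_ineq4)
  also have "\<dots> \<le> \<rho> + (\<bar>s\<bar> + 1)"
    using x K u by (intro add_mono) (auto simp: slab_section_def subset_iff)
  finally show "x \<in> cball 0 (\<rho> + \<bar>s\<bar> + 1)" by simp
qed

lemma abs_le_of_slab_section:
  assumes K: "K \<subseteq> cball 0 \<rho>" and u: "norm u = 1" and x: "x \<in> slab_section K u s"
  shows "\<bar>s\<bar> \<le> \<rho>"
proof -
  let ?y = "x + (s - x \<bullet> u) *\<^sub>R u"
  have "?y \<bullet> u = s" using u by (simp add: inner_add_left dot_square_norm)
  then have "\<bar>s\<bar> \<le> norm ?y * norm u" by (metis Cauchy_Schwarz_ineq2)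
  moreover have "norm ?y \<le> \<rho>" using x K by (auto simp: slab_section_def subset_iff)
  ultimately show ?thesis using u by simp
qed

lemma compact_slab_section:
  assumes "compact K" and u: "norm u = 1"
  shows "compact (slab_section K u s)"
proof -
  obtain \<rho> where "K \<subseteq> cball 0 \<rho>"
    using assms(1) compact_imp_bounded bounded_subset_ballD[of K 0] ball_subset_cball by (meson subset_trans)
  then have "bounded (slab_section K u s)" using slab_section_subset_cball u bounded_subset bounded_cball
    by metis
  then show ?thesis using closed_slab_section[OF compact_imp_closed[OF assms(1)]]
    by (simp add: compact_eq_bounded_closed)
qed

lemma emeasure_slab_section:
  assumes "compact K" and u: "norm u = 1"
  shows "emeasure lborel (slab_section K u s) = ennreal (section_function K u s)"
  unfolding section_function_def
  using emeasure_compact_finite[OF compact_slab_section[OF assms, of s]]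
    by (simp add: emeasure_eq_ennreal_measure)

text \<open>Fubini's theorem in a frame that contains \<open>u\<close>, without a change of frame: after the substitution
\<open>s = \<langle>x, u\<rangle> + r\<close> for fixed \<open>x\<close> and a translation of \<open>x\<close> by \<open>r u\<close> for fixed \<open>r\<close>, the variable \<open>r\<close>
occurs only in the window of length one that defines the slab.\<close>

lemma nn_integral_by_sections:
  fixes K :: "'a::euclidean_space set"
  assumes K: "compact K" and u: "norm u = 1" and [measurable]: "\<phi> \<in> borel_measurable borel"
  shows "(\<integral>\<^sup>+x. \<phi> (x \<bullet> u) * indicator K x \<partial>lborel) = (\<integral>\<^sup>+s. \<phi> s * ennreal (section_function K u s) \<partial>lborel)"
proof -
  have uu: "u \<bullet> u = 1" using u by (simp add: dot_square_norm)
  have [measurable]: "K \<in> sets borel" using K by (rule borel_compact)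
  let ?I = "\<lambda>t::real. indicator {0..1} t :: ennreal"
  have ind: "indicator (slab_section K u s) x = (indicator K (x + (s - x \<bullet> u) *\<^sub>R u) * ?I (x \<bullet> u) :: ennreal)"
      for x s
    by (auto simp: slab_section_def split: split_indicator)
  have "(\<integral>\<^sup>+s. \<phi> s * ennreal (section_function K u s) \<partial>lborel)
      = (\<integral>\<^sup>+s. (\<integral>\<^sup>+x. \<phi> s * (indicator K (x + (s - x \<bullet> u) *\<^sub>R u) * ?I (x \<bullet> u)) \<partial>lborel) \<partial>lborel)"
  proof (rule nn_integral_cong)
    fix s
    have "ennreal (section_function K u s) = (\<integral>\<^sup>+x. indicator (slab_section K u s) x \<partial>lborel)"
      using K u compact_slab_section[OF K u] by (simp add: emeasure_slab_section borel_compact)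
    then show "\<phi> s * ennreal (section_function K u s)
        = (\<integral>\<^sup>+x. \<phi> s * (indicator K (x + (s - x \<bullet> u) *\<^sub>R u) * ?I (x \<bullet> u)) \<partial>lborel)"
      unfolding ind by (subst nn_integral_cmult) simp_all
  qed
  also have "\<dots> = (\<integral>\<^sup>+x. (\<integral>\<^sup>+s. \<phi> s * (indicator K (x + (s - x \<bullet> u) *\<^sub>R u) * ?I (x \<bullet> u)) \<partial>lborel) \<partial>lborel)"
    by (rule lborel_pair.Fubini') measurable
  also have "\<dots> = (\<integral>\<^sup>+x. (\<integral>\<^sup>+r. \<phi> (x \<bullet> u + r) * (indicator K (x + r *\<^sub>R u) * ?I (x \<bullet> u)) \<partial>lborel) \<partial>lborel)"
  proof (rule nn_integral_cong)
    fix x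
    have "(\<integral>\<^sup>+r. \<phi> (x \<bullet> u + r) * (indicator K (x + ((x \<bullet> u + r) - x \<bullet> u) *\<^sub>R u) * ?I (x \<bullet> u)) \<partial>lborel)
        = (\<integral>\<^sup>+s. \<phi> s * (indicator K (x + (s - x \<bullet> u) *\<^sub>R u) * ?I (x \<bullet> u)) \<partial>lborel)"
      by (rule nn_integral_lborel_translation) measurable
    then show "(\<integral>\<^sup>+s. \<phi> s * (indicator K (x + (s - x \<bullet> u) *\<^sub>R u) * ?I (x \<bullet> u)) \<partial>lborel)
        = (\<integral>\<^sup>+r. \<phi> (x \<bullet> u + r) * (indicator K (x + r *\<^sub>R u) * ?I (x \<bullet> u)) \<partial>lborel)"
      by simp
  qed
  also have "\<dots> = (\<integral>\<^sup>+r. (\<integral>\<^sup>+x. \<phi> (x \<bullet> u + r) * (indicator K (x + r *\<^sub>R u) * ?I (x \<bullet> u)) \<partial>lborel) \<partial>lborel)"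
    by (rule lborel_pair.Fubini') measurable
  also have "\<dots> = (\<integral>\<^sup>+r. (\<integral>\<^sup>+x. \<phi> (x \<bullet> u) * indicator K x * ?I (x \<bullet> u - r) \<partial>lborel) \<partial>lborel)"
  proof (rule nn_integral_cong)
    fix r :: real
    have "(\<integral>\<^sup>+x. \<phi> ((r *\<^sub>R u + x) \<bullet> u) * indicator K (r *\<^sub>R u + x) * ?I ((r *\<^sub>R u + x) \<bullet> u - r) \<partial>lborel)
        = (\<integral>\<^sup>+x. \<phi> (x \<bullet> u) * indicator K x * ?I (x \<bullet> u - r) \<partial>lborel)"
      by (rule nn_integral_lborel_translation) measurable
    then show "(\<integral>\<^sup>+x. \<phi> (x \<bullet> u + r) * (indicator K (x + r *\<^sub>R u) * ?I (x \<bullet> u)) \<partial>lborel)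
        = (\<integral>\<^sup>+x. \<phi> (x \<bullet> u) * indicator K x * ?I (x \<bullet> u - r) \<partial>lborel)"
      by (simp add: inner_add_left uu add.commute mult_ac)
  qed
  also have "\<dots> = (\<integral>\<^sup>+x. (\<integral>\<^sup>+r. \<phi> (x \<bullet> u) * indicator K x * ?I (x \<bullet> u - r) \<partial>lborel) \<partial>lborel)"
    by (rule lborel_pair.Fubini') measurable
  also have "\<dots> = (\<integral>\<^sup>+x. \<phi> (x \<bullet> u) * indicator K x \<partial>lborel)"
  proof (rule nn_integral_cong)
    fix x
    have "(\<integral>\<^sup>+r. ?I (x \<bullet> u - r) \<partial>lborel) = 1"
      using nn_integral_lborel_real_affine[of ?I "-1" "x \<bullet> u"] by simp
    then show "(\<integral>\<^sup>+r. \<phi> (x \<bullet> u) * indicator K x * ?I (x \<bullet> u - r) \<partial>lborel) = \<phi> (x \<bullet> u) * indicator K x"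
      by (subst nn_integral_cmult) simp_all
  qed
  finally show ?thesis by simp
qed

lemma borel_measurable_section_function:
  fixes K :: "'a::euclidean_space set"
  assumes K: "compact K" and u: "norm u = 1"
  shows "section_function K u \<in> borel_measurable borel"
proof -
  have [measurable]: "K \<in> sets borel" using K by (rule borel_compact)
  have "(\<lambda>s. (\<integral>\<^sup>+x. (indicator K (x + (s - x \<bullet> u) *\<^sub>R u)
      * indicator {0..1} (x \<bullet> u)) \<partial>lborel)) \<in> borel_measurable borel"
    by measurable
  moreover have "(\<integral>\<^sup>+x. (indicator K (x + (s - x \<bullet> u) *\<^sub>R u) * indicator {0..1} (x \<bullet> u)) \<partial>lborel)
      = emeasure lborel (slab_section K u s)" for s
  proof -
    have "(\<integral>\<^sup>+x. (indicator K (x + (s - x \<bullet> u) *\<^sub>R u) * indicator {0..1} (x \<bullet> u)) \<partial>lborel)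
        = (\<integral>\<^sup>+x. indicator (slab_section K u s) x \<partial>lborel)"
      by (intro nn_integral_cong) (auto simp: slab_section_def split: split_indicator)
    then show ?thesis using compact_slab_section[OF K u] by (simp add: borel_compact)
  qed
  ultimately have "(\<lambda>s. enn2real (emeasure lborel (slab_section K u s))) \<in> borel_measurable borel" by simp
  then show ?thesis by (simp add: section_function_def[abs_def] measure_def)
qed

theorem integral_by_sections:
  fixes K :: "'a::euclidean_space set" and \<phi> :: "real \<Rightarrow> real"
  assumes K: "compact K" and u: "norm u = 1" and [measurable]: "\<phi> \<in> borel_measurable borel"
  shows "(LINT x:K|lborel. \<phi> (x \<bullet> u)) = (\<integral>s. \<phi> s * section_function K u s \<partial>lborel)"
proof -
  have [measurable]: "K \<in> sets borel" using K by (rule borel_compact)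
  note [measurable] = borel_measurable_section_function[OF K u]
  have eq: "distr (density lborel (indicator K)) borel (\<lambda>x. x \<bullet> u)
      = density lborel (\<lambda>s. ennreal (section_function K u s))"
  proof (rule measure_eqI)
    fix X assume "X \<in> sets (distr (density lborel (indicator K)) borel (\<lambda>x. x \<bullet> u))"
    then have [measurable]: "X \<in> sets borel" by simp
    have [measurable]: "(\<lambda>x. x \<bullet> u) -` X \<in> sets borel"
      using measurable_sets[of "\<lambda>x. x \<bullet> u" borel borel X] by simp
    have "emeasure (distr (density lborel (indicator K)) borel (\<lambda>x. x \<bullet> u)) X
        = (\<integral>\<^sup>+x. indicator K x * indicator ((\<lambda>x. x \<bullet> u) -` X) x \<partial>lborel)"
      by (subst emeasure_distr) (auto simp: emeasure_density)
    also have "\<dots> = (\<integral>\<^sup>+x. indicator X (x \<bullet> u) * indicator K x \<partial>lborel)"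
      by (intro nn_integral_cong) (auto split: split_indicator)
    also have "\<dots> = (\<integral>\<^sup>+s. indicator X s * ennreal (section_function K u s) \<partial>lborel)"
      by (rule nn_integral_by_sections[OF K u]) measurable
    also have "\<dots> = emeasure (density lborel (\<lambda>s. ennreal (section_function K u s))) X"
      by (simp add: emeasure_density mult.commute)
    finally show "emeasure (distr (density lborel (indicator K)) borel (\<lambda>x. x \<bullet> u)) X
        = emeasure (density lborel (\<lambda>s. ennreal (section_function K u s))) X" .
  qed simp
  have "(LINT x:K|lborel. \<phi> (x \<bullet> u)) = (\<integral>x. \<phi> (x \<bullet> u) \<partial>density lborel (indicator K))"
    unfolding set_lebesgue_integral_def ennreal_indicator[symmetric]
      by (rule integral_density[symmetric]) auto
  also have "\<dots> = (\<integral>s. \<phi> s \<partial>distr (density lborel (indicator K)) borel (\<lambda>x. x \<bullet> u))"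
    by (rule integral_distr[symmetric]) auto
  also have "\<dots> = (\<integral>s. section_function K u s *\<^sub>R \<phi> s \<partial>lborel)"
    unfolding eq by (rule integral_density) (auto simp: section_function_nonneg)
  finally show ?thesis by (simp add: mult.commute)
qed

text \<open>The matrix whose columns are the vectors of \<open>C\<close> is orthogonal, and orthogonal matrices preserve
Lebesgue measure.\<close>

lemma lborel_eq_distr_orthonormal_basis:
  fixes C :: "(real ^ 'n) set"
  assumes C: "finite C" "card C = CARD('n)" "pairwise orthogonal C" "\<And>b. b \<in> C \<Longrightarrow> norm b = 1"
  shows "lborel = distr (\<Pi>\<^sub>M b\<in>C. lborel) borel (\<lambda>f. \<Sum>b\<in>C. f b *\<^sub>R b)"
proof -
  interpret product_sigma_finite "\<lambda>_::real^'n. lborel :: real measure" ..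
  obtain \<pi> where \<pi>: "bij_betw \<pi> (UNIV :: 'n set) C"
    using finite_same_card_bij[OF finite C(1)] C(2) by auto
  have \<pi>C: "\<pi> i \<in> C" for i using \<pi> by (auto simp: bij_betw_def)
  have \<pi>inj: "\<pi> i = \<pi> j \<longleftrightarrow> i = j" for i j using \<pi> by (auto simp: bij_betw_def inj_def)
  define Q :: "real ^ 'n ^ 'n" where "Q = (\<chi> i j. \<pi> j $ i)"
  have col: "column j Q = \<pi> j" for j by (simp add: column_def Q_def vec_eq_iff)
  have Q: "orthogonal_matrix Q"
    unfolding orthogonal_matrix_orthonormal_columns col
    using C(3,4) \<pi>C \<pi>inj by (auto simp: pairwise_def)
  let ?V = "\<lambda>f::real^'n \<Rightarrow> real. (\<chi> i. f (\<pi> i)) :: real ^ 'n"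
  have V_sum: "?V f = (\<Sum>i\<in>UNIV. f (\<pi> i) *\<^sub>R axis i 1)" for f
    by (simp add: vec_eq_iff axis_def if_distrib cong: if_cong)
  have [measurable]: "?V \<in> (\<Pi>\<^sub>M b\<in>C. lborel) \<rightarrow>\<^sub>M borel"
    unfolding V_sum using \<pi>C by measurable
  have N: "lborel = distr (\<Pi>\<^sub>M b\<in>C. lborel) borel ?V"
  proof (rule lborel_eqI)
    fix l u :: "real ^ 'n" assume lu: "\<And>b. b \<in> Basis \<Longrightarrow> l \<bullet> b \<le> u \<bullet> b"
    have le: "l $ i \<le> u $ i" for i using lu[of "axis i 1"] by (simp add: inner_axis)
    have "emeasure (distr (\<Pi>\<^sub>M b\<in>C. lborel) borel ?V) (box l u)
        = emeasure (\<Pi>\<^sub>M b\<in>C. lborel) (?V -` box l u \<inter> space (\<Pi>\<^sub>M b\<in>C. lborel))"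
      by (rule emeasure_distr) auto
    also have "?V -` box l u \<inter> space (\<Pi>\<^sub>M b\<in>C. (lborel::real measure))
        = (\<Pi>\<^sub>E b\<in>C. {l $ the_inv_into UNIV \<pi> b <..< u $ the_inv_into UNIV \<pi> b})"
    proof -
      have "(\<forall>b\<in>C. P b) \<longleftrightarrow> (\<forall>i. P (\<pi> i))" for P using \<pi> by (auto simp: bij_betw_def)
      moreover have "the_inv_into UNIV \<pi> (\<pi> i) = i" for i using \<pi> by (simp add: bij_betw_def the_inv_into_f_f)
      ultimately show ?thesis by (simp add: space_PiM mem_box_cart PiE_iff set_eq_iff)
    qed
    also have "emeasure (\<Pi>\<^sub>M b\<in>C. lborel) \<dots>
        = (\<Prod>b\<in>C. emeasure lborel {l $ the_inv_into UNIV \<pi> b <..< u $ the_inv_into UNIV \<pi> b})"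
      by (rule emeasure_PiM) (use C in auto)
    also have "\<dots> = (\<Prod>i\<in>UNIV. emeasure lborel {l $ i <..< u $ i})"
      using \<pi> by (subst prod.reindex_bij_betw[OF \<pi>, symmetric]) (simp add: bij_betw_def the_inv_into_f_f)
    also have "\<dots> = (\<Prod>i\<in>UNIV. ennreal (u $ i - l $ i))" using le by simp
    also have "\<dots> = ennreal (\<Prod>b\<in>Basis. (u - l) \<bullet> b)"
      using le by (simp add: prod_Basis_vec inner_axis prod_ennreal)
    finally show "emeasure (distr (\<Pi>\<^sub>M b\<in>C. lborel) borel ?V) (box l u) = ennreal (\<Prod>b\<in>Basis. (u - l) \<bullet> b)" .
  qed simp
  have QV: "Q *v ?V f = (\<Sum>b\<in>C. f b *\<^sub>R b)" for f
  proof -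
    have "Q *v ?V f = (\<Sum>i\<in>UNIV. f (\<pi> i) *s \<pi> i)" by (simp add: matrix_mult_sum col)
    also have "\<dots> = (\<Sum>b\<in>C. f b *\<^sub>R b)" using sum.reindex_bij_betw[OF \<pi>, of "\<lambda>b. f b *\<^sub>R b"]
      by (simp add: scalar_mult_eq_scaleR)
    finally show ?thesis .
  qed
  have "lborel = distr lborel borel (\<lambda>x. Q *v x)" by (rule lborel_orthogonal_matrix[OF Q, symmetric])
  also have "\<dots> = distr (distr (\<Pi>\<^sub>M b\<in>C. lborel) borel ?V) borel (\<lambda>x. Q *v x)"
    using N by (rule arg_cong[where f="\<lambda>M. distr M borel (\<lambda>x. Q *v x)"])
  also have "\<dots> = distr (\<Pi>\<^sub>M b\<in>C. lborel) borel (\<lambda>f. \<Sum>b\<in>C. f b *\<^sub>R b)"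
    by (subst distr_distr) (auto simp: o_def QV)
  finally show ?thesis .
qed

lemma orthonormal_basis_of_hyperplane:
  fixes u :: "'a::euclidean_space"
  assumes u: "norm u = 1" and B: "orthonormal_basis_of (hyperplane_perp u) B"
  shows "finite B" "u \<notin> B" "card (insert u B) = DIM('a)" "pairwise orthogonal (insert u B)"
      "\<And>b. b \<in> insert u B \<Longrightarrow> norm b = 1"
    "\<And>b. b \<in> B \<Longrightarrow> b \<bullet> u = 0"
proof -
  have H: "hyperplane_perp u = {x. u \<bullet> x = 0}" by (simp add: hyperplane_perp_def orthogonal_def)
  have B': "pairwise orthogonal B" "\<And>b. b \<in> B \<Longrightarrow> norm b = 1" "span B = hyperplane_perp u"
    using B by (auto simp: orthonormal_basis_of_def)
  have perp: "u \<bullet> b = 0" if "b \<in> B" for b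
    using that B'(3) span_base[of b B] H by auto
  then show "b \<bullet> u = 0" if "b \<in> B" for b using that by (simp add: inner_commute)
  have ind: "independent B"
    using B'(1) B'(2)[of 0] by (intro pairwise_orthogonal_independent) auto
  then show fin: "finite B" by (rule independent_imp_finite)
  show nu: "u \<notin> B" using perp[of u] u by auto
  have "card B = dim (hyperplane_perp u)"
    using dim_eq_card_independent[OF ind] B'(3) dim_span by metis
  also have "\<dots> = DIM('a) - 1" unfolding H using u by (intro dim_hyperplane) auto
  finally show "card (insert u B) = DIM('a)" using fin nu DIM_positive[where 'a='a] by simp
  show "pairwise orthogonal (insert u B)"
    using B'(1) perp by (auto simp: pairwise_insert orthogonal_def inner_commute)
  show "norm b = 1" if "b \<in> insert u B" for b using that u B'(2) by auto
qed

text \<open>An orthonormal basis of the hyperplane becomes one of the whole space when \<open>u\<close> is added. In these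
coordinates the slab is the product of the section with the unit interval. In particular every
choice of basis gives the same section volume.\<close>

theorem section_volume_eq_section_function:
  fixes K :: "(real ^ 'n) set"
  assumes K: "compact K" and w: "w \<noteq> 0"
  shows "section_volume K w = section_function K (w /\<^sub>R norm w) 0"
proof -
  define u where "u = w /\<^sub>R norm w"
  have u: "norm u = 1" using w by (simp add: u_def)
  have uu: "u \<bullet> u = 1" using u by (simp add: dot_square_norm)
  have H: "hyperplane_perp w = hyperplane_perp u"
    using w by (auto simp: hyperplane_perp_def orthogonal_def u_def)
  define B where "B = (SOME B. orthonormal_basis_of (hyperplane_perp u) B)"
  have "subspace (hyperplane_perp u)" by (simp add: hyperplane_perp_def orthogonal_def subspace_hyperplane)
  then have "\<exists>B. orthonormal_basis_of (hyperplane_perp u) B"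
    unfolding orthonormal_basis_of_def by (metis orthonormal_basis_subspace)
  then have B: "orthonormal_basis_of (hyperplane_perp u) B" unfolding B_def by (rule someI_ex)
  note C = orthonormal_basis_of_hyperplane[OF u B]
  interpret product_sigma_finite "\<lambda>_::real^'n. lborel :: real measure" ..
  have [measurable]: "K \<in> sets borel" using K by (rule borel_compact)
  have "closed (hyperplane_perp u)" by (simp add: hyperplane_perp_def orthogonal_def closed_hyperplane)
  then have [measurable]: "hyperplane_perp u \<in> sets borel" by (rule borel_closed)
  have [measurable]: "slab_section K u 0 \<in> sets borel" using compact_slab_section[OF K u]
    by (rule borel_compact)
  let ?g = "\<lambda>C f. \<Sum>b\<in>C. f b *\<^sub>R b"
  have gB: "?g B f \<bullet> u = 0" for f using C(6) by (simp add: inner_sum_left)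
  have upd: "?g (insert u B) (f(u := t)) = t *\<^sub>R u + ?g B f" for f t
  proof -
    have "?g B (f(u := t)) = ?g B f" using C(2) by (intro sum.cong) auto
    then show ?thesis using C(1,2) by simp
  qed
  have [measurable]: "?g C' \<in> (\<Pi>\<^sub>M b\<in>C'. lborel) \<rightarrow>\<^sub>M borel" for C' :: "(real^'n) set"
    by measurable
  have "emeasure lborel (slab_section K u 0)
      = emeasure (distr (\<Pi>\<^sub>M b\<in>insert u B. lborel) borel (?g (insert u B))) (slab_section K u 0)"
    by (rule arg_cong[where f="\<lambda>M. emeasure M _"], rule lborel_eq_distr_orthonormal_basis) (use C in auto)
  also have "\<dots> = (\<integral>\<^sup>+x. indicator (slab_section K u 0) x \<partial>distr (\<Pi>\<^sub>M b\<in>insert u B. lborel) borel (?g (insert u B)))"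
    by simp
  also have "\<dots> = (\<integral>\<^sup>+f. indicator (slab_section K u 0) (?g (insert u B) f) \<partial>(\<Pi>\<^sub>M b\<in>insert u B. lborel))"
    by (rule nn_integral_distr) measurable
  also have "\<dots> = (\<integral>\<^sup>+f. (\<integral>\<^sup>+t. indicator (slab_section K u 0) (?g (insert u B) (f(u := t))) \<partial>lborel) \<partial>(\<Pi>\<^sub>M b\<in>B. lborel))"
    by (rule product_nn_integral_insert[OF C(1,2)]) measurable
  also have "\<dots> = (\<integral>\<^sup>+f. indicator (K \<inter> hyperplane_perp u) (?g B f) \<partial>(\<Pi>\<^sub>M b\<in>B. lborel))"
  proof (rule nn_integral_cong)
    fix f
    have "(\<integral>\<^sup>+t. indicator (slab_section K u 0) (?g (insert u B) (f(u := t))) \<partial>lborel)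
       = (\<integral>\<^sup>+t. indicator (K \<inter> hyperplane_perp u) (?g B f) * indicator {0..1::real} t \<partial>lborel)"
    proof (rule nn_integral_cong)
      fix t :: real
      have "hyperplane_perp u = {x. x \<bullet> u = 0}"
        by (auto simp: hyperplane_perp_def orthogonal_def inner_commute)
      then show "indicator (slab_section K u 0) (?g (insert u B) (f(u := t)))
          = indicator (K \<inter> hyperplane_perp u) (?g B f) * (indicator {0..1::real} t :: ennreal)"
        unfolding upd slab_section_def by (auto simp: inner_add_left gB uu split: split_indicator)
    qed
    then show "(\<integral>\<^sup>+t. indicator (slab_section K u 0) (?g (insert u B) (f(u := t))) \<partial>lborel)
        = indicator (K \<inter> hyperplane_perp u) (?g B f)"
      by (simp add: nn_integral_cmult)
  qed
  also have "\<dots> = (\<integral>\<^sup>+x. indicator (K \<inter> hyperplane_perp u) x \<partial>distr (\<Pi>\<^sub>M b\<in>B. lborel) borel (?g B))"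
    by (rule nn_integral_distr[symmetric]) measurable
  also have "\<dots> = emeasure (distr (\<Pi>\<^sub>M b\<in>B. lborel) borel (?g B)) (K \<inter> hyperplane_perp u)" by simp
  finally show ?thesis
    unfolding section_volume_def H subspace_lborel_def Let_def B_def[symmetric] section_function_def u_def[symmetric] measure_def by simp
qed

section \<open>The Prekopa-Leindler and Brunn-Minkowski inequalities\<close>

lemma emeasure_gt_imp_compact_gt:
  fixes A :: "'a::euclidean_space set"
  assumes A: "A \<in> sets borel" and r: "ennreal r < emeasure lborel A" and r0: "r \<ge> 0"
  obtains K where "compact K" "K \<subseteq> A" "ennreal r < emeasure lborel K"
proof -
  let ?B = "\<lambda>n::nat. A \<inter> cball 0 (real n)"
  have "(SUP n. emeasure lborel (?B n)) = emeasure lborel (\<Union>n. ?B n)"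
    using A by (intro SUP_emeasure_incseq) (auto simp: incseq_def)
  moreover have "(\<Union>n. ?B n) = A"
    using real_arch_simple by (auto simp: mem_cball)
  ultimately obtain n where n: "ennreal r < emeasure lborel (?B n)"
    using r less_SUP_iff[of "ennreal r" "\<lambda>n. emeasure lborel (?B n)" UNIV] by auto
  have fin: "emeasure lborel (?B n) < \<infinity>"
    by (intro emeasure_bounded_finite) (auto intro: bounded_Int)
  have lm: "?B n \<in> lmeasurable"
    using A fin by (auto simp: fmeasurable_def)
  have m: "emeasure lborel (?B n) = ennreal (measure lebesgue (?B n))"
    using A fin by (simp add: emeasure_eq_ennreal_measure)
  let ?e = "measure lebesgue (?B n) - r"
  have e: "?e > 0"
    using n r0 by (simp add: m ennreal_less_iff)
  obtain K where K: "compact K" "K \<subseteq> ?B n" "?B n - K \<in> lmeasurable"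
      "emeasure lebesgue (?B n - K) < ennreal ?e"
  proof -
    have "?B n \<in> sets lebesgue" using lm by auto
    then obtain K where K: "closed K" "K \<subseteq> ?B n" "?B n - K \<in> lmeasurable"
        "emeasure lebesgue (?B n - K) < ennreal ?e"
      using sets_lebesgue_inner_closed[OF _ e] by metis
    moreover have "bounded K" by (rule bounded_subset[OF _ K(2)]) (auto intro: bounded_Int)
    ultimately show ?thesis using that compact_eq_bounded_closed by blast
  qed
  have Km: "K \<in> lmeasurable" using K(1) by (rule lmeasurable_compact)
  have "emeasure lebesgue (?B n - K) = ennreal (measure lebesgue (?B n - K))"
    using K(3) by (simp add: emeasure_eq_measure2)
  then have "measure lebesgue (?B n - K) < ?e"
    using K(4) by (simp add: ennreal_less_iff)
  moreover have "measure lebesgue (?B n - K) = measure lebesgue (?B n) - measure lebesgue K"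
    using K(2) Km lm by (intro measurable_measure_Diff) (auto)
  ultimately have "r < measure lebesgue K" by simp
  moreover have "emeasure lborel K = ennreal (measure lebesgue K)"
    using emeasure_compact_finite[OF K(1)] borel_compact[OF K(1)] by (simp add: emeasure_eq_ennreal_measure)
  ultimately have "ennreal r < emeasure lborel K"
    using r0 by (simp add: ennreal_less_iff)
  with K show ?thesis by (intro that) auto
qed

lemma emeasure_halved_translate:
  fixes A :: "real set"
  assumes "compact A"
  shows "2 * emeasure lborel ((\<lambda>a. (a + t) / 2) ` A) = emeasure lborel A"
proof -
  have eq: "(\<lambda>a. (a + t) / 2) = (\<lambda>x. (1/2) *\<^sub>R x + t/2)"
    by (auto simp: field_simps)
  have c: "compact ((\<lambda>a. (a + t) / 2) ` A)"
    by (intro compact_continuous_image assms continuous_intros) auto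
  have "emeasure lborel ((\<lambda>a. (a + t) / 2) ` A) = emeasure lebesgue ((\<lambda>a. (a + t) / 2) ` A)"
    using c by (simp add: borel_compact)
  also have "\<dots> = ennreal (1/2) * emeasure lborel A"
    unfolding eq by (subst emeasure_lebesgue_affine) (simp add: borel_compact assms)
  finally have "2 * emeasure lborel ((\<lambda>a. (a + t) / 2) ` A) = (ennreal 2 * ennreal (1/2)) * emeasure lborel A"
    by (simp add: mult.assoc)
  also have "ennreal 2 * ennreal (1/2) = 1"
    by (subst ennreal_mult[symmetric]) auto
  finally show ?thesis by simp
qed

text \<open>Halve both sets and push them apart: the right end of the copy of \<open>A\<close> then meets the left end of
the copy of \<open>B\<close> in one point, and both copies lie in \<open>C\<close>.\<close>

lemma brunn_minkowski_real_compact: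
  fixes A B C :: "real set"
  assumes A: "compact A" "A \<noteq> {}" and B: "compact B" "B \<noteq> {}" and C: "C \<in> sets borel"
    and mid: "\<And>a b. a \<in> A \<Longrightarrow> b \<in> B \<Longrightarrow> (a + b) / 2 \<in> C"
  shows "emeasure lborel A + emeasure lborel B \<le> 2 * emeasure lborel C"
proof -
  define p where "p = Sup A"
  define q where "q = Inf B"
  have p: "p \<in> A" "\<And>a. a \<in> A \<Longrightarrow> a \<le> p"
    unfolding p_def using A by (auto intro!: closed_contains_Sup cSup_upper compact_imp_closed
      dest: compact_imp_bounded simp: bounded_imp_bdd_above)
  have q: "q \<in> B" "\<And>b. b \<in> B \<Longrightarrow> q \<le> b"
    unfolding q_def using B by (auto intro!: closed_contains_Inf cInf_lower compact_imp_closed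
      dest: compact_imp_bounded simp: bounded_imp_bdd_below)
  let ?X = "(\<lambda>a. (a + q) / 2) ` A" and ?Y = "(\<lambda>b. (b + p) / 2) ` B"
  have [measurable]: "?X \<in> sets lborel" "?Y \<in> sets lborel"
  proof -
    have X: "compact ?X" and Y: "compact ?Y"
      by (intro compact_continuous_image continuous_intros A B, auto)+
    show "?X \<in> sets lborel" "?Y \<in> sets lborel"
      unfolding sets_lborel by (rule borel_compact[OF X], rule borel_compact[OF Y])
  qed
  have "?X \<inter> ?Y \<subseteq> {(p + q) / 2}"
  proof
    fix x assume "x \<in> ?X \<inter> ?Y"
    then obtain a b where "a \<in> A" "b \<in> B" "x = (a + q) / 2" "x = (b + p) / 2" by auto
    with p(2)[of a] q(2)[of b] show "x \<in> {(p + q) / 2}" by (auto simp: field_simps)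
  qed
  then have "emeasure lborel (?X \<inter> ?Y) \<le> emeasure lborel {(p + q) / 2}"
    by (intro emeasure_mono) auto
  then have "emeasure lborel (?X \<inter> ?Y) = 0" by simp
  moreover have "emeasure lborel ?X + emeasure lborel ?Y
      = emeasure lborel (?X \<union> ?Y) + emeasure lborel (?X \<inter> ?Y)"
    by (rule emeasure_Un_Int) measurable
  ultimately have "emeasure lborel ?X + emeasure lborel ?Y = emeasure lborel (?X \<union> ?Y)"
    by simp
  also have "\<dots> \<le> emeasure lborel C"
    using mid[OF _ q(1)] mid[OF p(1)] C by (intro emeasure_mono) (auto simp: add.commute[of _ p])
  finally have "2 * (emeasure lborel ?X + emeasure lborel ?Y) \<le> 2 * emeasure lborel C"
    by (intro mult_left_mono) auto
  then show ?thesis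
    by (simp only: distrib_left emeasure_halved_translate[OF A(1)] emeasure_halved_translate[OF B(1)])
qed

lemma brunn_minkowski_real:
  fixes A B C :: "real set"
  assumes A: "A \<in> sets borel" "A \<noteq> {}" and B: "B \<in> sets borel" "B \<noteq> {}" and C: "C \<in> sets borel"
    and mid: "\<And>a b. a \<in> A \<Longrightarrow> b \<in> B \<Longrightarrow> (a + b) / 2 \<in> C"
  shows "emeasure lborel A + emeasure lborel B \<le> 2 * emeasure lborel C"
proof -
  let ?K = "\<lambda>X::real set. {K. compact K \<and> K \<subseteq> X \<and> K \<noteq> {}}"
  have sup: "emeasure lborel X \<le> (SUP K\<in>?K X. emeasure lborel K)" if X: "X \<in> sets borel" "X \<noteq> {}"
      for X :: "real set"
  proof (rule ccontr)
    assume "\<not> ?thesis"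
    then have less: "(SUP K\<in>?K X. emeasure lborel K) < emeasure lborel X" by simp
    then obtain r where r: "(SUP K\<in>?K X. emeasure lborel K) = ennreal r" "r \<ge> 0"
      by (cases "SUP K\<in>?K X. emeasure lborel K") auto
    obtain K where K: "compact K" "K \<subseteq> X" "ennreal r < emeasure lborel K"
      using emeasure_gt_imp_compact_gt[of X r] X r less by auto
    then have "K \<noteq> {}" by auto
    then have "emeasure lborel K \<le> ennreal r"
      unfolding r(1)[symmetric] using K by (intro SUP_upper) auto
    with K show False by auto
  qed
  have ne: "?K X \<noteq> {}" if X: "X \<noteq> {}" for X :: "real set"
  proof -
    from X obtain x where "x \<in> X" by auto
    then have "{x} \<in> ?K X" by auto
    then show ?thesis by blast
  qed
  have "emeasure lborel A + emeasure lborel B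
      \<le> (SUP K\<in>?K A. emeasure lborel K) + (SUP L\<in>?K B. emeasure lborel L)"
    by (intro add_mono sup A B)
  also have "\<dots> = (SUP K\<in>?K A. SUP L\<in>?K B. emeasure lborel K + emeasure lborel L)"
    using ne[OF A(2)] ne[OF B(2)]
      by (simp add: ennreal_SUP_add_left[symmetric] ennreal_SUP_add_right[symmetric])
  also have "\<dots> \<le> 2 * emeasure lborel C"
    using mid by (intro SUP_least brunn_minkowski_real_compact C) auto
  finally show ?thesis .
qed

text \<open>The levels are rescaled to the unit interval, so that functions truncated at different heights can
be compared level by level.\<close>

lemma layer_cake_min:
  fixes H :: "'a \<Rightarrow> ennreal" and c :: real
  assumes M: "sigma_finite_measure M" and [measurable]: "H \<in> borel_measurable M" and c: "c > 0"
  shows "ennreal c * (\<integral>\<^sup>+t. emeasure M {x\<in>space M. H x \<ge> ennreal (c * t)} * indicator {0<..<1} t \<partial>lborel)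
      = (\<integral>\<^sup>+x. min (H x) (ennreal c) \<partial>M)"
proof -
  interpret M: sigma_finite_measure M by fact
  interpret P: pair_sigma_finite M "lborel :: real measure" ..
  let ?i = "\<lambda>x t. indicator {(x, t). ennreal (c * t) \<le> H x \<and> 0 < t \<and> t < 1} (x, t) :: ennreal"
  have meas: "case_prod ?i \<in> borel_measurable (M \<Otimes>\<^sub>M lborel)"
    by measurable
  have "(\<integral>\<^sup>+t. emeasure M {x\<in>space M. H x \<ge> ennreal (c * t)} * indicator {0<..<1} t \<partial>lborel)
      = (\<integral>\<^sup>+t. (\<integral>\<^sup>+x. ?i x t \<partial>M) \<partial>lborel)"
  proof (intro nn_integral_cong)
    fix t :: real
    have "(\<integral>\<^sup>+x. ?i x t \<partial>M) = (\<integral>\<^sup>+x. indicator {x\<in>space M. H x \<ge> ennreal (c * t)} x * indicator {0<..<1} t \<partial>M)"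
      by (intro nn_integral_cong) (auto split: split_indicator)
    also have "\<dots> = emeasure M {x\<in>space M. H x \<ge> ennreal (c * t)} * indicator {0<..<1} t"
      by (subst nn_integral_multc) auto
    finally show "emeasure M {x\<in>space M. H x \<ge> ennreal (c * t)} * indicator {0<..<1} t = (\<integral>\<^sup>+x. ?i x t \<partial>M)"
      by simp
  qed
  also have "\<dots> = (\<integral>\<^sup>+x. (\<integral>\<^sup>+t. ?i x t \<partial>lborel) \<partial>M)"
    by (rule P.Fubini'[OF meas])
  finally have "ennreal c * (\<integral>\<^sup>+t. emeasure M {x\<in>space M. H x \<ge> ennreal (c * t)}
      * indicator {0<..<1} t \<partial>lborel)
     = (\<integral>\<^sup>+x. ennreal c * (\<integral>\<^sup>+t. ?i x t \<partial>lborel) \<partial>M)"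
    using lborel.borel_measurable_nn_integral[OF meas] by (simp add: nn_integral_cmult)
  also have "\<dots> = (\<integral>\<^sup>+x. min (H x) (ennreal c) \<partial>M)"
  proof (intro nn_integral_cong)
    fix x
    let ?S = "{t. ennreal (c * t) \<le> H x \<and> 0 < t \<and> t < 1}"
    have "(\<integral>\<^sup>+t. ?i x t \<partial>lborel) = (\<integral>\<^sup>+t. indicator ?S t \<partial>lborel)"
      by (intro nn_integral_cong) (auto split: split_indicator)
    also have "\<dots> = emeasure lborel ?S" by (intro nn_integral_indicator) measurable
    finally have 1: "(\<integral>\<^sup>+t. ?i x t \<partial>lborel) = emeasure lborel ?S" .
    show "ennreal c * (\<integral>\<^sup>+t. ?i x t \<partial>lborel) = min (H x) (ennreal c)"
    proof (cases "H x \<ge> ennreal c")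
      case True
      have "?S = {0<..<1}"
        using True c by (auto intro!: order.trans[OF _ True] ennreal_leI)
      then show ?thesis using True unfolding 1 by (simp add: min_def)
    next
      case False
      then obtain h where h: "H x = ennreal h" "h \<ge> 0" "h < c"
        using c by (cases "H x") (auto simp: ennreal_less_iff not_le)
      have "?S = {0<..h/c}"
      proof (intro set_eqI iffI)
        fix t assume "t \<in> {0<..h/c}"
        then have t: "0 < t" "t \<le> h / c" by auto
        then have "t < 1" using h c by (auto simp: field_simps intro: le_less_trans[of t "h / c" 1])
        then show "t \<in> ?S" using t h c by (auto simp: h(1) field_simps intro!: ennreal_leI)
      next
        fix t assume "t \<in> ?S"
        then show "t \<in> {0<..h/c}" using h c by (auto simp: h(1) field_simps)
      qed
      then show ?thesis unfolding 1 using h c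
        by (simp add: ennreal_mult[symmetric] min_def ennreal_le_iff)
    qed
  qed
  finally show ?thesis .
qed

text \<open>As the heights \<open>\<alpha>\<close> and \<open>\<beta>\<close> are reached, for each \<open>t < 1\<close> the sets where \<open>F \<ge> \<alpha> t\<close> and \<open>G \<ge> \<beta> t\<close>
are nonempty, and midpoints between them lie where \<open>H \<ge> \<gamma> t\<close> with \<open>\<gamma>\<^sup>2 = \<alpha> \<beta>\<close>. The
one-dimensional Brunn-Minkowski inequality compares the measures of these sets; integration over
\<open>t\<close> and the inequality of arithmetic and geometric means give the claim.\<close>

lemma prekopa_real_truncated:
  fixes F G H :: "real \<Rightarrow> ennreal"
  assumes [measurable]: "F \<in> borel_measurable borel" "G \<in> borel_measurable borel" "H \<in> borel_measurable borel"
    and FGH: "\<And>x y. F x * G y \<le> (H ((x + y) / 2))\<^sup>2"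
    and \<alpha>: "\<alpha> > 0" "ennreal \<alpha> \<le> F x0" and \<beta>: "\<beta> > 0" "ennreal \<beta> \<le> G y0"
  shows "(\<integral>\<^sup>+x. min (F x) (ennreal \<alpha>) \<partial>lborel) * (\<integral>\<^sup>+x. min (G x) (ennreal \<beta>) \<partial>lborel) \<le> (\<integral>\<^sup>+x. H x \<partial>lborel)\<^sup>2"
proof -
  define \<gamma> where "\<gamma> = sqrt (\<alpha> * \<beta>)"
  have \<gamma>: "\<gamma> > 0" "\<gamma>\<^sup>2 = \<alpha> * \<beta>" using \<alpha> \<beta> by (auto simp: \<gamma>_def)
  let ?I = "\<lambda>H c. (\<integral>\<^sup>+t. emeasure lborel {x\<in>space lborel. H x \<ge> ennreal (c * t)}
      * indicator {0<..<1} t \<partial>(lborel::real measure))"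
  have meas: "(\<lambda>t. emeasure lborel {x\<in>space lborel. H x \<ge> ennreal (c * t)}) \<in> borel_measurable lborel"
    if [measurable]: "H \<in> borel_measurable borel" for H :: "real \<Rightarrow> ennreal" and c
    by measurable
  have "?I F \<alpha> + ?I G \<beta> = (\<integral>\<^sup>+t. (emeasure lborel {x\<in>space lborel. F x \<ge> ennreal (\<alpha> * t)}
      + emeasure lborel {x\<in>space lborel. G x \<ge> ennreal (\<beta> * t)}) * indicator {0<..<1} t \<partial>lborel)"
    using meas[of F] meas[of G] by (subst nn_integral_add[symmetric]) (auto simp: distrib_right)
  also have "\<dots> \<le> (\<integral>\<^sup>+t. 2 * (emeasure lborel {x\<in>space lborel. H x \<ge> ennreal (\<gamma> * t)}
      * indicator {0<..<1} t) \<partial>lborel)"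
  proof (intro nn_integral_mono)
    fix t :: real
    show "(emeasure lborel {x\<in>space lborel. F x \<ge> ennreal (\<alpha> * t)}
        + emeasure lborel {x\<in>space lborel. G x \<ge> ennreal (\<beta> * t)}) * indicator {0<..<1} t
      \<le> 2 * (emeasure lborel {x\<in>space lborel. H x \<ge> ennreal (\<gamma> * t)} * indicator {0<..<1} t)"
    proof (cases "0 < t \<and> t < 1")
      case True
      have "emeasure lborel {x\<in>space lborel. F x \<ge> ennreal (\<alpha> * t)}
          + emeasure lborel {x\<in>space lborel. G x \<ge> ennreal (\<beta> * t)}
         \<le> 2 * emeasure lborel {x\<in>space lborel. H x \<ge> ennreal (\<gamma> * t)}"
      proof (rule brunn_minkowski_real)
        have "ennreal (\<alpha> * t) \<le> ennreal \<alpha>" "ennreal (\<beta> * t) \<le> ennreal \<beta>"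
          using True \<alpha> \<beta> by (auto intro!: ennreal_leI)
        then have "x0 \<in> {x\<in>space lborel. F x \<ge> ennreal (\<alpha> * t)}"
            "y0 \<in> {x\<in>space lborel. G x \<ge> ennreal (\<beta> * t)}"
          using order.trans[OF _ \<alpha>(2), of "ennreal (\<alpha> * t)"] order.trans[OF _ \<beta>(2), of "ennreal (\<beta> * t)"]
            by auto
        then show "{x\<in>space lborel. F x \<ge> ennreal (\<alpha> * t)} \<noteq> {}"
            "{x\<in>space lborel. G x \<ge> ennreal (\<beta> * t)} \<noteq> {}"
          by blast+
        fix a b assume "a \<in> {x\<in>space lborel. F x \<ge> ennreal (\<alpha> * t)}"
            "b \<in> {x\<in>space lborel. G x \<ge> ennreal (\<beta> * t)}"
        then have "ennreal (\<alpha> * t) * ennreal (\<beta> * t) \<le> F a * G b" by (intro mult_mono) auto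
        also have "\<dots> \<le> (H ((a + b) / 2))\<^sup>2" by (rule FGH)
        also have "ennreal (\<alpha> * t) * ennreal (\<beta> * t) = ennreal ((\<gamma> * t)\<^sup>2)"
          using True \<alpha> \<beta> \<gamma> by (simp add: ennreal_mult[symmetric] power_mult_distrib) (simp add: power2_eq_square mult_ac)
        finally have "(ennreal (\<gamma> * t))\<^sup>2 \<le> (H ((a + b) / 2))\<^sup>2"
          using True \<gamma> by (simp add: ennreal_power)
        then have "ennreal (\<gamma> * t) \<le> H ((a + b) / 2)"
          using True \<gamma> by (cases "H ((a + b) / 2)") (auto simp: ennreal_power ennreal_le_iff abs_le_square_iff[symmetric] power_mult_distrib[symmetric])
        then show "(a + b) / 2 \<in> {x\<in>space lborel. H x \<ge> ennreal (\<gamma> * t)}" by simp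
      qed measurable
      then show ?thesis using True by simp
    qed auto
  qed
  also have "\<dots> = 2 * ?I H \<gamma>"
    using meas[of H] by (subst nn_integral_cmult) auto
  finally have I: "?I F \<alpha> + ?I G \<beta> \<le> 2 * ?I H \<gamma>" .
  have F: "ennreal \<alpha> * ?I F \<alpha> = (\<integral>\<^sup>+x. min (F x) (ennreal \<alpha>) \<partial>lborel)"
   and G: "ennreal \<beta> * ?I G \<beta> = (\<integral>\<^sup>+x. min (G x) (ennreal \<beta>) \<partial>lborel)"
    by (rule layer_cake_min; use \<alpha> \<beta> lborel.sigma_finite_measure_axioms in simp)+
  have "ennreal \<gamma> * ?I H \<gamma> = (\<integral>\<^sup>+x. min (H x) (ennreal \<gamma>) \<partial>lborel)"
    by (rule layer_cake_min; use \<gamma> lborel.sigma_finite_measure_axioms in simp)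
  also have "\<dots> \<le> (\<integral>\<^sup>+x. H x \<partial>lborel)" by (intro nn_integral_mono) auto
  finally have H: "ennreal \<gamma> * ?I H \<gamma> \<le> (\<integral>\<^sup>+x. H x \<partial>lborel)" .
  have amgm: "a * b \<le> c\<^sup>2" if "a + b \<le> 2 * c" for a b c :: ennreal
  proof (cases c)
    case (real z)
    have "a + b < top" using that real
      by (metis ennreal_mult_less_top ennreal_less_top ennreal_numeral less_top top_unique order.strict_trans1)
    then obtain x y where xy: "a = ennreal x" "b = ennreal y" "x \<ge> 0" "y \<ge> 0"
      by (cases a; cases b) auto
    have "ennreal (x + y) \<le> ennreal (2 * z)"
      using that real xy by (simp add: ennreal_plus ennreal_mult del: ennreal_plus[symmetric])
    then have "x + y \<le> 2 * z" using real by (simp add: ennreal_le_iff)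
    then have "(x + y)\<^sup>2 \<le> (2 * z)\<^sup>2" using xy by (intro power_mono) auto
    moreover have "0 \<le> (x - y)\<^sup>2" by simp
    ultimately have "x * y \<le> z\<^sup>2" by (simp add: power2_eq_square algebra_simps)
    then show ?thesis using xy real by (simp add: ennreal_mult[symmetric] ennreal_power ennreal_leI)
  qed (simp add: power2_eq_square ennreal_top_mult)
  have "(ennreal \<alpha> * ?I F \<alpha>) * (ennreal \<beta> * ?I G \<beta>) = ennreal (\<alpha> * \<beta>) * (?I F \<alpha> * ?I G \<beta>)"
    using \<alpha> \<beta> by (simp add: ennreal_mult mult_ac)
  also have "\<dots> \<le> ennreal (\<gamma>\<^sup>2) * (?I H \<gamma>)\<^sup>2"
    unfolding \<gamma> by (intro mult_left_mono amgm I) auto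
  also have "\<dots> = (ennreal \<gamma> * ?I H \<gamma>)\<^sup>2"
    using \<gamma>(1) by (simp add: power_mult_distrib ennreal_power)
  also have "\<dots> \<le> (\<integral>\<^sup>+x. H x \<partial>lborel)\<^sup>2"
    by (intro power_mono H) auto
  finally show ?thesis unfolding F G .
qed

text \<open>A simple function attains its largest value, which is therefore an admissible truncation height;
and the integral is the supremum over simple functions.\<close>

lemma prekopa_real:
  fixes F G H :: "real \<Rightarrow> ennreal"
  assumes [measurable]: "F \<in> borel_measurable borel" "G \<in> borel_measurable borel" "H \<in> borel_measurable borel"
    and FGH: "\<And>x y. F x * G y \<le> (H ((x + y) / 2))\<^sup>2"
  shows "(\<integral>\<^sup>+x. F x \<partial>lborel) * (\<integral>\<^sup>+x. G x \<partial>lborel) \<le> (\<integral>\<^sup>+x. H x \<partial>lborel)\<^sup>2"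
proof -
  let ?S = "\<lambda>F::real \<Rightarrow> ennreal. {g. simple_function lborel g \<and> g \<le> F \<and> (\<forall>x. g x < top)}"
  have le: "integral\<^sup>S lborel f * integral\<^sup>S lborel g \<le> (\<integral>\<^sup>+x. H x \<partial>lborel)\<^sup>2" if f: "f \<in> ?S F" and g: "g \<in> ?S G"
      for f g
  proof -
    have max: "\<exists>x0. \<forall>x. f x \<le> f x0" if "simple_function lborel f" for f :: "real \<Rightarrow> ennreal"
    proof -
      have fin: "finite (range f)" using simple_functionD(1)[OF that] by simp
      then have "Max (range f) \<in> range f" by (intro Max_in) auto
      then obtain x0 where "Max (range f) = f x0" by auto
      with Max_ge[OF fin] show ?thesis by (metis rangeI)
    qed
    obtain x0 y0 where x0: "\<And>x. f x \<le> f x0" and y0: "\<And>x. g x \<le> g y0"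
      using max[of f] max[of g] f g by auto
    have eq: "integral\<^sup>S lborel f = integral\<^sup>N lborel f" "integral\<^sup>S lborel g = integral\<^sup>N lborel g"
      using f g by (auto simp: nn_integral_eq_simple_integral)
    show ?thesis
    proof (cases "f x0 = 0 \<or> g y0 = 0")
      case True
      then have "(\<forall>x. f x = 0) \<or> (\<forall>x. g x = 0)"
        using x0 y0 by auto
      then have "f = (\<lambda>_. 0) \<or> g = (\<lambda>_. 0)" by auto
      then show ?thesis unfolding eq by auto
    next
      case False
      have "f x0 < top" "g y0 < top" using f g by auto
      then obtain \<alpha> \<beta> where \<alpha>: "f x0 = ennreal \<alpha>" "\<alpha> \<ge> 0" and \<beta>: "g y0 = ennreal \<beta>" "\<beta> \<ge> 0"
        by (cases "f x0"; cases "g y0") auto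
      have pos: "\<alpha> > 0" "\<beta> > 0" using False \<alpha> \<beta> by (auto simp: less_le)
      have "integral\<^sup>N lborel f \<le> (\<integral>\<^sup>+x. min (F x) (ennreal \<alpha>) \<partial>lborel)"
        using f x0 \<alpha> by (intro nn_integral_mono) (auto simp: le_fun_def)
      moreover have "integral\<^sup>N lborel g \<le> (\<integral>\<^sup>+x. min (G x) (ennreal \<beta>) \<partial>lborel)"
        using g y0 \<beta> by (intro nn_integral_mono) (auto simp: le_fun_def)
      ultimately have "integral\<^sup>N lborel f * integral\<^sup>N lborel g
          \<le> (\<integral>\<^sup>+x. min (F x) (ennreal \<alpha>) \<partial>lborel) * (\<integral>\<^sup>+x. min (G x) (ennreal \<beta>) \<partial>lborel)"
        by (intro mult_mono) auto
      also have "\<dots> \<le> (\<integral>\<^sup>+x. H x \<partial>lborel)\<^sup>2"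
        using f g pos FGH by (intro prekopa_real_truncated[where ?x0.0=x0 and ?y0.0=y0]) (auto simp: le_fun_def \<alpha>(1)[symmetric] \<beta>(1)[symmetric])
      finally show ?thesis by (simp add: eq)
    qed
  qed
  have "(\<integral>\<^sup>+x. F x \<partial>lborel) * (\<integral>\<^sup>+x. G x \<partial>lborel)
      = (SUP f\<in>?S F. integral\<^sup>S lborel f) * (SUP g\<in>?S G. integral\<^sup>S lborel g)"
    by (simp add: nn_integral_def_finite)
  also have "\<dots> = (SUP f\<in>?S F. integral\<^sup>S lborel f * (SUP g\<in>?S G. integral\<^sup>S lborel g))"
    by (rule SUP_mult_right_ennreal)
  also have "\<dots> = (SUP f\<in>?S F. SUP g\<in>?S G. integral\<^sup>S lborel f * integral\<^sup>S lborel g)"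
    by (intro SUP_cong refl SUP_mult_left_ennreal)
  also have "\<dots> \<le> (\<integral>\<^sup>+x. H x \<partial>lborel)\<^sup>2"
    using le by (intro SUP_least)
  finally show ?thesis .
qed

text \<open>Fixing one coordinate and integrating over the others gives three functions of this coordinate
that again satisfy the hypothesis, by induction.\<close>

lemma prekopa_PiM:
  fixes f g h :: "('i \<Rightarrow> real) \<Rightarrow> ennreal"
  assumes "finite I"
    and "f \<in> borel_measurable (\<Pi>\<^sub>M i\<in>I. lborel)" "g \<in> borel_measurable (\<Pi>\<^sub>M i\<in>I. lborel)"
        "h \<in> borel_measurable (\<Pi>\<^sub>M i\<in>I. lborel)"
    and "\<And>x y. x \<in> extensional I \<Longrightarrow> y \<in> extensional I \<Longrightarrow> f x * g y \<le> (h (\<lambda>i\<in>I. (x i + y i) / 2))\<^sup>2"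
  shows "(\<integral>\<^sup>+x. f x \<partial>(\<Pi>\<^sub>M i\<in>I. lborel)) * (\<integral>\<^sup>+x. g x \<partial>(\<Pi>\<^sub>M i\<in>I. lborel)) \<le> (\<integral>\<^sup>+x. h x \<partial>(\<Pi>\<^sub>M i\<in>I. lborel))\<^sup>2"
  using assms
proof (induction I arbitrary: f g h rule: finite_induct)
  case empty
  interpret product_sigma_finite "\<lambda>_::'i. lborel :: real measure" ..
  from empty(4)[of "\<lambda>_. undefined" "\<lambda>_. undefined"] show ?case
    by (simp add: nn_integral_empty restrict_def)
next
  case (insert i I)
  interpret product_sigma_finite "\<lambda>_::'i. lborel :: real measure" ..
  note [measurable] = insert.prems(1-3)
  have int: "(\<integral>\<^sup>+x. f x \<partial>(\<Pi>\<^sub>M i\<in>insert i I. lborel)) = (\<integral>\<^sup>+s. (\<integral>\<^sup>+x. f (x(i := s)) \<partial>(\<Pi>\<^sub>M i\<in>I. lborel)) \<partial>lborel)"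
    if "f \<in> borel_measurable (\<Pi>\<^sub>M i\<in>insert i I. lborel)" for f :: "('i \<Rightarrow> real) \<Rightarrow> ennreal"
    using that insert.hyps by (rule product_nn_integral_insert_rev[rotated 2])
  show ?case
    unfolding int[OF insert.prems(1)] int[OF insert.prems(2)] int[OF insert.prems(3)]
  proof (rule prekopa_real)
    have m: "(\<lambda>s. \<integral>\<^sup>+x. f (x(i := s)) \<partial>(\<Pi>\<^sub>M i\<in>I. lborel)) \<in> borel_measurable borel"
      if [measurable]: "f \<in> borel_measurable (\<Pi>\<^sub>M i\<in>insert i I. lborel)" for f :: "('i \<Rightarrow> real) \<Rightarrow> ennreal"
    proof -
      interpret sigma_finite_measure "\<Pi>\<^sub>M i\<in>I. (lborel::real measure)"
        using insert.hyps(1) by (rule sigma_finite)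
      have "(\<lambda>s. \<integral>\<^sup>+x. f (x(i := s)) \<partial>(\<Pi>\<^sub>M i\<in>I. lborel)) \<in> borel_measurable lborel" by measurable
      then show ?thesis by simp
    qed
    show "(\<lambda>s. \<integral>\<^sup>+x. f (x(i := s)) \<partial>(\<Pi>\<^sub>M i\<in>I. lborel)) \<in> borel_measurable borel"
      "(\<lambda>s. \<integral>\<^sup>+x. g (x(i := s)) \<partial>(\<Pi>\<^sub>M i\<in>I. lborel)) \<in> borel_measurable borel"
      "(\<lambda>s. \<integral>\<^sup>+x. h (x(i := s)) \<partial>(\<Pi>\<^sub>M i\<in>I. lborel)) \<in> borel_measurable borel"
      by (rule m, fact)+
    fix s t :: real
    have ms: "(\<lambda>x. f (x(i := s))) \<in> borel_measurable (\<Pi>\<^sub>M i\<in>I. lborel)"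
      if [measurable]: "f \<in> borel_measurable (\<Pi>\<^sub>M i\<in>insert i I. lborel)" for f :: "('i \<Rightarrow> real) \<Rightarrow> ennreal" and s
      by measurable
    show "(\<integral>\<^sup>+x. f (x(i := s)) \<partial>(\<Pi>\<^sub>M i\<in>I. lborel)) * (\<integral>\<^sup>+x. g (x(i := t)) \<partial>(\<Pi>\<^sub>M i\<in>I. lborel))
      \<le> (\<integral>\<^sup>+x. h (x(i := (s + t) / 2)) \<partial>(\<Pi>\<^sub>M i\<in>I. lborel))\<^sup>2"
    proof (rule insert.IH)
      fix x y :: "'i \<Rightarrow> real" assume xy: "x \<in> extensional I" "y \<in> extensional I"
      have "f (x(i := s)) * g (y(i := t)) \<le> (h (\<lambda>j\<in>insert i I. ((x(i := s)) j + (y(i := t)) j) / 2))\<^sup>2"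
        using xy by (intro insert.prems(4)) (auto simp: extensional_def)
      also have "(\<lambda>j\<in>insert i I. ((x(i := s)) j + (y(i := t)) j) / 2)
          = (\<lambda>j\<in>I. (x j + y j) / 2)(i := (s + t) / 2)"
        using insert.hyps(2) by (auto simp: restrict_def fun_eq_iff)
      finally show "f (x(i := s)) * g (y(i := t)) \<le> (h ((\<lambda>j\<in>I. (x j + y j) / 2)(i := (s + t) / 2)))\<^sup>2" .
    qed (rule ms, fact)+
  qed
qed

theorem prekopa_leindler_midpoint:
  fixes f g h :: "'a::euclidean_space \<Rightarrow> ennreal"
  assumes [measurable]: "f \<in> borel_measurable borel" "g \<in> borel_measurable borel" "h \<in> borel_measurable borel"
    and fgh: "\<And>x y. f x * g y \<le> (h ((1/2) *\<^sub>R (x + y)))\<^sup>2"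
  shows "(\<integral>\<^sup>+x. f x \<partial>lborel) * (\<integral>\<^sup>+x. g x \<partial>lborel) \<le> (\<integral>\<^sup>+x. h x \<partial>lborel)\<^sup>2"
proof -
  let ?v = "\<lambda>x::'a \<Rightarrow> real. \<Sum>b\<in>Basis. x b *\<^sub>R b"
  have [measurable]: "?v \<in> (\<Pi>\<^sub>M b\<in>Basis. lborel) \<rightarrow>\<^sub>M borel" by measurable
  have int: "(\<integral>\<^sup>+x. f x \<partial>lborel) = (\<integral>\<^sup>+x. f (?v x) \<partial>(\<Pi>\<^sub>M b\<in>Basis. lborel))"
    if [measurable]: "f \<in> borel_measurable borel" for f :: "'a \<Rightarrow> ennreal"
    by (subst lborel_eq, subst nn_integral_distr) auto
  show ?thesis
    unfolding int[OF assms(1)] int[OF assms(2)] int[OF assms(3)]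
  proof (rule prekopa_PiM)
    fix x y :: "'a \<Rightarrow> real"
    have "?v (\<lambda>b\<in>Basis. (x b + y b) / 2) = (1/2) *\<^sub>R (?v x + ?v y)"
      by (simp add: scaleR_sum_right sum.distrib[symmetric] scaleR_add_left[symmetric] add_divide_distrib[symmetric] del: scaleR_add_left cong: sum.cong)
    then show "f (?v x) * g (?v y) \<le> (h (?v (\<lambda>b\<in>Basis. (x b + y b) / 2)))\<^sup>2"
      using fgh[of "?v x" "?v y"] by simp
  qed auto
qed

corollary brunn_minkowski_midpoint:
  fixes A B C :: "'a::euclidean_space set"
  assumes [measurable]: "A \<in> sets borel" "B \<in> sets borel" "C \<in> sets borel"
    and mid: "\<And>x y. x \<in> A \<Longrightarrow> y \<in> B \<Longrightarrow> (1/2) *\<^sub>R (x + y) \<in> C"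
  shows "emeasure lborel A * emeasure lborel B \<le> (emeasure lborel C)\<^sup>2"
proof -
  have "(\<integral>\<^sup>+x. indicator A x \<partial>lborel) * (\<integral>\<^sup>+x. indicator B x \<partial>lborel) \<le> (\<integral>\<^sup>+x. indicator C x \<partial>lborel)\<^sup>2"
    using mid by (intro prekopa_leindler_midpoint) (auto split: split_indicator)
  then show ?thesis by simp
qed

section \<open>Moments of log-concave functions on the line\<close>

text \<open>Taylor's formula: the remainder is at most \<open>exp (3/2) / 24\<close> times \<open>z\<^sup>4\<close>, and
\<open>exp (3/2) \<le> 9/2\<close> because \<open>exp 3 < 272\<^sup>3 / 100\<^sup>3 < 81/4\<close>. The range is what the bound \<open>exp 1 / 2\<close>
on the normalised slope in \<open>second_moment_ge\<close> requires.\<close>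

lemma exp_le_quartic:
  fixes z :: real
  assumes "\<bar>z\<bar> \<le> 34/25"
  shows "exp z \<le> 1 + z + z^2 / 2 + z^3 / 6 + 3/16 * z^4"
proof -
  obtain t where t: "\<bar>t\<bar> \<le> \<bar>z\<bar>" "exp z = (\<Sum>m<4. (z ^ m) / fact m) + (exp t / fact 4) * z ^ 4"
    using Maclaurin_exp_le[of z 4] by blast
  have "exp (3::real) = exp 1 ^ 3" by (simp add: exp_of_nat_mult[symmetric])
  also have "\<dots> \<le> (272/100) ^ 3" using e_less_272 by (intro power_mono) auto
  also have "\<dots> \<le> (9/2)^2" by (simp add: power_numeral_reduce)
  finally have "exp (3/2::real)^2 \<le> (9/2)^2" by (simp add: exp_of_nat_mult[symmetric] exp_double[symmetric])
  then have "exp (3/2::real) \<le> 9/2" by (rule power2_le_imp_le) simp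
  moreover have "exp t \<le> exp (3/2)" using t(1) assms by simp
  ultimately have "exp t \<le> 9/2" by (rule order.trans[rotated])
  then have "exp t / 24 * z^4 \<le> (9/2) / 24 * z^4" by (intro mult_right_mono divide_right_mono) auto
  then show ?thesis unfolding t(2) by (simp add: lessThan_nat_numeral fact_numeral eval_nat_numeral)
qed

text \<open>The numerical core of \<open>second_moment_ge\<close>. Both sides are \<open>1\<close> at \<open>v = 0\<close>; after multiplication by
\<open>exp (v / 3)\<close>, expanded to second order, the linear term leaves a margin of \<open>v / 15\<close>, which on the
given range exceeds the terms of higher order. The upper end of the range is just above
\<open>(34/25)\<^sup>2\<close>.\<close>

lemma exp_series_comparison:
  fixes v :: real
  assumes "0 \<le> v" "v \<le> 37/20"
  shows "exp (- v / 3) * (1 + v / 10 + 9/560 * v^2) \<le> 1 - v / 6"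
proof -
  have "1 + v/3 + (v/3)^2 / 2 \<le> exp (v / 3)"
    using exp_lower_Taylor_quadratic[of "v/3"] assms by simp
  then have "(1 - v / 6) * (1 + v/3 + (v/3)^2 / 2) \<le> (1 - v / 6) * exp (v / 3)"
    using assms by (intro mult_left_mono) auto
  moreover have "1 + v / 10 + 9/560 * v^2 \<le> (1 - v / 6) * (1 + v/3 + (v/3)^2 / 2)"
  proof -
    have "9/560 * v + v^2 / 108 \<le> 9/560 * (37/20) + (37/20)^2 / 108"
      using assms by (intro add_mono divide_right_mono power_mono mult_left_mono) auto
    also have "\<dots> \<le> 1/15" by (simp add: power2_eq_square)
    finally have "v * (9/560 * v + v^2 / 108) \<le> v * (1/15)" using assms by (intro mult_left_mono) auto
    moreover have "(1 - v / 6) * (1 + v/3 + (v/3)^2 / 2) - (1 + v / 10 + 9/560 * v^2)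
        = v * (1/15) - v * (9/560 * v + v^2 / 108)"
      by (simp add: field_simps power2_eq_square)
    ultimately show ?thesis by linarith
  qed
  ultimately have "1 + v / 10 + 9/560 * v^2 \<le> (1 - v / 6) * exp (v / 3)" by simp
  then show ?thesis by (simp add: exp_minus field_simps)
qed

lemma exp_moment_half_line:
  fixes \<alpha> :: real
  assumes \<alpha>: "\<alpha> > 0"
  shows "has_bochner_integral lborel (\<lambda>x. x ^ k * exp (- \<alpha> * x) * indicator {0..} x) (fact k / \<alpha> ^ Suc k)"
proof (rule has_bochner_integral_nn_integral)
  have "(\<integral>\<^sup>+x. ennreal (x ^ k * exp (- \<alpha> * x) * indicator {0..} x) \<partial>lborel)
     = (\<integral>\<^sup>+x. ennreal (1/\<alpha>) * ennreal (erlang_density 0 \<alpha> x * x ^ k) \<partial>lborel)"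
    using \<alpha> by (intro nn_integral_cong) (auto simp: erlang_density_def ennreal_mult[symmetric] split: split_indicator)
  also have "\<dots> = ennreal (1/\<alpha>) * (\<integral>\<^sup>+x. ennreal (erlang_density 0 \<alpha> x * x ^ k) \<partial>lborel)"
    by (intro nn_integral_cmult) auto
  also have "\<dots> = ennreal (fact k / \<alpha> ^ Suc k)"
    using \<alpha> by (subst nn_integral_erlang_ith_moment) (auto simp: ennreal_mult[symmetric])
  finally show "(\<integral>\<^sup>+x. ennreal (x ^ k * exp (- \<alpha> * x) * indicator {0..} x) \<partial>lborel)
      = ennreal (fact k / \<alpha> ^ Suc k)" .
qed (use \<alpha> in \<open>auto split: split_indicator\<close>)

lemma rescale_exponential_weight:
  fixes a c h m v V X :: real
  assumes m: "m = - c * h\<^sup>2 / 3" and v: "v = (c * h)\<^sup>2" and a: "a * h = V / 2"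
  shows "a * exp (c * m) * (4 * h^3 / 3 * X) = 2/3 * V * h\<^sup>2 * (exp (- v / 3) * X)"
proof -
  have "c * m = - v / 3" by (simp add: m v power2_eq_square)
  then have "a * exp (c * m) * (4 * h^3 / 3 * X) = (a * h) * (4 * h\<^sup>2 / 3) * (exp (- v / 3) * X)"
    by (simp add: power3_eq_cube power2_eq_square)
  then show ?thesis unfolding a by simp
qed

lemma quadratic_weight_expand:
  fixes h m x y :: real
  shows "(h\<^sup>2 - (x - m)\<^sup>2) * y = ((h\<^sup>2 - m\<^sup>2) * y + 2 * m * (x * y)) - x\<^sup>2 * y"
  by (simp add: power2_eq_square algebra_simps)

lemma quartic_weight_integral:
  fixes c h m K :: real
  assumes "0 \<le> h"
  shows "has_bochner_integral lborel
    (\<lambda>x. K * ((1 + c * (x - m) + (c * (x - m))^2 / 2 + (c * (x - m))^3 / 6 + 3/16 * (c * (x - m))^4) * (h\<^sup>2 - (x - m)\<^sup>2)) * indicator {m-h..m+h} x)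
    (K * (4 * h^3 / 3 * (1 + (c * h)\<^sup>2 / 10 + 9/560 * ((c * h)\<^sup>2)\<^sup>2)))"
proof -
  define p where "p y = (1 + c * y + (c * y)^2 / 2 + (c * y)^3 / 6 + 3/16 * (c * y)^4) * (h\<^sup>2 - y\<^sup>2)" for y
  define Y where "Y y = h\<^sup>2 * (y + 1/2 * c * y^2 + 1/6 * c^2 * y^3 + 1/24 * c^3 * y^4 + 3/80 * c^4 * y^5)
     - (1/3 * y^3 + 1/4 * c * y^4 + 1/10 * c^2 * y^5 + 1/36 * c^3 * y^6 + 3/112 * c^4 * y^7)" for y
  have Y: "(Y has_real_derivative p y) (at y)" for y
    unfolding Y_def p_def
    by (auto intro!: derivative_eq_intros simp: field_simps power_numeral_reduce)
  have "has_bochner_integral lborel (\<lambda>x. K * p (x - m) * indicator {m-h..m+h} x) (K * Y ((m + h) - m) - K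
      * Y ((m - h) - m))"
  proof (rule has_bochner_integral_FTC_Icc_real)
    fix x
    have "((\<lambda>x. Y (x - m)) has_real_derivative p (x - m) * 1) (at x)"
      by (rule DERIV_chain2[OF Y]) (auto intro!: derivative_eq_intros)
    then show "((\<lambda>x. K * Y (x - m)) has_real_derivative K * p (x - m)) (at x)"
      by (auto intro!: derivative_eq_intros)
    show "isCont (\<lambda>x. K * p (x - m)) x" unfolding p_def by (intro continuous_intros) auto
  qed (use assms in auto)
  moreover have "Y h - Y (- h) = 4 * h^3 / 3 * (1 + (c * h)\<^sup>2 / 10 + 9/560 * ((c * h)\<^sup>2)\<^sup>2)"
    unfolding Y_def by (simp add: field_simps eval_nat_numeral)
  then have "K * Y ((m + h) - m) - K * Y ((m - h) - m)
      = K * (4 * h^3 / 3 * (1 + (c * h)\<^sup>2 / 10 + 9/560 * ((c * h)\<^sup>2)\<^sup>2))"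
    by (simp add: right_diff_distrib[symmetric])
  ultimately show ?thesis by (simp only: p_def)
qed

lemma second_moment_ge_of_test_function:
  fixes h v V S m a :: real
  assumes "(h\<^sup>2 - m\<^sup>2) * V - S \<le> 2/3 * V * h\<^sup>2 * (1 - v / 6)" "m\<^sup>2 = h\<^sup>2 * v / 9" "a * h = V / 2"
  shows "V ^ 3 / 12 \<le> a\<^sup>2 * S"
proof -
  have "(h\<^sup>2 - h\<^sup>2 * v / 9) * V - 2/3 * V * h\<^sup>2 * (1 - v / 6) = V * h\<^sup>2 / 3" by (simp add: field_simps)
  then have "V * h\<^sup>2 / 3 \<le> S" using assms(1) unfolding assms(2) by linarith
  then have "a\<^sup>2 * (V * h\<^sup>2 / 3) \<le> a\<^sup>2 * S" by (rule mult_left_mono) simp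
  moreover have "a\<^sup>2 * (V * h\<^sup>2 / 3) = (a * h)\<^sup>2 * V / 3" by (simp add: power_mult_distrib)
  then have "a\<^sup>2 * (V * h\<^sup>2 / 3) = V ^ 3 / 12" unfolding assms(3) by (simp add: power3_eq_cube power2_eq_square)
  ultimately show ?thesis by linarith
qed

text \<open>For a nonnegative function this says that its logarithm is concave, without reference to the
logarithm of zero. It is also the form in which log-concavity is used: the set where \<open>f\<close> is above
an exponential is an interval.\<close>

definition log_concave :: "(real \<Rightarrow> real) \<Rightarrow> bool" where
  "log_concave f \<longleftrightarrow> (\<forall>k>0. \<forall>c. convex {s. k * exp (c * s) \<le> f s})"

text \<open>The properties of the function \<open>s \<mapsto> section_function K u s\<close> that determine the moment
inequalities, for a convex body \<open>K\<close> with \<open>0\<close> in its interior.\<close>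

locale section_profile =
  fixes f :: "real \<Rightarrow> real" and R B r :: real
  assumes measurable_f [measurable]: "f \<in> borel_measurable borel"
    and nonneg: "\<And>s. 0 \<le> f s" and bounded: "\<And>s. f s \<le> B"
    and support: "\<And>s. R < \<bar>s\<bar> \<Longrightarrow> f s = 0"
    and pos: "0 < r" "\<And>s. \<bar>s\<bar> < r \<Longrightarrow> 0 < f s"
    and log_concave: "log_concave f"
begin

lemma pos0: "0 < f 0" using pos by auto

lemma integrable_mult:
  assumes "continuous_on UNIV g"
  shows "integrable lborel (\<lambda>x. g x * f x)" and "integrable lborel (\<lambda>x. g x * f x * indicator {0..} x)"
proof -
  have [measurable]: "g \<in> borel_measurable borel" using assms by (rule borel_measurable_continuous_onI)
  have "compact (g ` {-R..R})"
    using assms continuous_on_subset by (intro compact_continuous_image) auto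
  then obtain C where C: "\<And>x. x \<in> {-R..R} \<Longrightarrow> norm (g x) \<le> C"
    using compact_imp_bounded bounded_iff by (metis imageI)
  have le: "norm (g x * f x) \<le> C * B" if "x \<in> {-R..R}" for x
  proof -
    have "\<bar>g x\<bar> * f x \<le> C * B"
      using C[OF that] nonneg[of x] bounded[of x] by (intro mult_mono) (auto intro: order_trans[of 0 "\<bar>g x\<bar>"])
    then show ?thesis using nonneg[of x] by (simp add: abs_mult)
  qed
  have z: "f x = 0" if "x \<notin> {-R..R}" for x using that by (intro support) auto
  show i: "integrable lborel (\<lambda>x. g x * f x)"
    by (rule integrableI_bounded_set[where A="{-R..R}"
        and B="C * B"]) (use le z in \<open>auto intro!: AE_I2 simp: emeasure_lborel_Icc_eq\<close>)
  show "integrable lborel (\<lambda>x. g x * f x * indicator {0..} x)"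
    by (intro integrable_real_mult_indicator i) auto
qed

lemma tangent:
  obtains c where "\<And>s. f s \<le> f 0 * exp (c * s)"
proof -
  define d where "d s = (ln (f s) - ln (f 0)) / s" for s
  have slope: "d s \<le> d t" if "t < 0" "0 < s" "0 < f s" "0 < f t" for s t
  proof -
    define c where "c = (ln (f s) - ln (f t)) / (s - t)"
    define k where "k = f s * exp (- (c * s))"
    have "k = exp (ln (f s) - c * s)" using that by (simp add: k_def exp_diff exp_minus field_simps)
    also have "ln (f s) - c * s = ln (f t) - c * t" using that by (simp add: c_def field_simps)
    finally have kt: "k = f t * exp (- (c * t))" using that by (simp add: exp_diff exp_minus field_simps)
    have kpos: "k > 0" using that by (simp add: k_def)
    let ?E = "{x. k * exp (c * x) \<le> f x}"
    have "s \<in> ?E" by (simp add: k_def exp_minus field_simps)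
    moreover have "t \<in> ?E" by (simp add: kt exp_minus field_simps)
    moreover have "convex ?E" using log_concave kpos by (auto simp: log_concave_def)
    ultimately have "0 \<in> ?E"
      using that mem_is_interval_1_I[of ?E t s 0] by (simp add: is_interval_convex_1)
    then have k: "k \<le> f 0" by simp
    have "ln k = ln (f s) - c * s" "ln k = ln (f t) - c * t"
      using that by (simp add: k_def ln_mult) (use that in \<open>simp add: kt ln_mult\<close>)
    moreover have "ln k \<le> ln (f 0)" using k kpos by simp
    ultimately have "ln (f s) - ln (f 0) \<le> c * s" "ln (f t) - ln (f 0) \<le> c * t" by auto
    then have "d s \<le> c" "c \<le> d t" using that by (auto simp: d_def field_simps)
    then show ?thesis by simp
  qed
  define P where "P = d ` {s. 0 < s \<and> 0 < f s}"
  \<comment> \<open>The chords from \<open>0\<close> to the right have slopes bounded by those of the chords to the left.\<close>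
  define c where "c = Sup P"
  have "f (r/2) > 0" "f (-r/2) > 0" using pos by auto
  then have bdd: "bdd_above P" and ne: "P \<noteq> {}"
    using pos slope[of "-r/2"] by (auto simp: P_def intro!: bdd_aboveI2[where M="d (-r/2)"] exI[of _ "r/2"])
  show thesis
  proof
    fix s show "f s \<le> f 0 * exp (c * s)"
    proof (cases "f s = 0 \<or> s = 0")
      case True then show ?thesis using pos0 by auto
    next
      case False
      then have fs: "f s > 0" "s \<noteq> 0" using nonneg[of s] by auto
      have "ln (f s) - ln (f 0) \<le> c * s"
      proof (cases "s > 0")
        case True
        then have "d s \<le> c" unfolding c_def using fs bdd by (intro cSup_upper) (auto simp: P_def)
        then show ?thesis using True by (simp add: d_def field_simps)
      next
        case False
        then have "c \<le> d s" unfolding c_def using fs by (intro cSup_least ne) (auto simp: P_def intro!: slope)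
        then show ?thesis using False fs by (simp add: d_def field_simps)
      qed
      then have "exp (ln (f s)) \<le> exp (ln (f 0) + c * s)" by simp
      then show ?thesis using fs pos0 by (simp add: exp_add)
    qed
  qed
qed

lemma half_line_moment_pos: "0 < (\<integral>x. x ^ k * f x * indicator {0..} x \<partial>lborel)"
proof -
  let ?g = "\<lambda>x. x ^ k * f x * indicator {0..} x"
  have int: "integrable lborel ?g" by (intro integrable_mult continuous_intros)
  have nn: "0 \<le> ?g x" for x using nonneg by (auto split: split_indicator)
  have "(\<integral>x. ?g x \<partial>lborel) \<noteq> 0"
  proof
    assume "(\<integral>x. ?g x \<partial>lborel) = 0"
    then have "AE x in lborel. ?g x = 0"
      using integral_nonneg_eq_0_iff_AE[OF int] nn by auto
    moreover have "?g x \<noteq> 0" if "x \<in> {0<..<r}" for x using that pos(2)[of x] by auto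
    ultimately have "AE x in lborel. x \<notin> {0<..<r}" by (auto elim: eventually_mono)
    then have "emeasure lborel {0<..<r} = 0"
      by (subst (asm) AE_iff_measurable[of "{0<..<r}"]) (auto simp: greaterThanLessThan_def)
    then show False using pos(1) by simp
  qed
  moreover have "0 \<le> (\<integral>x. ?g x \<partial>lborel)" using nn by (intro integral_nonneg_AE) auto
  ultimately show ?thesis by simp
qed

text \<open>The function and the exponential agree at \<open>0\<close>, and by log-concavity \<open>f\<close> is above the exponential
up to some point \<open>p\<close> and below it afterwards. If the moments of order \<open>k\<close> agree, the difference of
the moments of order \<open>k + 1\<close> is the integral of \<open>x ^ k\<close> times the difference of the functions,
weighted with \<open>x - p\<close>; this weight makes the integrand nonpositive.\<close>

lemma moment_crossing:
  assumes \<alpha>: "\<alpha> > 0" and eq: "(\<integral>x. x ^ k * f x * indicator {0..} x \<partial>lborel) = f 0 * fact k / \<alpha> ^ Suc k"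
  shows "(\<integral>x. x ^ Suc k * f x * indicator {0..} x \<partial>lborel) \<le> f 0 * fact (Suc k) / \<alpha> ^ Suc (Suc k)"
proof -
  define E where "E = {x. 0 \<le> x \<and> f 0 * exp (- \<alpha> * x) \<le> f x}"
  have E0: "0 \<in> E" by (simp add: E_def)
  have conv: "convex E"
  proof -
    have "E = {0..} \<inter> {x. f 0 * exp (- \<alpha> * x) \<le> f x}" by (auto simp: E_def)
    moreover have "convex {x. f 0 * exp (- \<alpha> * x) \<le> f x}"
      using log_concave pos0 unfolding log_concave_def by blast
    ultimately show ?thesis by (simp add: convex_Int)
  qed
  have "x \<le> R" if "x \<in> E" for x
  proof (rule ccontr)
    assume "\<not> x \<le> R"
    then have "f x = 0" using that by (intro support) (auto simp: E_def)
    then show False using that pos0 by (auto simp: E_def mult_le_0_iff)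
  qed
  then have bdd: "bdd_above E" by (auto simp: bdd_above_def)
  define p where "p = Sup E"
  have le: "(x - p) * (f x - f 0 * exp (- \<alpha> * x)) \<le> 0" if "0 \<le> x" for x
  proof (cases x p rule: linorder_cases)
    case less
    then obtain y where "y \<in> E" "x < y" unfolding p_def using less_cSup_iff[OF _ bdd] E0 by auto
    then have "x \<in> E" using that E0 conv mem_is_interval_1_I[of E 0 y x] by (simp add: is_interval_convex_1)
    then show ?thesis using less by (auto simp: E_def mult_le_0_iff)
  next
    case greater
    then have "x \<notin> E" unfolding p_def using cSup_upper[OF _ bdd, of x] by auto
    then show ?thesis using greater that by (auto simp: E_def mult_le_0_iff)
  qed simp
  let ?F = "\<lambda>k x. x ^ k * f x * indicator {0..} x"
  let ?G = "\<lambda>k x. f 0 * (x ^ k * exp (- \<alpha> * x) * indicator {0..} x)"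
  have intF: "integrable lborel (?F k)" for k by (intro integrable_mult continuous_intros)
  have G: "has_bochner_integral lborel (?G k) (f 0 * (fact k / \<alpha> ^ Suc k))" for k
    by (intro has_bochner_integral_mult_right exp_moment_half_line \<alpha>)
  note F = has_bochner_integral_integrable[OF intF]
  have "has_bochner_integral lborel (\<lambda>x. (?F (Suc k) x - p * ?F k x) - (?G (Suc k) x - p * ?G k x))
     (((\<integral>x. ?F (Suc k) x \<partial>lborel) - p * (\<integral>x. ?F k x \<partial>lborel)) - (f 0 * (fact (Suc k) / \<alpha> ^ Suc (Suc k)) - p * (f 0 * (fact k / \<alpha> ^ Suc k))))"
    by (intro has_bochner_integral_diff has_bochner_integral_mult_right F G)
  moreover have "(?F (Suc k) x - p * ?F k x) - (?G (Suc k) x - p * ?G k x) \<le> 0" for x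
  proof -
    have "(?F (Suc k) x - p * ?F k x) - (?G (Suc k) x - p * ?G k x)
        = x ^ k * ((x - p) * (f x - f 0 * exp (- \<alpha> * x))) * indicator {0..} x"
      by (simp add: algebra_simps)
    also have "\<dots> \<le> 0" using le[of x] by (auto split: split_indicator intro: mult_nonneg_nonpos)
    finally show ?thesis .
  qed
  then have "0 \<le> (\<integral>x. - ((?F (Suc k) x - p * ?F k x) - (?G (Suc k) x - p * ?G k x)) \<partial>lborel)"
    by (intro integral_nonneg_AE AE_I2) (simp only: neg_0_le_iff_le)
  then have "(\<integral>x. (?F (Suc k) x - p * ?F k x) - (?G (Suc k) x - p * ?G k x) \<partial>lborel) \<le> 0"
    by (simp only: integral_minus neg_0_le_iff_le)
  ultimately have "((\<integral>x. ?F (Suc k) x \<partial>lborel) - p * (\<integral>x. ?F k x \<partial>lborel))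
      - (f 0 * (fact (Suc k) / \<alpha> ^ Suc (Suc k)) - p * (f 0 * (fact k / \<alpha> ^ Suc k))) \<le> 0"
    by (simp only: has_bochner_integral_iff)
  then show ?thesis unfolding eq by simp
qed

lemma half_line_first_moment_le:
  "f 0 * (\<integral>x. x * f x * indicator {0..} x \<partial>lborel) \<le> (\<integral>x. f x * indicator {0..} x \<partial>lborel)\<^sup>2"
proof -
  let ?m = "\<integral>x. f x * indicator {0..} x \<partial>lborel"
  have m: "?m > 0" using half_line_moment_pos[of 0] by simp
  then have "(\<integral>x. x ^ Suc 0 * f x * indicator {0..} x \<partial>lborel)
      \<le> f 0 * fact (Suc 0) / (f 0 / ?m) ^ Suc (Suc 0)"
    using pos0 by (intro moment_crossing) auto
  then show ?thesis using pos0 m by (simp add: field_simps power2_eq_square)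
qed

lemma half_line_second_moment_le:
  "f 0 * (\<integral>x. x\<^sup>2 * f x * indicator {0..} x \<partial>lborel)\<^sup>2 \<le> 4 * (\<integral>x. x * f x * indicator {0..} x \<partial>lborel) ^ 3"
proof -
  let ?m = "\<integral>x. x * f x * indicator {0..} x \<partial>lborel"
  let ?n = "\<integral>x. x\<^sup>2 * f x * indicator {0..} x \<partial>lborel"
  have m: "?m > 0" using half_line_moment_pos[of 1] by simp
  have n: "?n > 0" using half_line_moment_pos[of 2] by simp
  define \<alpha> where "\<alpha> = sqrt (f 0 / ?m)"
  have \<alpha>: "\<alpha> > 0" "\<alpha>\<^sup>2 = f 0 / ?m" using m pos0 by (auto simp: \<alpha>_def)
  have "(\<integral>x. x ^ Suc 1 * f x * indicator {0..} x \<partial>lborel) \<le> f 0 * fact (Suc 1) / \<alpha> ^ Suc (Suc 1)"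
    using \<alpha> m pos0 by (intro moment_crossing) (auto simp: power2_eq_square[symmetric])
  then have "?n \<le> 2 * f 0 / \<alpha> ^ 3" by (simp add: eval_nat_numeral mult.commute)
  then have "?n\<^sup>2 \<le> (2 * f 0 / \<alpha> ^ 3)\<^sup>2" using n by (intro power_mono) auto
  also have "\<dots> = 4 * (f 0)\<^sup>2 / (\<alpha>\<^sup>2) ^ 3" by (simp add: power_divide power_mult_distrib power_mult[symmetric])
  also have "\<dots> = 4 * ?m ^ 3 / f 0"
    unfolding \<alpha> using pos0 m by (simp add: field_simps power2_eq_square power3_eq_cube)
  finally show ?thesis using pos0 by (simp add: field_simps)
qed

lemma reflect: "section_profile (\<lambda>s. f (- s)) R B r"
proof
  show "log_concave (\<lambda>s. f (- s))"
    unfolding log_concave_def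
  proof (intro allI impI)
    fix k c :: real assume "k > 0"
    then have "convex {s. k * exp (- c * s) \<le> f s}" using log_concave unfolding log_concave_def by blast
    then have "convex (uminus ` {s. k * exp (- c * s) \<le> f s})" by (rule convex_negations)
    also have "uminus ` {s. k * exp (- c * s) \<le> f s} = {s. k * exp (c * s) \<le> f (- s)}"
      by (auto intro!: image_eqI[where x="- _"])
    finally show "convex {s. k * exp (c * s) \<le> f (- s)}" .
  qed
qed (use nonneg bounded support pos in auto)

lemma integral_split_reflect:
  assumes "continuous_on UNIV g"
  shows "(\<integral>x. g x * f x \<partial>lborel)
      = (\<integral>x. g x * f x * indicator {0..} x \<partial>lborel) + (\<integral>x. g (- x) * f (- x) * indicator {0..} x \<partial>lborel)"
proof -
  have [measurable]: "g \<in> borel_measurable borel" using assms by (rule borel_measurable_continuous_onI)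
  have i: "integrable lborel (\<lambda>x. g x * f x)" "integrable lborel (\<lambda>x. g x * f x * indicator {0..} x)"
    by (intro integrable_mult assms)+
  have "(\<integral>x. g x * f x \<partial>lborel) = (\<integral>x. g x * f x * indicator {0..} x + g x * f x * indicator {..0} x \<partial>lborel)"
    by (rule integral_cong_AE) (auto split: split_indicator intro: AE_mp[OF AE_lborel_singleton[of 0]])
  also have "\<dots> = (\<integral>x. g x * f x * indicator {0..} x \<partial>lborel) + (\<integral>x. g x * f x * indicator {..0} x \<partial>lborel)"
    by (intro Bochner_Integration.integral_add integrable_real_mult_indicator i) auto
  also have "(\<integral>x. g x * f x * indicator {..0} x \<partial>lborel)
      = (\<integral>x. g (- x) * f (- x) * indicator {..0} (- x) \<partial>lborel)"
    by (subst lborel_integral_real_affine[where c="-1" and t=0]) auto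
  also have "\<dots> = (\<integral>x. g (- x) * f (- x) * indicator {0..} x \<partial>lborel)"
    by (intro Bochner_Integration.integral_cong) (auto split: split_indicator)
  finally show ?thesis .
qed

text \<open>As the mean is \<open>0\<close>, both half lines carry the same absolute first moment \<open>\<mu>\<close>. With
\<open>w\<^sup>2 = f 0 * \<mu>\<close>, the first-moment comparison says that \<open>w\<close> is at most the mass on either side,
hence at most half of the total mass, and the second-moment comparison bounds \<open>(f 0)\<^sup>2\<close> times the
second moment on each side by \<open>2 w\<^sup>3\<close>.\<close>

theorem second_moment_le:
  assumes mean: "(\<integral>x. x * f x \<partial>lborel) = 0"
  shows "(f 0)\<^sup>2 * (\<integral>x. x\<^sup>2 * f x \<partial>lborel) \<le> (\<integral>x. f x \<partial>lborel) ^ 3 / 2"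
proof -
  interpret g: section_profile "\<lambda>s. f (- s)" R B r by (rule reflect)
  define m where "m k = (\<integral>x. x ^ k * f x * indicator {0..} x \<partial>lborel)" for k
  define n where "n k = (\<integral>x. x ^ k * f (- x) * indicator {0..} x \<partial>lborel)" for k
  have V: "(\<integral>x. f x \<partial>lborel) = m 0 + n 0"
    using integral_split_reflect[of "\<lambda>_. 1"] by (simp add: m_def n_def)
  have "m 1 = n 1"
    using integral_split_reflect[of "\<lambda>x. x"] mean by (simp add: m_def n_def)
  have S: "(\<integral>x. x\<^sup>2 * f x \<partial>lborel) = m 2 + n 2"
    using integral_split_reflect[of "\<lambda>x. x\<^sup>2"] by (simp add: m_def n_def continuous_intros)
  have m: "f 0 * m 1 \<le> (m 0)\<^sup>2" "f 0 * (m 2)\<^sup>2 \<le> 4 * m 1 ^ 3"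
    using half_line_first_moment_le half_line_second_moment_le by (auto simp: m_def)
  have n: "f 0 * n 1 \<le> (n 0)\<^sup>2" "f 0 * (n 2)\<^sup>2 \<le> 4 * n 1 ^ 3"
    using g.half_line_first_moment_le g.half_line_second_moment_le by (auto simp: n_def)
  have p: "m k > 0" "n k > 0" for k
    using half_line_moment_pos g.half_line_moment_pos by (auto simp: m_def n_def)
  define w where "w = sqrt (f 0 * m 1)"
  have w: "w > 0" "w\<^sup>2 = f 0 * m 1" using p pos0 by (auto simp: w_def less_imp_le)
  have "w \<le> m 0" "w \<le> n 0"
    using m(1) n(1) p[of 0] \<open>m 1 = n 1\<close> w(2) by (auto intro!: power2_le_imp_le[of w] simp del: One_nat_def)
  then have wV: "w \<le> (\<integral>x. f x \<partial>lborel) / 2" using V by simp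
  have bd: "(f 0)\<^sup>2 * y \<le> 2 * w ^ 3" if "f 0 * y\<^sup>2 \<le> 4 * m 1 ^ 3" for y
  proof (rule power2_le_imp_le)
    have "((f 0)\<^sup>2 * y)\<^sup>2 = (f 0)^3 * (f 0 * y\<^sup>2)" by (simp add: power2_eq_square power3_eq_cube)
    also have "\<dots> \<le> (f 0)^3 * (4 * m 1 ^ 3)" using that pos0 by (intro mult_left_mono) auto
    also have "\<dots> = 4 * (w\<^sup>2)^3" unfolding w by (simp add: power_mult_distrib)
    also have "\<dots> = (2 * w ^ 3)\<^sup>2" by (simp add: power_mult_distrib power_mult[symmetric])
    finally show "((f 0)\<^sup>2 * y)\<^sup>2 \<le> (2 * w ^ 3)\<^sup>2" .
  qed (use w in auto)
  have "(f 0)\<^sup>2 * (m 2 + n 2) \<le> 4 * w ^ 3"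
    using bd[of "m 2"] bd[of "n 2"] m n \<open>m 1 = n 1\<close> by (simp add: distrib_left)
  also have "\<dots> \<le> 4 * ((\<integral>x. f x \<partial>lborel) / 2) ^ 3" using wV w by (intro mult_left_mono power_mono) auto
  finally show ?thesis unfolding S by (simp add: power_divide)
qed

text \<open>Integrate the weight \<open>b - x\<close> against \<open>f\<close>: the result is \<open>b\<close> times the mass since the mean is \<open>0\<close>,
and it is at most the integral against the tangent exponential up to \<open>b\<close>. The choice \<open>b = 1 / c\<close>
is the best one.\<close>

lemma tangent_slope_le:
  assumes c: "c > 0" and tan: "\<And>s. f s \<le> f 0 * exp (c * s)" and mean: "(\<integral>x. x * f x \<partial>lborel) = 0"
  shows "c * (\<integral>x. f x \<partial>lborel) \<le> exp 1 * f 0"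
proof -
  define b where "b = 1 / c"
  define S where "S = max R 0"
  have b: "b > 0" "- S \<le> b" using c by (auto simp: b_def S_def intro: order.trans[of _ 0])
  let ?F = "\<lambda>x. f 0 * (exp (c * x) * ((b - x) / c + 1 / c\<^sup>2))"
  let ?g = "\<lambda>x. f 0 * (exp (c * x) * (b - x))"
  have F: "has_bochner_integral lborel (\<lambda>x. ?g x * indicator {-S..b} x) (?F b - ?F (-S))"
    using c by (intro has_bochner_integral_FTC_Icc_real b)
      (auto intro!: derivative_eq_intros continuous_intros simp: field_simps power2_eq_square)
  have i: "integrable lborel (\<lambda>x. (b - x) * f x)" by (intro integrable_mult continuous_intros)
  have "(\<integral>x. (b - x) * f x \<partial>lborel) \<le> (\<integral>x. ?g x * indicator {-S..b} x \<partial>lborel)"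
  proof (rule integral_mono[OF i])
    show "integrable lborel (\<lambda>x. ?g x * indicator {-S..b} x)" using F by (simp add: has_bochner_integral_iff)
    fix x :: real
    consider "x < -S" | "x > b" | "x \<in> {-S..b}" by force
    then show "(b - x) * f x \<le> ?g x * indicator {-S..b} x"
    proof cases
      case 1 then have "f x = 0" by (intro support) (auto simp: S_def)
      then show ?thesis using 1 by simp
    next
      case 2 then show ?thesis using nonneg[of x] by (auto intro: mult_nonpos_nonneg)
    next
      case 3 then have "(b - x) * f x \<le> (b - x) * (f 0 * exp (c * x))" by (intro mult_left_mono tan) auto
      then show ?thesis using 3 by (simp add: mult_ac)
    qed
  qed
  also have "\<dots> = ?F b - ?F (-S)" using F by (simp add: has_bochner_integral_iff)
  also have "\<dots> \<le> ?F b" using pos0 c b by (simp add: zero_le_mult_iff add_nonneg_nonneg)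
  also have "\<dots> = exp 1 * f 0 / c\<^sup>2" using c by (simp add: b_def)
  also have "(\<integral>x. (b - x) * f x \<partial>lborel) = b * (\<integral>x. f x \<partial>lborel) - (\<integral>x. x * f x \<partial>lborel)"
    using integrable_mult[of "\<lambda>x. x"] integrable_mult[of "\<lambda>_. 1"]
    by (simp add: left_diff_distrib)
  finally show ?thesis using c mean by (simp add: b_def field_simps power2_eq_square)
qed

text \<open>The weight \<open>(x - m)\<^sup>2 - h\<^sup>2\<close> is negative exactly inside \<open>[m - h, m + h]\<close>, so its integral against
\<open>f\<close> decreases if \<open>f\<close> is replaced by the tangent exponential inside this interval and by \<open>0\<close>
outside. The interval has the length \<open>2 h = V / f 0\<close> of the uniform density with the same mass and
the same value at \<open>0\<close>; its centre \<open>m = - c h\<^sup>2 / 3\<close> is, to first order in \<open>c\<close>, the one for which the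
exponential on the interval has mean \<open>0\<close>. The bound on the slope keeps \<open>\<bar>c h\<bar>\<close> below \<open>exp 1 / 2\<close>,
where the exponential can be replaced by a polynomial.\<close>

theorem second_moment_ge:
  assumes mean: "(\<integral>x. x * f x \<partial>lborel) = 0"
  shows "(\<integral>x. f x \<partial>lborel) ^ 3 / 12 \<le> (f 0)\<^sup>2 * (\<integral>x. x\<^sup>2 * f x \<partial>lborel)"
proof -
  obtain c where tan: "\<And>s. f s \<le> f 0 * exp (c * s)" using tangent by blast
  let ?V = "\<integral>x. f x \<partial>lborel" and ?S = "\<integral>x. x\<^sup>2 * f x \<partial>lborel"
  interpret g: section_profile "\<lambda>s. f (- s)" R B r by (rule reflect)
  have i: "integrable lborel f" using integrable_mult[of "\<lambda>_. 1"] by simp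
  have V: "?V > 0"
  proof -
    have "(\<integral>x. f x * indicator {0..} x \<partial>lborel) \<le> ?V"
      using integrable_mult[of "\<lambda>_. 1"] nonneg by (intro integral_mono) (auto split: split_indicator)
    then show ?thesis using half_line_moment_pos[of 0] by simp
  qed
  have refl: "(\<integral>x. f (- x) \<partial>lborel) = ?V" "(\<integral>x. x * f (- x) \<partial>lborel) = - (\<integral>x. x * f x \<partial>lborel)"
    using lborel_integral_real_affine[of "-1" f 0] lborel_integral_real_affine[of "-1" "\<lambda>x. x * f x" 0]
      by auto
  have slope: "\<bar>c\<bar> * ?V \<le> exp 1 * f 0"
  proof (cases c "0::real" rule: linorder_cases)
    case less
    then show ?thesis using g.tangent_slope_le[of "- c"] tan[of "- _"] mean refl by simp
  next
    case greater
    then show ?thesis using tangent_slope_le[of c] tan mean by simp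
  qed (use pos0 in simp)
  define h where "h = ?V / (2 * f 0)"
  have h: "h > 0" "f 0 = ?V / (2 * h)" using V pos0 by (auto simp: h_def field_simps)
  have ch: "\<bar>c * h\<bar> \<le> 34/25"
  proof -
    have "\<bar>c * h\<bar> = (\<bar>c\<bar> * ?V) / (2 * f 0)" using V pos0 by (simp add: h_def abs_mult)
    also have "\<dots> \<le> (exp 1 * f 0) / (2 * f 0)" using slope pos0 by (intro divide_right_mono) auto
    also have "\<dots> = exp 1 / 2" using pos0 by simp
    also have "\<dots> \<le> 34/25" using e_less_272 by simp
    finally show ?thesis .
  qed
  define v where "v = (c * h)\<^sup>2"
  have v: "0 \<le> v" "v \<le> 37/20"
  proof -
    have "\<bar>c * h\<bar>\<^sup>2 \<le> (34/25)\<^sup>2" using ch by (intro power_mono) auto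
    then show "v \<le> 37/20" by (simp add: v_def power2_eq_square)
  qed (simp add: v_def)
  define m where "m = - c * h\<^sup>2 / 3"
  define P where "P z = 1 + z + z^2 / 2 + z^3 / 6 + 3/16 * z^4" for z :: real
  let ?q = "\<lambda>x. f 0 * exp (c * m) * (P (c * (x - m)) * (h\<^sup>2 - (x - m)\<^sup>2))"
  have Q: "has_bochner_integral lborel (\<lambda>x. ?q x * indicator {m-h..m+h} x) (f 0 * exp (c * m)
      * (4 * h^3 / 3 * (1 + v / 10 + 9/560 * v\<^sup>2)))"
    unfolding P_def v_def by (rule quartic_weight_integral) (use h in auto)
  have 1: "(\<integral>x. (h\<^sup>2 - (x - m)\<^sup>2) * f x \<partial>lborel) \<le> (\<integral>x. ?q x * indicator {m-h..m+h} x \<partial>lborel)"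
  proof (rule integral_mono)
    show "integrable lborel (\<lambda>x. (h\<^sup>2 - (x - m)\<^sup>2) * f x)" by (intro integrable_mult continuous_intros)
    show "integrable lborel (\<lambda>x. ?q x * indicator {m-h..m+h} x)" using Q
      by (simp add: has_bochner_integral_iff)
    fix x :: real
    show "(h\<^sup>2 - (x - m)\<^sup>2) * f x \<le> ?q x * indicator {m-h..m+h} x"
    proof (cases "x \<in> {m-h..m+h}")
      case True
      then have xm: "\<bar>x - m\<bar> \<le> h" by auto
      then have nn: "0 \<le> h\<^sup>2 - (x - m)\<^sup>2" using h power_mono[OF xm, of 2] by simp
      have "\<bar>c * (x - m)\<bar> \<le> \<bar>c * h\<bar>" using xm h by (auto simp: abs_mult intro!: mult_left_mono)
      then have "exp (c * (x - m)) \<le> P (c * (x - m))" unfolding P_def using ch by (intro exp_le_quartic) auto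
      then have "f 0 * exp (c * m) * exp (c * (x - m)) \<le> f 0 * exp (c * m) * P (c * (x - m))"
        using pos0 by (intro mult_left_mono) auto
      moreover have "f 0 * exp (c * m) * exp (c * (x - m)) = f 0 * exp (c * x)"
        by (simp add: mult.assoc exp_add[symmetric] algebra_simps)
      ultimately have "f x \<le> f 0 * exp (c * m) * P (c * (x - m))" using tan[of x] by simp
      then have "(h\<^sup>2 - (x - m)\<^sup>2) * f x \<le> (h\<^sup>2 - (x - m)\<^sup>2) * (f 0 * exp (c * m) * P (c * (x - m)))"
        using nn by (intro mult_left_mono) auto
      then show ?thesis using True by (simp add: mult_ac)
    next
      case False
      then have "h < \<bar>x - m\<bar>" by auto
      then have "h\<^sup>2 \<le> (x - m)\<^sup>2" using h power_mono[of h "\<bar>x - m\<bar>" 2] by simp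
      then show ?thesis using False nonneg[of x] by (simp add: mult_nonpos_nonneg)
    qed
  qed
  have 2: "(\<integral>x. ?q x * indicator {m-h..m+h} x \<partial>lborel)
      = f 0 * exp (c * m) * (4 * h^3 / 3 * (1 + v / 10 + 9/560 * v\<^sup>2))"
    using Q by (rule has_bochner_integral_integral_eq)
  have 3: "f 0 * exp (c * m) * (4 * h^3 / 3 * (1 + v / 10 + 9/560 * v\<^sup>2))
      = 2/3 * ?V * h\<^sup>2 * (exp (- v / 3) * (1 + v / 10 + 9/560 * v\<^sup>2))"
    by (rule rescale_exponential_weight[OF m_def v_def]) (use pos0 in \<open>simp add: h_def\<close>)
  have 4: "2/3 * ?V * h\<^sup>2 * (exp (- v / 3) * (1 + v / 10 + 9/560 * v\<^sup>2)) \<le> 2/3 * ?V * h\<^sup>2 * (1 - v / 6)"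
    using V by (intro mult_left_mono exp_series_comparison v) auto
  have 5: "(\<integral>x. (h\<^sup>2 - (x - m)\<^sup>2) * f x \<partial>lborel) = (h\<^sup>2 - m\<^sup>2) * ?V + 2 * m * (\<integral>x. x * f x \<partial>lborel) - ?S"
  proof -
    have hb: "has_bochner_integral lborel (\<lambda>x. ((h\<^sup>2 - m\<^sup>2) * f x + 2 * m * (x * f x)) - x\<^sup>2 * f x)
        (((h\<^sup>2 - m\<^sup>2) * ?V + 2 * m * (\<integral>x. x * f x \<partial>lborel)) - ?S)"
      using integrable_mult(1)[of "\<lambda>x. x"] integrable_mult(1)[of "\<lambda>x. x\<^sup>2"]
      by (intro has_bochner_integral_diff has_bochner_integral_add has_bochner_integral_mult_right
          has_bochner_integral_integrable i) (simp_all add: continuous_on_power)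
    have eq: "(\<lambda>x. (h\<^sup>2 - (x - m)\<^sup>2) * f x) = (\<lambda>x. ((h\<^sup>2 - m\<^sup>2) * f x + 2 * m * (x * f x)) - x\<^sup>2 * f x)"
      by (rule ext) (rule quadratic_weight_expand)
    show ?thesis
      by (rule trans[OF arg_cong[where f="integral\<^sup>L lborel", OF eq] has_bochner_integral_integral_eq[OF hb]])
  qed
  have le: "(h\<^sup>2 - m\<^sup>2) * ?V + 2 * m * (\<integral>x. x * f x \<partial>lborel) - ?S \<le> 2/3 * ?V * h\<^sup>2 * (1 - v / 6)"
    using 1 4 unfolding 2 3 5 by (rule order_trans)
  have "(h\<^sup>2 - m\<^sup>2) * ?V - ?S \<le> 2/3 * ?V * h\<^sup>2 * (1 - v / 6)"
    using le unfolding mean mult_zero_right add_0_right .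
  moreover have "m\<^sup>2 = h\<^sup>2 * v / 9" by (simp add: m_def v_def power2_eq_square)
  moreover have "f 0 * h = ?V / 2" using pos0 by (simp add: h_def)
  ultimately show ?thesis by (rule second_moment_ge_of_test_function)
qed

end

section \<open>Central sections of a centered convex body\<close>

text \<open>Upper semicontinuity of the measure of closed sets: a point that lies in \<open>S (p n)\<close> for infinitely
many \<open>n\<close> lies in the set at the limit, and the measure of the sets of points that occur after time
\<open>m\<close> decreases to that of their intersection.\<close>

lemma closed_superlevel_measure:
  fixes S :: "'p::metric_space \<Rightarrow> 'a::euclidean_space set"
  assumes P: "closed P" and graph: "closed {(p, x). p \<in> P \<and> x \<in> S p}" and bd: "\<And>p. p \<in> P \<Longrightarrow> S p \<subseteq> cball 0 \<rho>"
  shows "closed {p \<in> P. r \<le> measure lborel (S p)}"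
  unfolding closed_sequential_limits
proof (intro allI impI, elim conjE)
  fix p l assume p: "\<forall>n. p n \<in> {p \<in> P. r \<le> measure lborel (S p)}" and lim: "p \<longlonglongrightarrow> l"
  have pP: "p n \<in> P" and pr: "r \<le> measure lborel (S (p n))" for n using p by auto
  have lP: "l \<in> P" using P lim pP by (metis closed_sequentially)
  have cl: "closed (S q)" if "q \<in> P" for q
  proof -
    have "S q = (\<lambda>x. (q, x)) -` {(p, x). p \<in> P \<and> x \<in> S p}" using that by auto
    also have "closed \<dots>" by (intro closed_vimage graph continuous_intros)
    finally show ?thesis .
  qed
  define U where "U m = (\<Union>k\<in>{m..}. S (p k))" for m :: nat
  have Um [measurable, simp]: "U m \<in> sets borel" for m
    unfolding U_def using cl[OF pP] by (auto intro!: sets.countable_UN' borel_closed)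
  have Usub: "U m \<subseteq> cball 0 \<rho>" for m unfolding U_def using bd[OF pP] by blast
  have fm: "X \<in> fmeasurable lborel" if "X \<in> sets lborel" "X \<subseteq> cball 0 \<rho>" for X :: "'a set"
    using that emeasure_bounded_finite[OF bounded_subset[OF bounded_cball that(2)]]
      by (auto simp: fmeasurable_def)
  have "(\<lambda>m. measure lborel (U m)) \<longlonglongrightarrow> measure lborel (\<Inter>m. U m)"
  proof (rule Lim_measure_decseq)
    show "decseq U" unfolding U_def decseq_def by (meson UN_mono atLeast_subset_iff order_refl)
    show "emeasure lborel (U m) \<noteq> \<infinity>" for m using fm[OF _ Usub, of m] Um[of m] by (auto simp: fmeasurable_def)
  qed (use Um in auto)
  moreover have "r \<le> measure lborel (U m)" for m
  proof -
    have "measure lborel (S (p m)) \<le> measure lborel (U m)"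
      using cl[OF pP] by (intro measure_mono_fmeasurable fm Usub) (auto simp: U_def intro: borel_closed)
    then show ?thesis using pr[of m] by simp
  qed
  ultimately have r: "r \<le> measure lborel (\<Inter>m. U m)"
    by (intro LIMSEQ_le_const) auto
  have "(\<Inter>m. U m) \<subseteq> S l"
  proof
    fix x assume "x \<in> (\<Inter>m. U m)"
    then have "\<forall>m. \<exists>k\<ge>m. x \<in> S (p k)" by (auto simp: U_def)
    then obtain k where k: "\<And>m. k m \<ge> m" "\<And>m. x \<in> S (p (k m))" by metis
    have "filterlim k sequentially sequentially"
      using k(1) by (intro filterlim_at_top_mono[OF filterlim_ident]) auto
    then have "(\<lambda>m. (p (k m), x)) \<longlonglongrightarrow> (l, x)"
      by (intro tendsto_Pair filterlim_compose[OF lim] tendsto_const)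
    moreover have "(p (k m), x) \<in> {(p, x). p \<in> P \<and> x \<in> S p}" for m using pP k by auto
    ultimately have "(l, x) \<in> {(p, x). p \<in> P \<and> x \<in> S p}" using graph
      by (metis (no_types, lifting) closed_sequentially)
    then show "x \<in> S l" by simp
  qed
  moreover have "(\<Inter>m. U m) \<in> sets borel" by (intro sets.countable_INT'' Um) auto
  moreover have "S l \<in> fmeasurable lborel" using cl[OF lP] bd[OF lP] by (intro fm) (auto intro: borel_closed)
  ultimately have "measure lborel (\<Inter>m. U m) \<le> measure lborel (S l)" by (intro measure_mono_fmeasurable) auto
  with r show "l \<in> {p \<in> P. r \<le> measure lborel (S p)}" using lP by simp
qed

text \<open>A gap in \<open>E\<close> has end points \<open>p < q\<close> in \<open>E\<close>, whose midpoint would lie in the gap.\<close>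

lemma closed_midpoint_convex_real:
  fixes E :: "real set"
  assumes E: "closed E" and mid: "\<And>x y. x \<in> E \<Longrightarrow> y \<in> E \<Longrightarrow> (x + y) / 2 \<in> E"
  shows "convex E"
proof -
  have "z \<in> E" if xy: "x \<in> E" "y \<in> E" "x \<le> z" "z \<le> y" for x y z
  proof (rule ccontr)
    assume z: "z \<notin> E"
    define p where "p = Sup (E \<inter> {..z})"
    define q where "q = Inf (E \<inter> {z..})"
    have bdd: "bdd_above (E \<inter> {..z})" "bdd_below (E \<inter> {z..})" by (auto simp: bdd_above_def bdd_below_def)
    have p: "p \<in> E \<inter> {..z}" unfolding p_def
      using xy bdd by (intro closed_contains_Sup) (auto intro!: closed_Int E)
    have q: "q \<in> E \<inter> {z..}" unfolding q_def
      using xy bdd by (intro closed_contains_Inf) (auto intro!: closed_Int E)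
    have pq: "p < z" "z < q" using p q z by (auto simp: less_le)
    have "(p + q) / 2 \<in> E" using mid p q by auto
    then consider "(p + q) / 2 \<in> E \<inter> {..z}" | "(p + q) / 2 \<in> E \<inter> {z..}" by force
    then show False
    proof cases
      case 1 then have "(p + q) / 2 \<le> p" unfolding p_def using bdd by (intro cSup_upper) auto
      then show False using pq by simp
    next
      case 2 then have "q \<le> (p + q) / 2" unfolding q_def using bdd by (intro cInf_lower) auto
      then show False using pq by simp
    qed
  qed
  then have "is_interval E" unfolding is_interval_1 by blast
  then show ?thesis by (rule is_interval_convex)
qed

lemma section_function_midpoint:
  fixes K :: "'a::euclidean_space set"
  assumes K: "compact K" "convex K" and u: "norm u = 1"
  shows "section_function K u s * section_function K u t \<le> (section_function K u ((s + t) / 2))\<^sup>2"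
proof -
  let ?A = "section_function K u"
  have "emeasure lborel (slab_section K u s) * emeasure lborel (slab_section K u t)
      \<le> (emeasure lborel (slab_section K u ((s + t) / 2)))\<^sup>2"
  proof (rule brunn_minkowski_midpoint)
    fix x y assume x: "x \<in> slab_section K u s" and y: "y \<in> slab_section K u t"
    let ?z = "(1/2) *\<^sub>R (x + y)"
    have "(1/2) *\<^sub>R (x + (s - x \<bullet> u) *\<^sub>R u) + (1/2) *\<^sub>R (y + (t - y \<bullet> u) *\<^sub>R u) \<in> K"
      using x y K(2) by (intro convexD) (auto simp: slab_section_def)
    moreover have "(1/2) *\<^sub>R (x + (s - x \<bullet> u) *\<^sub>R u) + (1/2) *\<^sub>R (y + (t - y \<bullet> u) *\<^sub>R u)
        = ?z + ((s + t) / 2 - ?z \<bullet> u) *\<^sub>R u"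
      by (simp add: inner_add_left scaleR_right_distrib scaleR_left_distrib scaleR_left_diff_distrib scaleR_right_diff_distrib add_divide_distrib)
    ultimately show "?z \<in> slab_section K u ((s + t) / 2)"
      using x y by (simp add: slab_section_def inner_add_left)
  qed (use compact_slab_section[OF K(1) u] in \<open>auto intro: borel_compact\<close>)
  then have "ennreal (?A s * ?A t) \<le> ennreal ((?A ((s + t) / 2))\<^sup>2)"
    by (simp add: emeasure_slab_section[OF K(1) u] ennreal_mult ennreal_power section_function_nonneg)
  then show ?thesis by (simp add: ennreal_le_iff)
qed

text \<open>Brunn-Minkowski gives log-concavity for midpoints; semicontinuity in the height extends it to all
convex combinations.\<close>

lemma log_concave_section_function:
  fixes K :: "'a::euclidean_space set"
  assumes K: "compact K" "convex K" and u: "norm u = 1"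
  shows "log_concave (section_function K u)"
  unfolding log_concave_def
proof (intro allI impI)
  fix k c :: real assume k: "k > 0"
  let ?A = "section_function K u"
  obtain \<rho> where \<rho>: "K \<subseteq> cball 0 \<rho>"
    using compact_imp_bounded[OF K(1)] by (auto simp: bounded_iff subset_iff)
  show "convex {s. k * exp (c * s) \<le> ?A s}"
  proof (rule closed_midpoint_convex_real)
    fix s t assume st: "s \<in> {s. k * exp (c * s) \<le> ?A s}" "t \<in> {s. k * exp (c * s) \<le> ?A s}"
    have "(k * exp (c * ((s + t) / 2)))\<^sup>2 = (k * exp (c * s)) * (k * exp (c * t))"
      by (simp add: power2_eq_square mult_ac exp_add[symmetric]) (simp add: algebra_simps)
    also have "\<dots> \<le> ?A s * ?A t" using st k by (intro mult_mono) (auto intro: section_function_nonneg)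
    also have "\<dots> \<le> (?A ((s + t) / 2))\<^sup>2" by (rule section_function_midpoint[OF K u])
    finally show "(s + t) / 2 \<in> {s. k * exp (c * s) \<le> ?A s}"
      by (auto intro: power2_le_imp_le section_function_nonneg)
  next
    have clr: "closed {s \<in> {-\<rho>..\<rho>}. r \<le> ?A s}" for r
      unfolding section_function_def
    proof (rule closed_superlevel_measure[where \<rho>="\<rho> + \<rho> + 1"])
      have "closed (({-\<rho>..\<rho>} \<times> UNIV) \<inter> (\<lambda>z. ((u, fst z), snd z)) -` {(p, x). x \<in> slab_section K (fst p) (snd p)})"
        by (intro closed_Int closed_Times closed_vimage closed_slab_section_graph compact_imp_closed K continuous_intros closed_UNIV closed_atLeastAtMost)
      moreover have "{(s, x). s \<in> {-\<rho>..\<rho>} \<and> x \<in> slab_section K u s}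
          = ({-\<rho>..\<rho>} \<times> UNIV) \<inter> (\<lambda>z. ((u, fst z), snd z)) -` {(p, x). x \<in> slab_section K (fst p) (snd p)}"
        by auto
      ultimately show "closed {(s, x). s \<in> {-\<rho>..\<rho>} \<and> x \<in> slab_section K u s}" by (simp only:)
      show "slab_section K u s \<subseteq> cball 0 (\<rho> + \<rho> + 1)" if "s \<in> {-\<rho>..\<rho>}" for s
        using slab_section_subset_cball[OF \<rho> u, of s] that by (auto simp: subset_iff)
    qed simp
    show "closed {s. k * exp (c * s) \<le> ?A s}"
      unfolding closed_sequential_limits
    proof (intro allI impI, elim conjE)
      fix x l assume x: "\<forall>n. x n \<in> {s. k * exp (c * s) \<le> ?A s}" and lim: "x \<longlonglongrightarrow> l"
      have xr: "x n \<in> {-\<rho>..\<rho>}" for n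
      proof -
        have "0 < ?A (x n)" using x k by (auto intro: less_le_trans[of 0 "k * exp (c * x n)"])
        then have "slab_section K u (x n) \<noteq> {}" by (auto simp: section_function_def)
        then show ?thesis using abs_le_of_slab_section[OF \<rho> u] by fastforce
      qed
      have le: "r \<le> ?A l" if "r < k * exp (c * l)" for r
      proof -
        have "(\<lambda>n. k * exp (c * x n)) \<longlonglongrightarrow> k * exp (c * l)" by (intro tendsto_intros lim)
        then have "eventually (\<lambda>n. r < k * exp (c * x n)) sequentially" using that by (rule order_tendstoD)
        then have ev: "eventually (\<lambda>n. x n \<in> {s \<in> {-\<rho>..\<rho>}. r \<le> ?A s}) sequentially"
        proof eventually_elim
          case (elim n)
          moreover have "k * exp (c * x n) \<le> ?A (x n)" using x by auto
          ultimately show ?case using xr[of n] by auto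
        qed
        have "l \<in> {s \<in> {-\<rho>..\<rho>}. r \<le> ?A s}"
          by (rule Lim_in_closed_set[OF clr ev _ lim]) simp
        then show ?thesis by simp
      qed
      show "l \<in> {s. k * exp (c * s) \<le> ?A s}" using le by (auto intro: dense_le)
    qed
  qed
qed

lemma measure_pos_if_interior:
  fixes S :: "'a::euclidean_space set"
  assumes "compact S" "interior S \<noteq> {}"
  shows "0 < measure lborel S"
proof -
  obtain x e where xe: "e > 0" "ball x e \<subseteq> S" using assms(2) mem_interior by (metis ex_in_conv)
  have "0 < measure lborel (ball x e)" using content_ball_pos[OF xe(1), of x] by simp
  also have "\<dots> \<le> measure lborel S"
    using xe assms(1) emeasure_compact_finite[OF assms(1)]
    by (intro measure_mono_fmeasurable) (auto simp: fmeasurable_def borel_compact)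
  finally show ?thesis .
qed

lemma section_profile_section_function:
  fixes K :: "'a::euclidean_space set"
  assumes K: "compact K" "convex K" "0 \<in> interior K" and u: "norm u = 1"
  obtains R B r where "section_profile (section_function K u) R B r"
proof -
  obtain \<rho> where \<rho>: "K \<subseteq> cball 0 \<rho>"
    using compact_imp_bounded[OF K(1)] by (auto simp: bounded_iff subset_iff)
  obtain e where e: "e > 0" "ball 0 e \<subseteq> K" using K(3) mem_interior by blast
  have uu: "u \<bullet> u = 1" using u by (simp add: dot_square_norm)
  have supp: "section_function K u s = 0" if "\<rho> < \<bar>s\<bar>" for s
  proof -
    have "slab_section K u s = {}" using abs_le_of_slab_section[OF \<rho> u] that by fastforce
    then show ?thesis by (simp add: section_function_def)
  qed
  have bound: "section_function K u s \<le> measure lborel (cball 0 (\<rho> + \<rho> + 1) :: 'a set)" for s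
  proof (cases "\<rho> < \<bar>s\<bar>")
    case False
    then have "slab_section K u s \<subseteq> cball 0 (\<rho> + \<rho> + 1)"
      using slab_section_subset_cball[OF \<rho> u, of s] by (auto simp: subset_iff)
    then show ?thesis unfolding section_function_def
      using compact_slab_section[OF K(1) u] emeasure_compact_finite[of "cball 0 (\<rho> + \<rho> + 1) :: 'a set"]
      by (intro measure_mono_fmeasurable) (auto simp: fmeasurable_def borel_compact)
  qed (simp add: supp)
  have pos: "0 < section_function K u s" if s: "\<bar>s\<bar> < e / 2" for s
  proof -
    define d where "d = min (e / 4) (1 / 2)"
    have d: "d > 0" "d \<le> e / 4" "d \<le> 1/2" using e by (auto simp: d_def)
    have "ball ((1/2) *\<^sub>R u) d \<subseteq> slab_section K u s"
    proof
      fix x assume "x \<in> ball ((1/2) *\<^sub>R u) d"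
      define z where "z = x - (1/2) *\<^sub>R u"
      have z: "norm z < d" using \<open>x \<in> _\<close> by (simp add: z_def dist_norm norm_minus_commute)
      have x: "x = z + (1/2) *\<^sub>R u" by (simp add: z_def)
      have zu: "\<bar>z \<bullet> u\<bar> \<le> norm z" using Cauchy_Schwarz_ineq2[of z u] u by simp
      have xu: "x \<bullet> u = z \<bullet> u + 1/2" by (simp add: x inner_add_left uu)
      have "x + (s - x \<bullet> u) *\<^sub>R u = z + (s - z \<bullet> u) *\<^sub>R u"
        unfolding xu by (simp add: x algebra_simps)
      moreover have "norm (z + (s - z \<bullet> u) *\<^sub>R u) \<le> norm z + \<bar>s - z \<bullet> u\<bar>"
        using norm_triangle_ineq[of z "(s - z \<bullet> u) *\<^sub>R u"] u by simp
      moreover have "norm z + \<bar>s - z \<bullet> u\<bar> < e" using z zu s d by linarith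
      ultimately have "x + (s - x \<bullet> u) *\<^sub>R u \<in> ball 0 e" by simp
      then show "x \<in> slab_section K u s"
        using e(2) xu zu z d by (auto simp: slab_section_def)
    qed
    then have "interior (slab_section K u s) \<noteq> {}"
      using d(1) interior_maximal[OF _ open_ball] by (metis centre_in_ball empty_iff subsetD)
    then show ?thesis unfolding section_function_def
      by (intro measure_pos_if_interior compact_slab_section K u)
  qed
  show thesis
  proof (rule that)
    show "section_profile (section_function K u) \<rho> (measure lborel (cball 0 (\<rho> + \<rho> + 1) :: 'a set)) (e / 2)"
      by standard (use e supp bound pos borel_measurable_section_function[OF K(1) u] section_function_nonneg
          log_concave_section_function[OF K(1,2) u] in auto)
  qed
qed

lemma set_integrable_compact_continuous:
  fixes f :: "'a::euclidean_space \<Rightarrow> 'b::{banach, second_countable_topology}"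
  assumes "compact K" "continuous_on UNIV f"
  shows "set_integrable lborel K f"
  unfolding set_integrable_def
  by (rule borel_integrable_compact[OF assms(1) continuous_on_subset[OF assms(2)]]) simp

lemma integral_eq_barycentre:
  assumes "convex_body K"
  shows "(LINT x:K|lborel. x) = measure lborel K *\<^sub>R barycentre K"
  using measure_pos_if_interior[of K] assms by (simp add: convex_body_def barycentre_def)

lemma integral_inner_eq_barycentre:
  assumes "convex_body K"
  shows "(LINT x:K|lborel. x \<bullet> u) = measure lborel K * (barycentre K \<bullet> u)"
proof -
  have "compact K" using assms by (simp add: convex_body_def)
  then have "set_integrable lborel K (\<lambda>x. x)" by (intro set_integrable_compact_continuous continuous_intros)
  then have "(LINT x:K|lborel. x \<bullet> u) = (LINT x:K|lborel. x) \<bullet> u"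
    unfolding set_lebesgue_integral_def set_integrable_def by (subst integral_inner_left[symmetric]) auto
  then show ?thesis by (simp add: integral_eq_barycentre[OF assms])
qed

lemma set_integral_pos:
  fixes f :: "'a::euclidean_space \<Rightarrow> real"
  assumes K: "compact K" "interior K \<noteq> {}" and f: "continuous_on UNIV f" "\<And>x. x \<in> K \<Longrightarrow> 0 \<le> f x"
    and neg: "negligible {x. f x = 0}"
  shows "0 < (LINT x:K|lborel. f x)"
proof -
  have i: "integrable lborel (\<lambda>x. indicator K x *\<^sub>R f x)"
    using set_integrable_compact_continuous[OF K(1) f(1)] by (simp add: set_integrable_def)
  have nn: "0 \<le> indicator K x *\<^sub>R f x" for x using f(2) by (auto split: split_indicator)
  have "0 \<le> (LINT x:K|lborel. f x)"
    unfolding set_lebesgue_integral_def using nn by (intro integral_nonneg_AE AE_I2)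
  moreover have "(LINT x:K|lborel. f x) \<noteq> 0"
  proof
    assume "(LINT x:K|lborel. f x) = 0"
    then have "AE x in lborel. indicator K x *\<^sub>R f x = 0"
      unfolding set_lebesgue_integral_def using integral_nonneg_eq_0_iff_AE[OF i] nn by auto
    moreover have "closed {x. f x = 0}" using f(1) by (intro closed_Collect_eq) auto
    then have "{x. f x = 0} \<in> null_sets lborel"
      using neg by (auto simp: negligible_iff_null_sets null_sets_completion_iff borel_closed)
    then have "AE x in lborel. f x \<noteq> 0" by (auto dest: AE_not_in)
    ultimately have "AE x in lborel. x \<notin> K" by eventually_elim (auto split: split_indicator_asm)
    then have "emeasure lborel K = 0"
      using K(1) by (subst (asm) AE_iff_measurable[of K]) (auto simp: borel_compact)
    then have "measure lborel K = 0" by (simp add: measure_def)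
    then show False using measure_pos_if_interior[OF K] by simp
  qed
  ultimately show ?thesis by simp
qed

text \<open>Otherwise some hyperplane has the whole of \<open>K\<close> on one side and the barycentre on the other side or
on itself. The affine function that defines it is then nonnegative on \<open>K\<close> with integral at most \<open>0\<close>,
although it vanishes only on a null set.\<close>

lemma barycentre_in_interior:
  assumes K: "convex_body K"
  shows "barycentre K \<in> interior K"
proof (rule ccontr)
  assume b: "barycentre K \<notin> interior K"
  have cK: "compact K" "convex K" "interior K \<noteq> {}" using K by (auto simp: convex_body_def)
  have "convex (interior K)" "convex {barycentre K}" "interior K \<noteq> {}" "{barycentre K} \<inter> interior K = {}"
    using cK b by (auto intro: convex_interior)
  then obtain a \<beta> where a: "a \<noteq> 0" "\<And>x. x \<in> {barycentre K} \<Longrightarrow> a \<bullet> x \<le> \<beta>" "\<And>x. x \<in> interior K \<Longrightarrow> a \<bullet> x \<ge> \<beta>"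
    using separating_hyperplane_sets[of "{barycentre K}" "interior K"] by blast
  have "K \<subseteq> closure (interior K)"
    using convex_closure_interior[OF cK(2,3)] closure_subset by auto
  also have "\<dots> \<subseteq> {x. a \<bullet> x \<ge> \<beta>}"
    using a(3) by (intro closure_minimal closed_halfspace_ge) auto
  finally have ge: "a \<bullet> x \<ge> \<beta>" if "x \<in> K" for x using that by auto
  have "0 < (LINT x:K|lborel. (x \<bullet> a - \<beta>))"
  proof (rule set_integral_pos[OF cK(1,3)])
    show "negligible {x. x \<bullet> a - \<beta> = 0}"
      using negligible_hyperplane[of a \<beta>] a(1) by (simp add: inner_commute)
  qed (use ge in \<open>auto simp: inner_commute intro!: continuous_intros\<close>)
  also have "(LINT x:K|lborel. (x \<bullet> a - \<beta>)) = (LINT x:K|lborel. x \<bullet> a) - (LINT x:K|lborel. \<beta>)"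
    by (intro set_integral_diff set_integrable_compact_continuous cK continuous_intros)
  also have "(LINT x:K|lborel. \<beta>) = measure lborel K * \<beta>"
    by (simp add: set_lebesgue_integral_def)
  also have "(LINT x:K|lborel. x \<bullet> a) = measure lborel K * (barycentre K \<bullet> a)"
    by (rule integral_inner_eq_barycentre[OF K])
  finally have "\<beta> < barycentre K \<bullet> a"
    using measure_pos_if_interior[OF cK(1,3)] by (simp add: right_diff_distrib[symmetric] zero_less_mult_iff)
  then show False using a(2) by (simp add: inner_commute)
qed

theorem central_section_bounds:
  fixes K :: "'a::euclidean_space set"
  assumes K: "centered_convex_body K" and u: "norm u = 1"
  defines "V \<equiv> measure lborel K" and "A \<equiv> section_function K u 0" and "q \<equiv> (LINT x:K|lborel. (x \<bullet> u)\<^sup>2)"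
  shows "0 < A" "V ^ 3 / 12 \<le> A\<^sup>2 * q" "A\<^sup>2 * q \<le> V ^ 3 / 2"
proof -
  have cK: "compact K" "convex K" "convex_body K" using K
    by (auto simp: convex_body_def centered_convex_body_def)
  have "0 \<in> interior K" using barycentre_in_interior[OF cK(3)] K by (simp add: centered_convex_body_def)
  then obtain R B r where "section_profile (section_function K u) R B r"
    using section_profile_section_function[OF cK(1,2) _ u] by metis
  then interpret section_profile "section_function K u" R B r .
  have V: "(\<integral>s. section_function K u s \<partial>lborel) = V"
    using integral_by_sections[OF cK(1) u, of "\<lambda>_. 1"] by (simp add: V_def set_lebesgue_integral_def)
  have m: "(\<integral>s. s * section_function K u s \<partial>lborel) = 0"
    using integral_by_sections[OF cK(1) u, of "\<lambda>s. s"] integral_inner_eq_barycentre[OF cK(3), of u] K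
    by (simp add: centered_convex_body_def)
  have q: "(\<integral>s. s\<^sup>2 * section_function K u s \<partial>lborel) = q"
    using integral_by_sections[OF cK(1) u, of "\<lambda>s. s\<^sup>2"] by (simp add: q_def)
  show "0 < A" unfolding A_def by (rule pos0)
  show "V ^ 3 / 12 \<le> A\<^sup>2 * q" using second_moment_ge[OF m] unfolding V q A_def .
  show "A\<^sup>2 * q \<le> V ^ 3 / 2" using second_moment_le[OF m] unfolding V q A_def .
qed

section \<open>The inertia matrix and the isotropic constant\<close>

text \<open>The first variation of \<open>B x x / \<bar>x\<bar>\<^sup>2\<close> at its maximizer \<open>u\<close> in the direction \<open>v\<close> is \<open>2 B u v\<close>.\<close>

lemma rayleigh_maximizer_orthogonal:
  fixes B :: "'a::euclidean_space \<Rightarrow> 'a \<Rightarrow> real"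
  assumes bil: "bilinear B" and sym: "\<And>x y. B x y = B y x"
    and S: "subspace S" and u: "u \<in> S" "norm u = 1"
    and max: "\<And>x. x \<in> S \<Longrightarrow> norm x = 1 \<Longrightarrow> B x x \<le> B u u"
    and v: "v \<in> S" "u \<bullet> v = 0"
  shows "B u v = 0"
proof -
  have scale: "B x x \<le> B u u * (norm x)\<^sup>2" if x: "x \<in> S" for x
  proof (cases "x = 0")
    case True then show ?thesis using bil by (simp add: bilinear_lzero)
  next
    case False
    let ?y = "(1 / norm x) *\<^sub>R x"
    have "B ?y ?y \<le> B u u" using False x S by (intro max) (auto simp: subspace_scale)
    moreover have "B ?y ?y = B x x / (norm x)\<^sup>2"
      by (simp only: bilinear_lmul[OF bil] bilinear_rmul[OF bil]) (simp add: power2_eq_square)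
    ultimately show ?thesis using False by (simp add: divide_le_eq)
  qed
  define c where "c = \<bar>B u u * (norm v)\<^sup>2 - B v v\<bar>"
  define b where "b = B u v"
  \<comment> \<open>A step so small that the quadratic term cannot compensate a linear term \<open>b\<close> other than \<open>0\<close>.\<close>
  define t where "t = b / (c + 1)"
  have c: "c \<ge> 0" by (simp add: c_def)
  have "B (u + t *\<^sub>R v) (u + t *\<^sub>R v) \<le> B u u * (norm (u + t *\<^sub>R v))\<^sup>2"
    using S u v by (intro scale subspace_add subspace_scale)
  moreover have "B (u + t *\<^sub>R v) (u + t *\<^sub>R v) = B u u + 2 * t * b + t\<^sup>2 * B v v"
    by (simp only: bilinear_ladd[OF bil] bilinear_radd[OF bil] bilinear_lmul[OF bil] bilinear_rmul[OF bil] sym[of v u] b_def)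
       (simp add: power2_eq_square algebra_simps)
  moreover have "(norm (u + t *\<^sub>R v))\<^sup>2 = 1 + t\<^sup>2 * (norm v)\<^sup>2"
  proof -
    have "u \<bullet> u = 1" using u(2) by (simp add: dot_square_norm)
    then show ?thesis
      using v(2) by (simp add: power2_norm_eq_inner inner_add_left inner_add_right inner_commute[of v u] power2_eq_square[of t])
  qed
  ultimately have "2 * t * b \<le> t\<^sup>2 * (B u u * (norm v)\<^sup>2 - B v v)" by (simp add: algebra_simps)
  also have "\<dots> \<le> t\<^sup>2 * c" unfolding c_def by (intro mult_left_mono) auto
  finally have "2 * t * b \<le> t\<^sup>2 * c" .
  then have "2 * t * b * (c + 1)\<^sup>2 \<le> t\<^sup>2 * c * (c + 1)\<^sup>2" by (intro mult_right_mono) auto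
  moreover have "t * (c + 1) = b" using c by (simp add: t_def)
  then have "2 * b * (t * (c + 1)) * (c + 1) = 2 * b\<^sup>2 * (c + 1)" "(t * (c + 1))\<^sup>2 * c = b\<^sup>2 * c"
    by (auto simp: power2_eq_square)
  moreover have "2 * t * b * (c + 1)\<^sup>2 = 2 * b * (t * (c + 1)) * (c + 1)"
      "t\<^sup>2 * c * (c + 1)\<^sup>2 = (t * (c + 1))\<^sup>2 * c"
    by (simp_all add: power2_eq_square)
  ultimately have "2 * b\<^sup>2 * (c + 1) \<le> b\<^sup>2 * c" by linarith
  then have "b\<^sup>2 * (c + 2) \<le> 0" by (simp add: algebra_simps)
  then have "b\<^sup>2 \<le> 0" using c by (simp add: mult_le_0_iff)
  then show ?thesis by (simp add: b_def)
qed

text \<open>Split off a unit vector that maximizes the quadratic form on \<open>S\<close> and continue in its orthogonal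
complement.\<close>

lemma orthonormal_diagonalizing_basis:
  fixes B :: "'a::euclidean_space \<Rightarrow> 'a \<Rightarrow> real"
  assumes bil: "bilinear B" and sym: "\<And>x y. B x y = B y x" and S: "subspace S"
  shows "\<exists>C\<subseteq>S. pairwise orthogonal C \<and> (\<forall>b\<in>C. norm b = 1) \<and> span C = S \<and> pairwise (\<lambda>x y. B x y = 0) C"
  using S
proof (induction "dim S" arbitrary: S rule: less_induct)
  case less
  show ?case
  proof (cases "S = {0}")
    case True then show ?thesis by (intro exI[of _ "{}"]) auto
  next
    case False
    have "continuous_on UNIV (\<lambda>x. B x x)"
      using bilinear_continuous_on_compose[OF continuous_on_id continuous_on_id] bil
      by (auto simp: bilinear_conv_bounded_bilinear[symmetric])
    moreover obtain x where x: "x \<in> S" "x \<noteq> 0" using False subspace_0[OF less.prems] by auto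
    then have "(1 / norm x) *\<^sub>R x \<in> S \<inter> sphere 0 1" using less.prems by (auto simp: subspace_scale)
    moreover have "compact (S \<inter> sphere 0 1)"
      using closed_subspace[OF less.prems] by (intro closed_Int_compact compact_sphere)
    ultimately obtain u where u: "u \<in> S" "norm u = 1" and max: "\<And>x. x \<in> S \<Longrightarrow> norm x = 1 \<Longrightarrow> B x x \<le> B u u"
      using continuous_attains_sup[of "S \<inter> sphere 0 1" "\<lambda>x. B x x"] continuous_on_subset by fastforce
    define S' where "S' = S \<inter> {x. u \<bullet> x = 0}"
    have sub: "subspace S'" unfolding S'_def by (intro subspace_inter less.prems subspace_hyperplane)
    have "u \<notin> S'" using u(2) by (auto simp: S'_def)
    then have "S' \<subset> S" using u(1) unfolding S'_def by blast
    then have "dim S' < dim S"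
      using dim_psubset sub less.prems by (metis span_eq_iff)
    then obtain C where C: "C \<subseteq> S'" "pairwise orthogonal C" "\<forall>b\<in>C. norm b = 1" "span C = S'"
        "pairwise (\<lambda>x y. B x y = 0) C"
      using less.hyps[OF _ sub] by blast
    have perp: "u \<bullet> v = 0" "B u v = 0" if "v \<in> C" for v
      using C(1) that rayleigh_maximizer_orthogonal[OF bil sym less.prems u max, of v] by (auto simp: S'_def)
    have "span (insert u C) = S"
    proof
      show "span (insert u C) \<subseteq> S" using C(1) u less.prems by (intro span_minimal) (auto simp: S'_def)
      show "S \<subseteq> span (insert u C)"
      proof
        fix y assume y: "y \<in> S"
        have "y - (u \<bullet> y) *\<^sub>R u \<in> S'"
          using y u less.prems
            by (auto simp: S'_def subspace_diff subspace_scale inner_diff_right dot_square_norm)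
        then show "y \<in> span (insert u C)" unfolding span_insert C(4) by auto
      qed
    qed
    moreover have "pairwise orthogonal (insert u C)" "pairwise (\<lambda>x y. B x y = 0) (insert u C)"
      using C perp sym by (auto simp: pairwise_insert orthogonal_def inner_commute)
    ultimately show ?thesis
      using C u by (intro exI[of _ "insert u C"]) (auto simp: S'_def)
  qed
qed

lemma orthogonal_matrix_iff_rows:
  fixes Q :: "real ^ 'n ^ 'n"
  shows "orthogonal_matrix Q \<longleftrightarrow> (\<forall>i. norm (Q $ i) = 1) \<and> (\<forall>i j. i \<noteq> j \<longrightarrow> orthogonal (Q $ i) (Q $ j))"
  unfolding orthogonal_matrix_orthonormal_rows by (simp add: row_def vec_lambda_eta)

lemma matrix_of_orthonormal_set:
  fixes C :: "(real ^ 'n) set"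
  assumes C: "pairwise orthogonal C" "\<forall>b\<in>C. norm b = 1" "span C = UNIV"
  obtains Q :: "real ^ 'n ^ 'n" where "orthogonal_matrix Q" "bij_betw (($) Q) UNIV C"
proof -
  have ind: "independent C" using C by (intro pairwise_orthogonal_independent) auto
  have "card C = dim (UNIV :: (real ^ 'n) set)"
    using dim_eq_card_independent[OF ind] C(3) dim_span by metis
  then have "card C = CARD('n)" by (simp add: dim_UNIV)
  then obtain \<pi> where \<pi>: "bij_betw \<pi> (UNIV :: 'n set) C"
    using finite_same_card_bij[OF finite independent_imp_finite[OF ind]] by auto
  define Q :: "real ^ 'n ^ 'n" where "Q = (\<chi> i. \<pi> i)"
  have Qi: "Q $ i = \<pi> i" for i by (simp add: Q_def)
  have mem: "\<pi> i \<in> C" for i using \<pi> by (auto simp: bij_betw_def)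
  have inj: "\<pi> i = \<pi> j \<longleftrightarrow> i = j" for i j using \<pi> by (auto simp: bij_betw_def inj_def)
  show thesis
  proof (rule that)
    show "orthogonal_matrix Q"
      unfolding orthogonal_matrix_iff_rows Qi using C mem inj by (auto simp: pairwise_def)
    show "bij_betw (($) Q) UNIV C" using \<pi> by (simp add: Qi cong: bij_betw_cong)
  qed
qed

lemma conjugate_entry:
  fixes A J :: "real ^ 'n ^ 'n"
  shows "(A ** J ** transpose A) $ i $ j = A $ i \<bullet> (J *v A $ j)"
proof -
  have "(A ** J ** transpose A) $ i $ j = (\<Sum>k\<in>UNIV. (\<Sum>l\<in>UNIV. A $ i $ l * J $ l $ k) * A $ j $ k)"
    by (simp add: matrix_matrix_mult_def transpose_def)
  also have "\<dots> = (\<Sum>k\<in>UNIV. \<Sum>l\<in>UNIV. A $ i $ l * (J $ l $ k * A $ j $ k))"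
    by (simp add: sum_distrib_right mult.assoc)
  also have "\<dots> = (\<Sum>l\<in>UNIV. \<Sum>k\<in>UNIV. A $ i $ l * (J $ l $ k * A $ j $ k))" by (rule sum.swap)
  also have "\<dots> = A $ i \<bullet> (J *v A $ j)"
    by (simp add: inner_vec_def matrix_vector_mult_def sum_distrib_left)
  finally show ?thesis .
qed

theorem symmetric_matrix_diagonalizable:
  fixes J :: "real ^ 'n ^ 'n"
  assumes "transpose J = J"
  obtains Q where "orthogonal_matrix Q" "\<And>i j. i \<noteq> j \<Longrightarrow> Q $ i \<bullet> (J *v Q $ j) = 0"
proof -
  let ?B = "\<lambda>x y. x \<bullet> (J *v y)"
  have sym: "?B x y = ?B y x" for x y
    using assms by (metis dot_lmul_matrix inner_commute transpose_matrix_vector)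
  have bil: "bilinear ?B"
    by (auto simp: bilinear_def linear_iff inner_add_left inner_add_right matrix_vector_right_distrib matrix_vector_mult_scaleR)
  obtain C where C: "pairwise orthogonal C" "\<forall>b\<in>C. norm b = 1" "span C = UNIV" "pairwise (\<lambda>x y. ?B x y = 0) C"
    using orthonormal_diagonalizing_basis[OF bil sym subspace_UNIV] by blast
  obtain Q :: "real ^ 'n ^ 'n" where Q: "orthogonal_matrix Q" "bij_betw (($) Q) UNIV C"
    using matrix_of_orthonormal_set[OF C(1-3)] by blast
  show thesis
  proof (rule that[OF Q(1)])
    fix i j :: 'n assume "i \<noteq> j"
    then have "Q $ i \<in> C" "Q $ j \<in> C" "Q $ i \<noteq> Q $ j" using Q(2) by (auto simp: bij_betw_def inj_def)
    then show "?B (Q $ i) (Q $ j) = 0" using C(4) by (auto simp: pairwise_def)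
  qed
qed

definition inertia_matrix :: "(real ^ 'n) set \<Rightarrow> real ^ 'n ^ 'n" where
  "inertia_matrix K = (\<chi> i j. LINT x:K|lborel. (x - barycentre K) $ i * (x - barycentre K) $ j)"

lemma inertia_matrix_symmetric: "transpose (inertia_matrix K) = inertia_matrix K"
  by (simp add: inertia_matrix_def transpose_def mult.commute)

lemma inertia_matrix_bilinear:
  fixes K :: "(real ^ 'n) set"
  assumes K: "compact K"
  shows "u \<bullet> (inertia_matrix K *v v) = (LINT x:K|lborel. ((x - barycentre K) \<bullet> u) * ((x - barycentre K) \<bullet> v))"
proof -
  let ?y = "\<lambda>x. x - barycentre K"
  have i: "integrable lborel (\<lambda>x. indicator K x *\<^sub>R (u $ i * v $ j * (?y x $ i * ?y x $ j)))" for i j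
    using set_integrable_compact_continuous[OF K, of "\<lambda>x. u $ i * v $ j * (?y x $ i * ?y x $ j)"]
    by (simp add: set_integrable_def continuous_intros)
  have "u \<bullet> (inertia_matrix K *v v)
      = (\<Sum>i\<in>UNIV. \<Sum>j\<in>UNIV. LINT x:K|lborel. u $ i * v $ j * (?y x $ i * ?y x $ j))"
    by (simp add: inner_vec_def matrix_vector_mult_def inertia_matrix_def sum_distrib_left mult_ac)
  also have "\<dots> = (LINT x:K|lborel. (\<Sum>i\<in>UNIV. \<Sum>j\<in>UNIV. u $ i * v $ j * (?y x $ i * ?y x $ j)))"
  proof -
    have "has_bochner_integral lborel (\<lambda>x. \<Sum>i\<in>UNIV. \<Sum>j\<in>UNIV. indicator K x *\<^sub>R (u $ i * v $ j
        * (?y x $ i * ?y x $ j)))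
       (\<Sum>i\<in>UNIV. \<Sum>j\<in>UNIV. LINT x:K|lborel. u $ i * v $ j * (?y x $ i * ?y x $ j))"
      unfolding set_lebesgue_integral_def
        by (intro has_bochner_integral_sum has_bochner_integral_integrable i)
    then show ?thesis
      unfolding set_lebesgue_integral_def scaleR_sum_right[symmetric] by (simp only: has_bochner_integral_iff)
  qed
  also have "\<dots> = (LINT x:K|lborel. (?y x \<bullet> u) * (?y x \<bullet> v))"
    by (simp add: inner_vec_def sum_product mult_ac)
  finally show ?thesis .
qed

lemma inertia_matrix_quadratic:
  fixes K :: "(real ^ 'n) set"
  assumes "compact K" "barycentre K = 0"
  shows "u \<bullet> (inertia_matrix K *v u) = (LINT x:K|lborel. (x \<bullet> u)\<^sup>2)"
  using inertia_matrix_bilinear[OF assms(1)] assms(2) by (simp add: power2_eq_square)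

lemma inertia_matrix_pos:
  fixes K :: "(real ^ 'n) set"
  assumes K: "convex_body K" and u: "u \<noteq> 0"
  shows "0 < u \<bullet> (inertia_matrix K *v u)"
proof -
  have cK: "compact K" "interior K \<noteq> {}" using K by (auto simp: convex_body_def)
  have "0 < (LINT x:K|lborel. ((x - barycentre K) \<bullet> u) * ((x - barycentre K) \<bullet> u))"
  proof (rule set_integral_pos[OF cK])
    have "{x. ((x - barycentre K) \<bullet> u) * ((x - barycentre K) \<bullet> u) = 0} = {x. u \<bullet> x = u \<bullet> barycentre K}"
      by (auto simp: inner_diff_left inner_commute[of u])
    then show "negligible {x. ((x - barycentre K) \<bullet> u) * ((x - barycentre K) \<bullet> u) = 0}"
      using u negligible_hyperplane[of u] by simp
  qed (auto intro!: continuous_intros)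
  then show ?thesis by (simp add: inertia_matrix_bilinear[OF cK(1)])
qed

lemma convex_body_affine_image:
  fixes A :: "real ^ 'n ^ 'n"
  assumes K: "convex_body K" and A: "det A \<noteq> 0"
  shows "convex_body ((\<lambda>x. a + A *v x) ` K)"
proof -
  have cK: "compact K" "convex K" "interior K \<noteq> {}" using K by (auto simp: convex_body_def)
  have eq: "(\<lambda>x. a + A *v x) ` K = (+) a ` ((*v) A ` K)" by (simp add: image_image)
  have "surj ((*v) A)" using A unfolding invertible_det_nz[symmetric] invertible_def
    by (auto simp: matrix_right_invertible_surjective[symmetric])
  then have "interior ((*v) A ` K) \<noteq> {}"
    using interior_surjective_linear_image[of "(*v) A" K] cK by (auto simp: matrix_vector_mul_linear)
  then have "interior ((\<lambda>x. a + A *v x) ` K) \<noteq> {}" unfolding eq by (simp add: interior_translation)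
  moreover have "convex ((\<lambda>x. a + A *v x) ` K)" unfolding eq
    by (intro convex_translation convex_linear_image cK matrix_vector_mul_linear)
  moreover have "compact ((\<lambda>x. a + A *v x) ` K)"
    by (intro compact_continuous_image cK continuous_intros linear_continuous_on) auto
  ultimately show ?thesis by (simp add: convex_body_def)
qed

lemma barycentre_affine_image:
  fixes A :: "real ^ 'n ^ 'n"
  assumes K: "convex_body K" and A: "det A \<noteq> 0"
  shows "barycentre ((\<lambda>x. a + A *v x) ` K) = a + A *v barycentre K"
proof -
  let ?K = "(\<lambda>x. a + A *v x) ` K"
  have cK: "compact K" "interior K \<noteq> {}" using K by (auto simp: convex_body_def)
  have V: "measure lborel K > 0" using measure_pos_if_interior[OF cK] .
  have i: "set_integrable lborel K (\<lambda>x. x)" "set_integrable lborel K (\<lambda>x. A *v x)"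
      "set_integrable lborel K (\<lambda>x. a)"
    by (intro set_integrable_compact_continuous cK(1) continuous_intros linear_continuous_on; simp)+
  have "(LINT y:?K|lborel. y) = \<bar>det A\<bar> *\<^sub>R (LINT x:K|lborel. a + A *v x)"
    by (rule set_integral_affine_image[OF A cK(1)]) simp
  also have "(LINT x:K|lborel. a + A *v x) = (LINT x:K|lborel. a) + (LINT x:K|lborel. A *v x)"
    by (intro set_integral_add i)
  also have "(LINT x:K|lborel. a) = measure lborel K *\<^sub>R a"
    using cK(1) emeasure_compact_finite[OF cK(1)] by (simp add: set_lebesgue_integral_def borel_compact)
  also have "(LINT x:K|lborel. A *v x) = A *v (LINT x:K|lborel. x)"
    using integral_bounded_linear[of "(*v) A" lborel "\<lambda>x. indicator K x *\<^sub>R x"] i(1)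
    by (simp add: set_lebesgue_integral_def set_integrable_def matrix_vector_mult_scaleR)
  also have "(LINT x:K|lborel. x) = measure lborel K *\<^sub>R barycentre K" by (rule integral_eq_barycentre[OF K])
  finally show ?thesis
    using V A by (simp add: barycentre_def[of ?K] measure_affine_image[OF A cK(1)] matrix_vector_mult_scaleR scaleR_add_right)
qed

theorem inertia_matrix_affine_image:
  fixes A :: "real ^ 'n ^ 'n"
  assumes K: "convex_body K" and A: "det A \<noteq> 0"
  shows "inertia_matrix ((\<lambda>x. a + A *v x) ` K) = \<bar>det A\<bar> *\<^sub>R (A ** inertia_matrix K ** transpose A)"
proof -
  have cK: "compact K" using K by (auto simp: convex_body_def)
  have "inertia_matrix ((\<lambda>x. a + A *v x) ` K) $ i $ j = \<bar>det A\<bar> * (A $ i \<bullet> (inertia_matrix K *v A $ j))"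
      for i j
  proof -
    let ?b = "barycentre K"
    have comp: "(a + A *v x - (a + A *v ?b)) $ i = (x - ?b) \<bullet> A $ i" for x i
      by (simp add: matrix_vector_mul_component inner_diff_left inner_diff_right inner_commute)
    have "inertia_matrix ((\<lambda>x. a + A *v x) ` K) $ i $ j
        = (LINT y:(\<lambda>x. a + A *v x) ` K|lborel. (y - (a + A *v ?b)) $ i * (y - (a + A *v ?b)) $ j)"
      by (simp add: inertia_matrix_def barycentre_affine_image[OF K A])
    also have "\<dots> = \<bar>det A\<bar> *\<^sub>R (LINT x:K|lborel. (a + A *v x - (a + A *v ?b)) $ i
        * (a + A *v x - (a + A *v ?b)) $ j)"
      by (rule set_integral_affine_image[OF A cK]) (intro borel_measurable_continuous_onI continuous_intros)
    also have "\<dots> = \<bar>det A\<bar> * (A $ i \<bullet> (inertia_matrix K *v A $ j))"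
      unfolding comp inertia_matrix_bilinear[OF cK] by simp
    finally show ?thesis .
  qed
  then show ?thesis by (simp add: vec_eq_iff conjugate_entry)
qed

text \<open>The quadratic form of the inertia matrix is constant on the unit sphere; the directions between
two coordinate axes show that the off-diagonal entries vanish.\<close>

lemma inertia_matrix_isotropic:
  fixes K :: "(real ^ 'n) set"
  assumes K: "isotropic_with K L"
  shows "inertia_matrix K = L\<^sup>2 *\<^sub>R mat 1"
proof -
  let ?J = "inertia_matrix K"
  have cK: "compact K" "barycentre K = 0"
    using K by (auto simp: isotropic_with_def centered_convex_body_def convex_body_def)
  have q: "\<theta> \<bullet> (?J *v \<theta>) = L\<^sup>2" if "norm \<theta> = 1" for \<theta>
    using K that inertia_matrix_quadratic[OF cK, of \<theta>] by (simp add: isotropic_with_def)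
  have entry: "axis i 1 \<bullet> (?J *v axis j 1) = ?J $ i $ j" for i j
    by (simp add: matrix_vector_mult_basis column_def inner_axis')
  have diag: "?J $ i $ i = L\<^sup>2" for i using q[of "axis i 1"] entry[of i i] by simp
  have "?J $ i $ j = 0" if ij: "i \<noteq> j" for i j
  proof -
    \<comment> \<open>Polarization along the diagonal between the two axes.\<close>
    let ?\<theta> = "(1 / sqrt 2) *\<^sub>R (axis i 1 + axis j 1) :: real ^ 'n"
    have "(norm ?\<theta>)\<^sup>2 = 1"
      unfolding power2_norm_eq_inner using ij
      by (simp add: inner_add_left inner_add_right inner_axis_axis field_simps)
    then have "norm ?\<theta> = 1"
      using power2_eq_imp_eq[OF trans[OF _ power_one[symmetric]], of "norm ?\<theta>", OF _ norm_ge_zero zero_le_one]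
        by blast
    then have "?\<theta> \<bullet> (?J *v ?\<theta>) = L\<^sup>2" by (rule q)
    moreover have "?\<theta> \<bullet> (?J *v ?\<theta>) = (1 / 2) * (?J $ i $ i + ?J $ i $ j + ?J $ j $ i + ?J $ j $ j)"
      by (simp only: matrix_vector_mult_scaleR inner_scaleR_left inner_scaleR_right matrix_vector_right_distrib inner_add_left inner_add_right entry)
         (simp add: algebra_simps)
    moreover have "?J $ j $ i = ?J $ i $ j" by (simp add: inertia_matrix_def mult.commute)
    ultimately show ?thesis by (simp add: diag)
  qed
  then show ?thesis using diag by (auto simp: vec_eq_iff mat_def)
qed

lemma det_scaleR_mat1: "det (c *\<^sub>R mat 1 :: real ^ 'n ^ 'n) = c ^ CARD('n)"
proof -
  have "det (c *\<^sub>R mat 1 :: real ^ 'n ^ 'n) = (\<Prod>i\<in>UNIV. (c *\<^sub>R mat 1 :: real ^ 'n ^ 'n) $ i $ i)"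
    by (intro det_diagonal) (simp add: mat_def)
  then show ?thesis by (simp add: mat_def)
qed

lemma det_scaleR: "det (c *\<^sub>R A :: real ^ 'n ^ 'n) = c ^ CARD('n) * det A"
proof -
  have "c *\<^sub>R A = (c *\<^sub>R mat 1) ** A"
  proof -
    have "((c *\<^sub>R mat 1) ** A) $ i $ j = (\<Sum>k\<in>UNIV. if k = i then c * A $ i $ j else 0)" for i j
      unfolding matrix_matrix_mult_def vec_lambda_beta by (intro sum.cong) (auto simp: mat_def)
    then show ?thesis by (simp add: vec_eq_iff)
  qed
  then show ?thesis by (simp add: det_mul det_scaleR_mat1)
qed

text \<open>The exponent of the volume is the one that makes the ratio an affine invariant: a matrix \<open>A\<close>
multiplies the determinant by \<open>\<bar>det A\<bar> ^ (n + 2)\<close> and the volume by \<open>\<bar>det A\<bar>\<close>.\<close>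

definition inertia_ratio :: "(real ^ 'n) set \<Rightarrow> real" where
  "inertia_ratio K = det (inertia_matrix K) / measure lborel K ^ (CARD('n) + 2)"

lemma inertia_ratio_affine_image:
  fixes A :: "real ^ 'n ^ 'n"
  assumes K: "convex_body K" and A: "det A \<noteq> 0"
  shows "inertia_ratio ((\<lambda>x. a + A *v x) ` K) = inertia_ratio K"
proof -
  have cK: "compact K" using K by (auto simp: convex_body_def)
  have "det (A ** inertia_matrix K ** transpose A) = \<bar>det A\<bar>\<^sup>2 * det (inertia_matrix K)"
    by (simp add: det_mul power2_eq_square)
  then have "det (inertia_matrix ((\<lambda>x. a + A *v x) ` K)) = \<bar>det A\<bar> ^ (CARD('n) + 2) * det (inertia_matrix K)"
    by (simp only: inertia_matrix_affine_image[OF K A] det_scaleR power_add mult.assoc)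
  then show ?thesis
    using A unfolding inertia_ratio_def measure_affine_image[OF A cK] power_mult_distrib by simp
qed

lemma linear_bij_eq_matrix:
  fixes T :: "real ^ 'n \<Rightarrow> real ^ 'n"
  assumes "linear T" "bij T"
  shows "T = (*v) (matrix T)" "det (matrix T) \<noteq> 0"
  using assms by (auto simp: matrix_works fun_eq_iff det_nz_iff_inj bij_def)

lemma isotropic_constant_unique:
  fixes K :: "(real ^ 'n) set" and T :: "real ^ 'n \<Rightarrow> real ^ 'n"
  assumes K: "convex_body K" and T: "linear T" "bij T" and iso: "isotropic_with ((\<lambda>x. a + T x) ` K) L"
  shows "L = root (2 * CARD('n)) (inertia_ratio K)"
proof -
  let ?A = "matrix T"
  have T': "T = (*v) ?A" "det ?A \<noteq> 0" using linear_bij_eq_matrix[OF T] by auto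
  have "inertia_ratio ((\<lambda>x. a + T x) ` K) = inertia_ratio K"
    by (subst T'(1)) (rule inertia_ratio_affine_image[OF K T'(2)])
  moreover have "inertia_ratio ((\<lambda>x. a + T x) ` K) = (L\<^sup>2) ^ CARD('n)"
    using iso by (simp add: inertia_ratio_def inertia_matrix_isotropic[OF iso] det_scaleR_mat1 isotropic_with_def)
  ultimately have "inertia_ratio K = L ^ (2 * CARD('n))" by (simp add: power_mult)
  moreover have "L > 0" using iso by (simp add: isotropic_with_def)
  ultimately show ?thesis by (simp add: real_root_power_cancel)
qed

lemma inertia_matrix_principal_axes:
  fixes K :: "(real ^ 'n) set"
  assumes K: "convex_body K"
  obtains Q where "orthogonal_matrix Q" "\<And>i j. i \<noteq> j \<Longrightarrow> Q $ i \<bullet> (inertia_matrix K *v Q $ j) = 0"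
    "\<And>i. 0 < Q $ i \<bullet> (inertia_matrix K *v Q $ i)"
    "det (inertia_matrix K) = (\<Prod>i\<in>UNIV. Q $ i \<bullet> (inertia_matrix K *v Q $ i))"
proof -
  let ?J = "inertia_matrix K"
  obtain Q where Q: "orthogonal_matrix Q" "\<And>i j. i \<noteq> j \<Longrightarrow> Q $ i \<bullet> (?J *v Q $ j) = 0"
    using symmetric_matrix_diagonalizable[OF inertia_matrix_symmetric] by metis
  have "Q $ i \<noteq> 0" for i using Q(1) by (metis norm_zero orthogonal_matrix_iff_rows zero_neq_one)
  then have pos: "0 < Q $ i \<bullet> (?J *v Q $ i)" for i by (rule inertia_matrix_pos[OF K])
  have "det (Q ** ?J ** transpose Q) = (\<Prod>i\<in>UNIV. (Q ** ?J ** transpose Q) $ i $ i)"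
    by (rule det_diagonal) (simp add: conjugate_entry Q)
  moreover have "det Q * det Q = 1" using det_orthogonal_matrix[OF Q(1)] by auto
  moreover have "det (Q ** ?J ** transpose Q) = (det Q * det Q) * det ?J" by (simp add: det_mul)
  ultimately have "det ?J = (\<Prod>i\<in>UNIV. Q $ i \<bullet> (?J *v Q $ i))"
    by (simp add: conjugate_entry)
  with that Q pos show thesis by blast
qed

lemma inertia_ratio_pos:
  fixes K :: "(real ^ 'n) set"
  assumes K: "convex_body K"
  shows "0 < inertia_ratio K"
proof (rule inertia_matrix_principal_axes[OF K])
  fix Q :: "real ^ 'n ^ 'n"
  assume Q: "\<And>i. 0 < Q $ i \<bullet> (inertia_matrix K *v Q $ i)"
    "det (inertia_matrix K) = (\<Prod>i\<in>UNIV. Q $ i \<bullet> (inertia_matrix K *v Q $ i))"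
  have "0 < measure lborel K" using K by (auto simp: convex_body_def intro: measure_pos_if_interior)
  moreover have "0 < det (inertia_matrix K)" unfolding Q(2) by (intro prod_pos) (simp add: Q(1))
  ultimately show ?thesis by (simp add: inertia_ratio_def)
qed

text \<open>Translate the barycentre to \<open>0\<close>, turn the principal axes into the coordinate axes, and scale each
of them by the inverse square root of its eigenvalue. The common factor \<open>\<alpha>\<close> normalises the
volume.\<close>

lemma ex_isotropic_image:
  fixes K :: "(real ^ 'n) set"
  assumes K: "convex_body K"
  obtains a L and T :: "real ^ 'n \<Rightarrow> real ^ 'n" where "linear T" "bij T" "isotropic_with ((\<lambda>x. a + T x) ` K) L"
proof -
  let ?J = "inertia_matrix K"
  let ?V = "measure lborel K"
  have cK: "compact K" "interior K \<noteq> {}" using K by (auto simp: convex_body_def)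
  have V: "?V > 0" by (rule measure_pos_if_interior[OF cK])
  obtain Q where Q: "orthogonal_matrix Q" "\<And>i j. i \<noteq> j \<Longrightarrow> Q $ i \<bullet> (?J *v Q $ j) = 0"
      "\<And>i. 0 < Q $ i \<bullet> (?J *v Q $ i)"
    using inertia_matrix_principal_axes[OF K] by metis
  define ev where "ev i = Q $ i \<bullet> (?J *v Q $ i)" for i
  have ev: "ev i > 0" for i using Q(3) by (simp add: ev_def)
  define p where "p = (\<Prod>i\<in>UNIV. 1 / sqrt (ev i))"
  have p: "p > 0" using ev unfolding p_def by (intro prod_pos) auto
  define \<alpha> where "\<alpha> = root CARD('n) (1 / (p * ?V))"
  have \<alpha>: "\<alpha> > 0" "\<alpha> ^ CARD('n) = 1 / (p * ?V)"
    using p V by (auto simp: \<alpha>_def real_root_pow_pos2)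
  define D :: "real ^ 'n ^ 'n" where "D = (\<chi> i j. if i = j then \<alpha> / sqrt (ev i) else 0)"
  define A where "A = D ** Q"
  have Ai: "A $ i = (\<alpha> / sqrt (ev i)) *\<^sub>R Q $ i" for i
    by (simp add: A_def D_def vec_eq_iff matrix_matrix_mult_def if_distrib[where f="\<lambda>x. x * _"] cong: if_cong)
  have "det D = (\<Prod>i\<in>UNIV. \<alpha> * (1 / sqrt (ev i)))"
    by (subst det_diagonal) (auto simp: D_def)
  also have "\<dots> = \<alpha> ^ CARD('n) * p" by (simp only: prod.distrib p_def prod_constant)
  finally have "det D = 1 / ?V" using \<alpha> p by simp
  moreover have "\<bar>det Q\<bar> = 1" using det_orthogonal_matrix[OF Q(1)] by auto
  ultimately have detA: "\<bar>det A\<bar> = 1 / ?V" using V by (simp add: A_def det_mul abs_mult)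
  then have A: "det A \<noteq> 0" using V by auto
  define a where "a = - (A *v barycentre K)"
  let ?K = "(\<lambda>x. a + A *v x) ` K"
  define L where "L = \<alpha> / sqrt ?V"
  have J: "inertia_matrix ?K = L\<^sup>2 *\<^sub>R mat 1"
  proof -
    have "A $ i \<bullet> (?J *v A $ j) = (if i = j then \<alpha>\<^sup>2 else 0)" for i j
    proof (cases "i = j")
      case True
      have "A $ i \<bullet> (?J *v A $ i) = (\<alpha> / sqrt (ev i))\<^sup>2 * ev i"
        by (simp add: Ai matrix_vector_mult_scaleR ev_def power2_eq_square)
      then show ?thesis using True ev[of i] by (simp add: power_divide)
    next
      case False then show ?thesis by (simp add: Ai matrix_vector_mult_scaleR Q)
    qed
    then show ?thesis
      unfolding inertia_matrix_affine_image[OF K A]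
      using V by (auto simp: vec_eq_iff conjugate_entry detA mat_def L_def power_divide)
  qed
  have body: "convex_body ?K" by (rule convex_body_affine_image[OF K A])
  then have cK': "compact ?K" by (simp add: convex_body_def)
  have b: "barycentre ?K = 0" unfolding barycentre_affine_image[OF K A] by (simp add: a_def)
  have "isotropic_with ?K L"
    unfolding isotropic_with_def centered_convex_body_def
  proof (intro conjI ballI body b)
    show "measure lborel ?K = 1" unfolding measure_affine_image[OF A cK(1)] detA using V by simp
    show "L > 0" using \<alpha> V by (simp add: L_def)
    fix \<theta> :: "real ^ 'n" assume "\<theta> \<in> sphere 0 1"
    then have "\<theta> \<bullet> \<theta> = 1" by (simp add: dot_square_norm)
    then show "(LINT x:?K|lborel. (x \<bullet> \<theta>)\<^sup>2) = L\<^sup>2"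
      unfolding inertia_matrix_quadratic[OF cK' b, symmetric] J
      by (simp add: scaleR_matrix_vector_assoc[symmetric])
  qed
  moreover have "bij ((*v) A)"
    using A unfolding invertible_det_nz[symmetric] by (rule invertible_eq_bij[THEN iffD1])
  ultimately show thesis using that[of "(*v) A" a L] by (simp add: matrix_vector_mul_linear)
qed

theorem isotropic_constant_eq:
  fixes K :: "(real ^ 'n) set"
  assumes K: "convex_body K"
  shows "isotropic_constant K = root (2 * CARD('n)) (inertia_ratio K)"
  unfolding isotropic_constant_def
proof (rule the_equality)
  obtain a L and T :: "real ^ 'n \<Rightarrow> real ^ 'n" where aTL: "linear T" "bij T"
      "isotropic_with ((\<lambda>x. a + T x) ` K) L"
    using ex_isotropic_image[OF K] by blast
  then have L: "L = root (2 * CARD('n)) (inertia_ratio K)" by (rule isotropic_constant_unique[OF K])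
  show "\<exists>a (T :: real ^ 'n \<Rightarrow> real ^ 'n). linear T \<and> bij T
      \<and> isotropic_with ((\<lambda>x. a + T x) ` K) (root (2 * CARD('n)) (inertia_ratio K))"
    unfolding L[symmetric] by (intro exI[of _ a] exI[of _ T] conjI aTL)
qed (use isotropic_constant_unique[OF K] in blast)

lemma isotropic_constant_pos:
  fixes K :: "(real ^ 'n) set"
  assumes K: "convex_body K"
  shows "0 < isotropic_constant K"
  using inertia_ratio_pos[OF K] by (simp add: isotropic_constant_eq[OF K])

lemma isotropic_constant_power:
  fixes K :: "(real ^ 'n) set"
  assumes K: "convex_body K"
  shows "isotropic_constant K ^ (2 * CARD('n)) = det (inertia_matrix K) / measure lborel K ^ (CARD('n) + 2)"
proof -
  have "root (2 * CARD('n)) (inertia_ratio K) ^ (2 * CARD('n)) = inertia_ratio K"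
    using inertia_ratio_pos[OF K] by (intro real_root_pow_pos2) auto
  then show ?thesis by (simp only: isotropic_constant_eq[OF K] inertia_ratio_def)
qed

lemma isotropic_image_with_constant:
  fixes K :: "(real ^ 'n) set"
  assumes K: "convex_body K"
  obtains K' :: "(real ^ 'n) set" where "isotropic_with K' (isotropic_constant K)"
proof -
  obtain a L and T :: "real ^ 'n \<Rightarrow> real ^ 'n" where aTL: "linear T" "bij T"
      "isotropic_with ((\<lambda>x. a + T x) ` K) L"
    using ex_isotropic_image[OF K] by blast
  then have "L = isotropic_constant K" using isotropic_constant_unique[OF K] isotropic_constant_eq[OF K]
    by metis
  then show thesis using that aTL(3) by simp
qed

text \<open>The product over the principal axes of the lower bounds for \<open>(section volume)\<^sup>2 * (second moment)\<close>
contains the second moments only through the determinant of the inertia matrix, that is, through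
the isotropic constant.\<close>

theorem principal_axes_section_product:
  fixes K :: "(real ^ 'n) set"
  assumes K: "centered_convex_body K"
  obtains Q where "orthogonal_matrix Q"
    "measure lborel K ^ (CARD('n) - 1) / (\<Prod>i\<in>UNIV. section_function K (Q $ i) 0)
        \<le> (2 * sqrt 3 * isotropic_constant K) ^ CARD('n)"
proof -
  let ?J = "inertia_matrix K" and ?V = "measure lborel K" and ?n = "CARD('n)"
  have cK: "convex_body K" "compact K" "interior K \<noteq> {}" "barycentre K = 0"
    using K by (auto simp: convex_body_def centered_convex_body_def)
  have V: "?V > 0" by (rule measure_pos_if_interior[OF cK(2,3)])
  obtain Q where Q: "orthogonal_matrix Q" "det ?J = (\<Prod>i\<in>UNIV. Q $ i \<bullet> (?J *v Q $ i))"
    using inertia_matrix_principal_axes[OF cK(1)] by metis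
  define A where "A i = section_function K (Q $ i) 0" for i
  define P where "P = (\<Prod>i\<in>UNIV. A i)"
  have Q1: "norm (Q $ i) = 1" for i using Q(1) by (simp add: orthogonal_matrix_iff_rows)
  have A: "0 < A i" "?V ^ 3 / 12 \<le> (A i)\<^sup>2 * (Q $ i \<bullet> (?J *v Q $ i))" for i
    using central_section_bounds[OF K Q1] inertia_matrix_quadratic[OF cK(2,4)] by (auto simp: A_def)
  have P: "P > 0" unfolding P_def using A by (intro prod_pos) auto
  have "(?V ^ 3 / 12) ^ ?n = (\<Prod>i\<in>(UNIV::'n set). ?V ^ 3 / 12)" by simp
  also have "\<dots> \<le> (\<Prod>i\<in>UNIV. (A i)\<^sup>2 * (Q $ i \<bullet> (?J *v Q $ i)))"
    using A V by (intro prod_mono) auto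
  also have "\<dots> = P\<^sup>2 * det ?J" by (simp add: prod.distrib Q(2) P_def prod_power_distrib)
  finally have le: "?V ^ (3 * ?n) / 12 ^ ?n \<le> P\<^sup>2 * det ?J" by (simp add: power_divide power_mult)
  \<comment> \<open>The quotient is compared after squaring, because the bounds are for squares of section volumes.\<close>
  obtain m where m: "?n = Suc m" using zero_less_card_finite[where 'a='n] gr0_conv_Suc by blast
  have "?V ^ (m + m) * (?V ^ (?n + 2) / 12 ^ ?n) = ?V ^ (3 * ?n) / 12 ^ ?n"
  proof -
    have "m + m + (?n + 2) = 3 * ?n" using m by simp
    then show ?thesis by (simp only: times_divide_eq_right power_add[symmetric])
  qed
  also have "\<dots> \<le> P\<^sup>2 * det ?J" by (rule le)
  finally have "?V ^ (m + m) / P\<^sup>2 \<le> 12 ^ ?n * (det ?J / ?V ^ (?n + 2))"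
    using P V by (simp add: field_simps)
  also have "\<dots> = 12 ^ ?n * isotropic_constant K ^ (2 * ?n)" by (simp only: isotropic_constant_power[OF cK(1)])
  also have "\<dots> = ((2 * sqrt 3 * isotropic_constant K) ^ ?n)\<^sup>2"
    by (simp add: power_mult_distrib power_mult[symmetric] mult.commute[of _ 2]) (simp add: power_mult power_mult_distrib[symmetric])
  finally have "(?V ^ m / P)\<^sup>2 \<le> ((2 * sqrt 3 * isotropic_constant K) ^ ?n)\<^sup>2"
    by (simp add: power_divide power_add power2_eq_square)
  then have "?V ^ m / P \<le> (2 * sqrt 3 * isotropic_constant K) ^ ?n"
    using isotropic_constant_pos[OF cK(1)] by (intro power2_le_imp_le[of "?V ^ m / P"]) auto
  then show thesis using that[OF Q(1)] by (simp add: m P_def A_def)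
qed

text \<open>All second moments are \<open>L\<^sup>2\<close>, so the upper bound for the second moment says that each central
section has volume at most \<open>1 / (sqrt 2 * L)\<close>.\<close>

theorem isotropic_section_product:
  fixes K :: "(real ^ 'n) set"
  assumes K: "isotropic_with K L" and Q: "orthogonal_matrix Q"
  shows "(sqrt 2 * L) ^ CARD('n)
      \<le> measure lborel K ^ (CARD('n) - 1) / (\<Prod>i\<in>UNIV. section_function K (Q $ i) 0)"
proof -
  have K': "centered_convex_body K" "measure lborel K = 1" "L > 0" using K by (auto simp: isotropic_with_def)
  define A where "A i = section_function K (Q $ i) 0" for i
  have Q1: "norm (Q $ i) = 1" for i using Q by (simp add: orthogonal_matrix_iff_rows)
  have A: "0 < A i \<and> sqrt 2 * L \<le> 1 / A i" for i
  proof -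
    have "(LINT x:K|lborel. (x \<bullet> Q $ i)\<^sup>2) = L\<^sup>2" using K Q1[of i] by (simp add: isotropic_with_def)
    then have "0 < A i" "(A i)\<^sup>2 * L\<^sup>2 \<le> 1 / 2"
      using central_section_bounds[OF K'(1) Q1, of i] K'(2) by (auto simp: A_def)
    then have "(sqrt 2 * L * A i)\<^sup>2 \<le> 1\<^sup>2" by (simp add: power_mult_distrib mult_ac)
    then have "sqrt 2 * L * A i \<le> 1" by (rule power2_le_imp_le) simp
    with \<open>0 < A i\<close> show ?thesis by (simp add: field_simps)
  qed
  have "(sqrt 2 * L) ^ CARD('n) = (\<Prod>i\<in>(UNIV::'n set). sqrt 2 * L)" by simp
  also have "\<dots> \<le> (\<Prod>i\<in>UNIV. 1 / A i)" using A K'(3) by (intro prod_mono) auto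
  also have "\<dots> = 1 / (\<Prod>i\<in>UNIV. A i)" by (simp add: prod_dividef)
  finally show ?thesis by (simp add: K'(2) A_def)
qed

section \<open>The best orthogonal basis\<close>

text \<open>A product of nonnegative upper semicontinuous functions is upper semicontinuous: along a
convergent sequence each factor is eventually below its value at the limit plus \<open>e\<close>. The sets where
the product is at least one of its values are therefore closed, and they form a chain of nonempty
subsets of a compact set.\<close>

lemma usc_prod_attains_sup:
  fixes g :: "'i \<Rightarrow> 'p::metric_space \<Rightarrow> real"
  assumes S: "compact S" "S \<noteq> {}" and I: "finite I"
    and nonneg: "\<And>i x. i \<in> I \<Longrightarrow> x \<in> S \<Longrightarrow> 0 \<le> g i x"
    and usc: "\<And>i r. i \<in> I \<Longrightarrow> closed {x \<in> S. r \<le> g i x}"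
  shows "\<exists>x\<in>S. \<forall>y\<in>S. (\<Prod>i\<in>I. g i y) \<le> (\<Prod>i\<in>I. g i x)"
proof -
  let ?P = "\<lambda>x. \<Prod>i\<in>I. g i x"
  have cl: "closed {x \<in> S. r \<le> ?P x}" for r
    unfolding closed_sequential_limits
  proof (intro allI impI, elim conjE)
    fix x l assume x: "\<forall>n. x n \<in> {x \<in> S. r \<le> ?P x}" and lim: "x \<longlonglongrightarrow> l"
    have xS: "x n \<in> S" and xr: "r \<le> ?P (x n)" for n using x by auto
    have lS: "l \<in> S" using compact_imp_closed[OF S(1)] xS lim by (metis closed_sequentially)
    have le: "r \<le> (\<Prod>i\<in>I. g i l + e)" if e: "e > 0" for e
    proof -
      have "eventually (\<lambda>n. g i (x n) < g i l + e) sequentially" if i: "i \<in> I" for i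
      proof -
        have "eventually (\<lambda>n. x n \<in> - {x \<in> S. g i l + e \<le> g i x}) sequentially"
          using usc[OF i] e by (intro topological_tendstoD[OF lim]) auto
        then show ?thesis by eventually_elim (use xS in auto)
      qed
      then have "eventually (\<lambda>n. \<forall>i\<in>I. g i (x n) < g i l + e) sequentially"
        using I by (simp add: eventually_ball_finite_distrib)
      then obtain n where n: "\<forall>i\<in>I. g i (x n) < g i l + e" by (auto simp: eventually_sequentially)
      have "r \<le> ?P (x n)" by (rule xr)
      also have "\<dots> \<le> (\<Prod>i\<in>I. g i l + e)" using n nonneg xS by (intro prod_mono) (auto intro: less_imp_le)
      finally show ?thesis .
    qed
    have "((\<lambda>e. \<Prod>i\<in>I. g i l + e) \<longlongrightarrow> (\<Prod>i\<in>I. g i l + 0)) (at_right 0)"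
      by (intro tendsto_intros)
    moreover have "eventually (\<lambda>e. r \<le> (\<Prod>i\<in>I. g i l + e)) (at_right 0)"
      using le by (auto simp: eventually_at_filter)
    ultimately have "r \<le> ?P l"
      using tendsto_lowerbound[of _ _ "at_right (0::real)" r] by simp
    then show "l \<in> {x \<in> S. r \<le> ?P x}" using lS by simp
  qed
  let ?F = "(\<lambda>y. {x \<in> S. ?P y \<le> ?P x}) ` S"
  have "S \<inter> \<Inter>?F \<noteq> {}"
  proof (rule compact_imp_fip[OF S(1)])
    show "closed T" if "T \<in> ?F" for T using that cl by auto
    fix F' assume F': "finite F'" "F' \<subseteq> ?F"
    then obtain Y where Y: "Y \<subseteq> S" "finite Y" "F' = (\<lambda>y. {x \<in> S. ?P y \<le> ?P x}) ` Y"
      by (meson finite_subset_image)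
    show "S \<inter> \<Inter>F' \<noteq> {}"
    proof (cases "Y = {}")
      case True then show ?thesis using S Y by auto
    next
      case False
      have "Max (?P ` Y) \<in> ?P ` Y" using False Y by (intro Max_in) auto
      then obtain z where z: "z \<in> Y" "?P z = Max (?P ` Y)" by auto
      have "?P y \<le> ?P z" if "y \<in> Y" for y unfolding z(2) using that Y by (intro Max_ge) auto
      then have "z \<in> S \<inter> \<Inter>F'" using z Y by auto
      then show ?thesis by blast
    qed
  qed
  then show ?thesis by auto
qed

lemma compact_orthogonal_matrices: "compact {Q :: real ^ 'n ^ 'n. orthogonal_matrix Q}"
  unfolding compact_eq_bounded_closed
proof
  have "norm Q \<le> of_nat CARD('n)" if "orthogonal_matrix Q" for Q :: "real ^ 'n ^ 'n"
  proof -
    have "norm Q \<le> (\<Sum>i\<in>UNIV. norm (Q $ i))" by (simp add: norm_vec_def L2_set_le_sum)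
    then show ?thesis using that by (simp add: orthogonal_matrix_iff_rows)
  qed
  then show "bounded {Q :: real ^ 'n ^ 'n. orthogonal_matrix Q}" by (auto simp: bounded_iff)
  have "closed {Q :: real ^ 'n ^ 'n. norm (Q $ i) = 1}" "closed {Q :: real ^ 'n ^ 'n. Q $ i \<bullet> Q $ j = 0}"
      for i j
    by (intro closed_Collect_eq continuous_intros)+
  then show "closed {Q :: real ^ 'n ^ 'n. orthogonal_matrix Q}"
    unfolding orthogonal_matrix_iff_rows orthogonal_def
    by (intro closed_Collect_conj closed_Collect_all) (auto simp: imp_conv_disj intro!: closed_Collect_disj closed_Collect_const)
qed

lemma closed_superlevel_central_section:
  fixes K :: "'a::euclidean_space set"
  assumes K: "compact K"
  shows "closed {u \<in> sphere 0 1. r \<le> section_function K u 0}"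
proof -
  obtain \<rho> where \<rho>: "K \<subseteq> cball 0 \<rho>"
    using compact_imp_bounded[OF K(1)] by (auto simp: bounded_iff subset_iff)
  show ?thesis
    unfolding section_function_def
  proof (rule closed_superlevel_measure[where \<rho>="\<rho> + 1"])
    have "closed ((sphere 0 1 \<times> UNIV) \<inter> (\<lambda>z. ((fst z, 0), snd z)) -` {(p, x). x \<in> slab_section K (fst p) (snd p)})"
      by (intro closed_Int closed_Times closed_vimage closed_slab_section_graph compact_imp_closed K continuous_intros closed_UNIV closed_sphere)
    moreover have "{(u, x). u \<in> sphere 0 1 \<and> x \<in> slab_section K u 0}
        = (sphere 0 1 \<times> UNIV) \<inter> (\<lambda>z. ((fst z, 0), snd z)) -` {(p, x). x \<in> slab_section K (fst p) (snd p)}"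
      by auto
    ultimately show "closed {(u, x). u \<in> sphere 0 1 \<and> x \<in> slab_section K u 0}" by (simp only:)
    show "slab_section K u 0 \<subseteq> cball 0 (\<rho> + 1)" if "u \<in> sphere 0 1" for u
      using slab_section_subset_cball[OF \<rho>, of u 0] that by simp
  qed simp
qed

definition section_quotient :: "(real ^ 'n) set \<Rightarrow> real ^ 'n ^ 'n \<Rightarrow> real" where
  "section_quotient K Q = measure lborel K ^ (CARD('n) - 1) / (\<Prod>i\<in>UNIV. section_function K (Q $ i) 0)"

lemma ex_minimal_section_quotient:
  fixes K :: "(real ^ 'n) set"
  assumes K: "centered_convex_body K"
  obtains Q where "orthogonal_matrix Q"
      "\<And>Q'. orthogonal_matrix Q' \<Longrightarrow> section_quotient K Q \<le> section_quotient K Q'"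
proof -
  have cK: "compact K" using K by (simp add: centered_convex_body_def convex_body_def)
  let ?O = "{Q :: real ^ 'n ^ 'n. orthogonal_matrix Q}"
  have "\<exists>Q\<in>?O. \<forall>Q'\<in>?O. (\<Prod>i\<in>UNIV. section_function K (Q' $ i) 0) \<le> (\<Prod>i\<in>UNIV. section_function K (Q $ i) 0)"
  proof (rule usc_prod_attains_sup)
    show "?O \<noteq> {}" using orthogonal_matrix_id by blast
    show "closed {Q \<in> ?O. r \<le> section_function K (Q $ i) 0}" for i r
    proof -
      have "{Q \<in> ?O. r \<le> section_function K (Q $ i) 0} = ?O \<inter> (\<lambda>Q. Q $ i) -` {u \<in> sphere 0 1. r
          \<le> section_function K u 0}"
        by (auto simp: orthogonal_matrix_iff_rows)
      also have "closed \<dots>"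
        by (intro closed_Int closed_vimage closed_superlevel_central_section cK compact_imp_closed compact_orthogonal_matrices continuous_intros)
      finally show ?thesis .
    qed
  qed (auto intro: compact_orthogonal_matrices section_function_nonneg)
  then obtain Q where Q: "orthogonal_matrix Q"
    "\<And>Q'. orthogonal_matrix Q' \<Longrightarrow> (\<Prod>i\<in>UNIV. section_function K (Q' $ i) 0)
        \<le> (\<Prod>i\<in>UNIV. section_function K (Q $ i) 0)" by auto
  have pos: "0 < (\<Prod>i\<in>UNIV. section_function K (Q' $ i) 0)" if "orthogonal_matrix Q'"
      for Q' :: "real ^ 'n ^ 'n"
    using that central_section_bounds(1)[OF K] by (intro prod_pos) (auto simp: orthogonal_matrix_iff_rows)
  show thesis
  proof (rule that[OF Q(1)])
    fix Q' :: "real ^ 'n ^ 'n" assume "orthogonal_matrix Q'"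
    then show "section_quotient K Q \<le> section_quotient K Q'"
      unfolding section_quotient_def using Q pos by (intro divide_left_mono) auto
  qed
qed

text \<open>A section volume depends only on the direction of its normal vector, so an orthogonal basis may be
normalised and listed as the rows of an orthogonal matrix.\<close>

lemma orthogonal_basis_quotient_iff:
  fixes K :: "(real ^ 'n) set"
  assumes K: "compact K"
  shows "(\<exists>W. orthogonal_basis W \<and> r = measure lborel K ^ (DIM(real ^ 'n) - 1) / (\<Prod>w\<in>W. section_volume K w))
     \<longleftrightarrow> (\<exists>Q. orthogonal_matrix Q \<and> r = section_quotient K Q)"
proof
  assume "\<exists>W. orthogonal_basis W \<and> r = measure lborel K ^ (DIM(real ^ 'n) - 1) / (\<Prod>w\<in>W. section_volume K w)"
  then obtain W where W: "pairwise orthogonal W" "independent W" "span W = UNIV"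
    and r: "r = measure lborel K ^ (DIM(real ^ 'n) - 1) / (\<Prod>w\<in>W. section_volume K w)"
    by (auto simp: orthogonal_basis_def)
  have W0: "w \<noteq> 0" if "w \<in> W" for w using that W(2) dependent_zero by blast
  let ?n = "\<lambda>w :: real ^ 'n. w /\<^sub>R norm w"
  have inj: "inj_on ?n W"
  proof (rule inj_onI, rule ccontr)
    fix v w assume vw: "v \<in> W" "w \<in> W" "?n v = ?n w" "v \<noteq> w"
    then have "v \<bullet> w = 0" using W(1) by (simp add: pairwise_def orthogonal_def)
    then have "?n v \<bullet> ?n w = 0" by simp
    then have "?n w \<bullet> ?n w = 0" using vw by simp
    then show False using W0[OF vw(2)] by simp
  qed
  have "span (?n ` W) = span W"
  proof (rule subset_antisym)
    show "span (?n ` W) \<subseteq> span W" by (intro span_minimal) (auto intro: span_scale span_base)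
    have "w \<in> span (?n ` W)" if "w \<in> W" for w
      using span_scale[OF span_base[OF imageI[OF that, of ?n]], of "norm w"] W0[OF that] by simp
    then show "span W \<subseteq> span (?n ` W)" by (intro span_minimal) auto
  qed
  then have s: "span (?n ` W) = UNIV" using W(3) by simp
  have o: "pairwise orthogonal (?n ` W)"
    using W(1) by (auto simp: pairwise_def orthogonal_def)
  have n: "\<forall>b\<in>?n ` W. norm b = 1" using W0 by auto
  obtain Q :: "real ^ 'n ^ 'n" where Q: "orthogonal_matrix Q" "bij_betw (($) Q) UNIV (?n ` W)"
    by (rule matrix_of_orthonormal_set[OF o n s])
  have "(\<Prod>w\<in>W. section_volume K w) = (\<Prod>w\<in>W. section_function K (?n w) 0)"
    using W0 section_volume_eq_section_function[OF K] by (intro prod.cong) auto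
  also have "\<dots> = (\<Prod>u\<in>?n ` W. section_function K u 0)" by (simp add: prod.reindex[OF inj])
  also have "\<dots> = (\<Prod>i\<in>UNIV. section_function K (Q $ i) 0)" by (rule prod.reindex_bij_betw[OF Q(2), symmetric])
  finally show "\<exists>Q. orthogonal_matrix Q \<and> r = section_quotient K Q"
    using Q(1) r by (intro exI[of _ Q]) (simp add: section_quotient_def)
next
  assume "\<exists>Q. orthogonal_matrix Q \<and> r = section_quotient K Q"
  then obtain Q where Q: "orthogonal_matrix Q" and r: "r = section_quotient K Q" by auto
  have n1: "norm (Q $ i) = 1" and orth: "i \<noteq> j \<Longrightarrow> orthogonal (Q $ i) (Q $ j)" for i j
    using Q by (auto simp: orthogonal_matrix_iff_rows)
  have inj: "inj (($) Q)"
  proof (rule injI, rule ccontr)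
    fix i j assume "Q $ i = Q $ j" "i \<noteq> j"
    then have "Q $ j \<bullet> Q $ j = 0" using orth[of i j] by (simp add: orthogonal_def)
    then show False using n1[of j] by simp
  qed
  let ?W = "range (($) Q)"
  have W: "pairwise orthogonal ?W" by (auto simp: pairwise_def intro!: orth)
  have nz: "Q $ i \<noteq> 0" for i using n1[of i] by auto
  then have "0 \<notin> ?W" by (metis rangeE)
  then have ind: "independent ?W" using W by (intro pairwise_orthogonal_independent)
  have "card ?W = dim (UNIV :: (real ^ 'n) set)" by (simp add: card_image[OF inj] dim_UNIV)
  then have "UNIV \<subseteq> span ?W" using ind by (intro card_ge_dim_independent) auto
  then have "span ?W = UNIV" by blast
  then have "orthogonal_basis ?W" using W ind by (simp add: orthogonal_basis_def)
  moreover have "(\<Prod>w\<in>?W. section_volume K w) = (\<Prod>i\<in>UNIV. section_function K (Q $ i) 0)"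
  proof -
    have "section_volume K (Q $ i) = section_function K (Q $ i) 0" for i
      using section_volume_eq_section_function[OF K nz, of i] by (simp add: n1)
    then show ?thesis by (simp add: prod.reindex[OF inj])
  qed
  ultimately show "\<exists>W. orthogonal_basis W \<and> r
      = measure lborel K ^ (DIM(real ^ 'n) - 1) / (\<Prod>w\<in>W. section_volume K w)"
    by (intro exI[of _ ?W]) (simp add: r section_quotient_def)
qed

theorem Lambda_tilde_eq:
  fixes K :: "(real ^ 'n) set"
  assumes K: "centered_convex_body K"
  obtains Q where "orthogonal_matrix Q" "Lambda_tilde K = section_quotient K Q"
    "\<And>Q'. orthogonal_matrix Q' \<Longrightarrow> Lambda_tilde K \<le> section_quotient K Q'"
proof -
  have cK: "compact K" using K by (simp add: centered_convex_body_def convex_body_def)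
  obtain Q where Q: "orthogonal_matrix Q"
      "\<And>Q'. orthogonal_matrix Q' \<Longrightarrow> section_quotient K Q \<le> section_quotient K Q'"
    using ex_minimal_section_quotient[OF K] by metis
  have "Lambda_tilde K = section_quotient K Q"
    unfolding Lambda_tilde_def orthogonal_basis_quotient_iff[OF cK] using Q by (intro Least_equality) auto
  with Q that show thesis by metis
qed

section \<open>The largest isotropic constant\<close>

lemma infdist_convex_combination_le:
  fixes C :: "'a::euclidean_space set"
  assumes C: "closed C" "convex C" "C \<noteq> {}" and t: "0 \<le> s" "0 \<le> t" "s + t = 1"
  shows "infdist (s *\<^sub>R x + t *\<^sub>R y) C \<le> s * infdist x C + t * infdist y C"
proof -
  obtain p q where p: "p \<in> C" "infdist x C = dist x p" and q: "q \<in> C" "infdist y C = dist y q"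
    using infdist_attains_inf[OF C(1,3)] by metis
  have "s *\<^sub>R p + t *\<^sub>R q \<in> C" using C(2) p q t by (intro convexD)
  then have "infdist (s *\<^sub>R x + t *\<^sub>R y) C \<le> dist (s *\<^sub>R x + t *\<^sub>R y) (s *\<^sub>R p + t *\<^sub>R q)" by (rule infdist_le)
  also have "\<dots> = norm (s *\<^sub>R (x - p) + t *\<^sub>R (y - q))" by (simp add: dist_norm algebra_simps)
  also have "\<dots> \<le> s * dist x p + t * dist y q"
    using norm_triangle_ineq[of "s *\<^sub>R (x - p)" "t *\<^sub>R (y - q)"] t by (simp add: dist_norm)
  finally show ?thesis by (simp add: p q)
qed

text \<open>Move from \<open>x\<close> by \<open>e\<close> straight away from its nearest point in \<open>C\<close>.\<close>

lemma ex_far_point_outside_convex: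
  fixes C :: "'a::euclidean_space set"
  assumes C: "closed C" "convex C" "C \<noteq> {}" and x: "x \<notin> C" and e: "0 < e"
  shows "\<exists>z\<in>cball x e. e < infdist z C"
proof -
  obtain p where p: "p \<in> C" "infdist x C = dist x p" using infdist_attains_inf[OF C(1,3)] by metis
  have le: "dist x p \<le> dist x y" if "y \<in> C" for y using infdist_le[OF that, of x] p by simp
  have xp: "x \<noteq> p" using x p by auto
  define u where "u = (1 / norm (x - p)) *\<^sub>R (x - p)"
  have u: "norm u = 1" using xp by (simp add: u_def)
  define z where "z = x + e *\<^sub>R u"
  obtain q where q: "q \<in> C" "infdist z C = dist z q" using infdist_attains_inf[OF C(1,3)] by metis
  have "(x - p) \<bullet> (q - p) \<le> 0" using any_closest_point_dot[OF C(2,1) p(1) q(1)] le by auto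
  then have "u \<bullet> (q - p) \<le> 0" by (simp add: u_def divide_le_0_iff)
  moreover have "u \<bullet> (x - p) = norm (x - p)" using xp by (simp add: u_def dot_square_norm power2_eq_square)
  ultimately have "norm (x - p) + e \<le> u \<bullet> (z - q)"
    using u by (simp add: z_def inner_diff_right inner_add_right dot_square_norm)
  also have "\<dots> \<le> norm (z - q)" using norm_cauchy_schwarz[of u "z - q"] u by simp
  finally have "norm (x - p) + e \<le> infdist z C" unfolding q(2) dist_norm .
  moreover have "0 < norm (x - p)" using xp by simp
  ultimately have "e < infdist z C" by linarith
  moreover have "z \<in> cball x e" using u e by (simp add: z_def dist_norm)
  ultimately show ?thesis by blast
qed

text \<open>This is the selection theorem of Blaschke, with convergence of indicator functions almost
everywhere. The distance functions of the sets are \<open>1\<close>-Lipschitz, so a subsequence converges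
uniformly; the limit set is the set of zeros of the limit. Points outside it are eventually at
positive distance from the sets. An interior point is eventually in the sets, since otherwise a
point near it, also in the limit set, would keep a positive distance from them. The frontier of a
convex set is a null set.\<close>

theorem convex_selection:
  fixes C :: "nat \<Rightarrow> 'a::euclidean_space set"
  assumes C: "\<And>n. compact (C n)" "\<And>n. convex (C n)" "\<And>n. C n \<noteq> {}" and bd: "\<And>n. C n \<subseteq> cball 0 \<rho>"
  obtains r K where "strict_mono r" "compact K" "convex K" "K \<subseteq> cball 0 \<rho>"
    "AE x in lborel. (\<lambda>n. indicator (C (r n)) x :: real) \<longlonglongrightarrow> indicator K x"
proof -
  define S where "S = cball (0::'a) (\<rho> + 1)"
  define F where "F n x = infdist x (C n)" for n x
  have cl: "closed (C n)" for n using C(1) by (rule compact_imp_closed)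
  have Fle: "F n x \<le> dist x y" if "y \<in> C n" for n x y unfolding F_def using that by (rule infdist_le)
  have M: "norm (F n x) \<le> 2 * \<rho> + 1" if "x \<in> S" for n x
  proof -
    obtain y where y: "y \<in> C n" using C(3)[of n] by auto
    have "dist x y \<le> norm x + norm y" by (simp add: dist_norm norm_triangle_ineq4)
    also have "\<dots> \<le> (\<rho> + 1) + \<rho>" using that y bd[of n] by (intro add_mono) (auto simp: S_def)
    finally show ?thesis using Fle[OF y, of x] by (simp add: F_def infdist_nonneg)
  qed
  have eq: "\<exists>d. 0 < d \<and> (\<forall>n y. y \<in> S \<and> norm (x - y) < d \<longrightarrow> norm (F n x - F n y) < e)" if "0 < e" for x e
  proof (intro exI[of _ e] conjI allI impI that, elim conjE)
    fix n y assume "norm (x - y) < e"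
    moreover have "\<bar>F n x - F n y\<bar> \<le> dist x y" unfolding F_def by (rule infdist_triangle_abs)
    ultimately show "norm (F n x - F n y) < e" by (simp add: dist_norm)
  qed
  obtain g r where g: "continuous_on S g" and r: "strict_mono (r :: nat \<Rightarrow> nat)"
    and unif: "\<And>e. 0 < e \<Longrightarrow> \<exists>N. \<forall>n x. n \<ge> N \<and> x \<in> S \<longrightarrow> norm (F (r n) x - g x) < e"
    using Arzela_Ascoli[of S F "2 * \<rho> + 1"] M eq unfolding S_def by (metis compact_cball)
  have lim: "(\<lambda>n. F (r n) x) \<longlonglongrightarrow> g x" if "x \<in> S" for x
    unfolding LIMSEQ_iff using unif that by meson
  have g0: "0 \<le> g x" if "x \<in> S" for x
    by (rule LIMSEQ_le_const[OF lim[OF that]]) (auto simp: F_def infdist_nonneg)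
  define K where "K = {x \<in> S. g x = 0}"
  have "closed K" unfolding K_def by (intro continuous_closed_preimage_constant g) (simp add: S_def)
  moreover have "bounded K" unfolding K_def S_def
    by (rule bounded_subset[OF bounded_cball[of 0 "\<rho> + 1"]]) auto
  ultimately have cK: "compact K" by (simp add: compact_eq_bounded_closed)
  have conv: "convex K"
  proof (rule convexI)
    fix x y and s t :: real assume xy: "x \<in> K" "y \<in> K" and st: "0 \<le> s" "0 \<le> t" "s + t = 1"
    let ?z = "s *\<^sub>R x + t *\<^sub>R y"
    have z: "?z \<in> S" unfolding S_def
      by (rule convexD[OF convex_cball]) (use xy st in \<open>auto simp: K_def S_def\<close>)
    have "g ?z \<le> s * g x + t * g y"
    proof (rule LIMSEQ_le[OF lim[OF z]])
      show "(\<lambda>n. s * F (r n) x + t * F (r n) y) \<longlonglongrightarrow> s * g x + t * g y"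
        using xy by (intro tendsto_intros lim) (auto simp: K_def)
      show "\<exists>N. \<forall>n\<ge>N. F (r n) ?z \<le> s * F (r n) x + t * F (r n) y"
        unfolding F_def using infdist_convex_combination_le[OF cl C(2,3) st] by blast
    qed
    then show "?z \<in> K" using xy g0[OF z] z by (simp add: K_def)
  qed
  have sub: "K \<subseteq> cball 0 \<rho>"
  proof
    fix x assume x: "x \<in> K"
    have "norm x - \<rho> \<le> F (r n) x" for n
    proof -
      obtain p where p: "p \<in> C (r n)" "F (r n) x = dist x p"
        unfolding F_def using infdist_attains_inf[OF cl C(3)] by metis
      have "norm p \<le> \<rho>" using p(1) bd[of "r n"] by auto
      then show ?thesis using p(2) norm_triangle_ineq2[of x p] by (simp add: dist_norm)
    qed
    then have "norm x - \<rho> \<le> g x" using x by (intro LIMSEQ_le_const[OF lim]) (auto simp: K_def)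
    then show "x \<in> cball 0 \<rho>" using x by (simp add: K_def)
  qed
  have point: "(\<lambda>n. indicator (C (r n)) x :: real) \<longlonglongrightarrow> indicator K x" if "x \<notin> frontier K" for x
  proof (cases "x \<in> K")
    case True
    then have "x \<in> interior K" using that compact_imp_closed[OF cK] by (auto simp: frontier_def)
    then obtain e where e: "e > 0" "cball x e \<subseteq> K" using mem_interior_cball by blast
    obtain N where N: "\<And>n z. n \<ge> N \<Longrightarrow> z \<in> S \<Longrightarrow> norm (F (r n) z - g z) < e" using unif[OF e(1)] by blast
    have "x \<in> C (r n)" if n: "n \<ge> N" for n
    proof (rule ccontr)
      assume "x \<notin> C (r n)"
      then obtain z where z: "z \<in> cball x e" "e < F (r n) z"
        using ex_far_point_outside_convex[OF cl C(2,3) _ e(1)] unfolding F_def by blast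
      then have "z \<in> S" "g z = 0" using e(2) by (auto simp: K_def)
      then show False using N[OF n, of z] z(2) by simp
    qed
    then have "eventually (\<lambda>n. indicator (C (r n)) x = (indicator K x :: real)) sequentially"
      using True by (auto simp: eventually_sequentially intro!: exI[of _ N])
    then show ?thesis by (rule tendsto_eventually)
  next
    case False
    have "eventually (\<lambda>n. x \<notin> C (r n)) sequentially"
    proof (cases "x \<in> S")
      case True
      then have "g x > 0" using False g0[OF True] by (simp add: K_def less_le)
      then have "eventually (\<lambda>n. 0 < F (r n) x) sequentially" by (rule order_tendstoD(1)[OF lim[OF True]])
      then show ?thesis by eventually_elim (auto simp: F_def)
    next
      case False
      then have "x \<notin> C n" for n using bd[of n] by (auto simp: S_def)
      then show ?thesis by simp
    qed
    then have "eventually (\<lambda>n. indicator (C (r n)) x = (indicator K x :: real)) sequentially"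
      by eventually_elim (use False in simp)
    then show ?thesis by (rule tendsto_eventually)
  qed
  have "frontier K \<in> null_sets lborel"
    using negligible_convex_frontier[OF conv]
      by (simp add: negligible_iff_null_sets null_sets_completion_iff borel_closed)
  then have "AE x in lborel. x \<notin> frontier K" by (rule AE_not_in)
  then have "AE x in lborel. (\<lambda>n. indicator (C (r n)) x :: real) \<longlonglongrightarrow> indicator K x"
    by eventually_elim (rule point)
  then show thesis using that r cK conv sub by blast
qed

lemma set_integral_tendsto:
  fixes C :: "nat \<Rightarrow> 'a::euclidean_space set" and \<phi> :: "nat \<Rightarrow> 'a \<Rightarrow> 'b::{banach, second_countable_topology}"
  assumes C: "\<And>n. compact (C n)" "\<And>n. C n \<subseteq> cball 0 \<rho>" and K: "compact K"
    and lim: "AE x in lborel. (\<lambda>n. indicator (C n) x :: real) \<longlonglongrightarrow> indicator K x"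
    and \<phi>: "\<And>n. continuous_on UNIV (\<phi> n)" "continuous_on UNIV \<psi>" "\<And>x. (\<lambda>n. \<phi> n x) \<longlonglongrightarrow> \<psi> x"
    and M: "\<And>n x. x \<in> cball 0 \<rho> \<Longrightarrow> norm (\<phi> n x) \<le> M"
  shows "(\<lambda>n. LINT x:C n|lborel. \<phi> n x) \<longlonglongrightarrow> (LINT x:K|lborel. \<psi> x)"
  unfolding set_lebesgue_integral_def
proof (rule integral_dominated_convergence[where w="\<lambda>x. \<bar>M\<bar> * indicator (cball 0 \<rho>) x"])
  have [measurable]: "C n \<in> sets borel" "K \<in> sets borel" for n using C K by (auto intro: borel_compact)
  have [measurable]: "\<phi> n \<in> borel_measurable borel" "\<psi> \<in> borel_measurable borel" for n
    using \<phi> by (auto intro: borel_measurable_continuous_onI)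
  show "(\<lambda>x. indicator K x *\<^sub>R \<psi> x) \<in> borel_measurable lborel"
    "\<And>n. (\<lambda>x. indicator (C n) x *\<^sub>R \<phi> n x) \<in> borel_measurable lborel" by measurable
  show "integrable lborel (\<lambda>x. \<bar>M\<bar> * indicator (cball (0::'a) \<rho>) x)"
    using emeasure_compact_finite[of "cball (0::'a) \<rho>"]
      by (intro integrable_mult_right integrable_real_indicator) auto
  show "AE x in lborel. (\<lambda>n. indicator (C n) x *\<^sub>R \<phi> n x) \<longlonglongrightarrow> indicator K x *\<^sub>R \<psi> x"
    using lim by eventually_elim (intro tendsto_scaleR \<phi>(3))
  show "AE x in lborel. norm (indicator (C n) x *\<^sub>R \<phi> n x) \<le> \<bar>M\<bar> * indicator (cball 0 \<rho>) x" for n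
  proof (rule AE_I2)
    fix x
    show "norm (indicator (C n) x *\<^sub>R \<phi> n x) \<le> \<bar>M\<bar> * indicator (cball 0 \<rho>) x"
      using M[of x n] C(2)[of n] by (auto split: split_indicator)
  qed
qed

lemma convex_body_if_measure_pos:
  assumes "compact K" "convex K" "0 < measure lborel K"
  shows "convex_body K"
proof -
  have "interior K \<noteq> {}"
  proof
    assume "interior K = {}"
    then have "negligible K" using negligible_convex_interior[OF assms(2)] by simp
    then have "K \<in> null_sets lborel"
      using assms(1) by (simp add: negligible_iff_null_sets null_sets_completion_iff borel_compact)
    then show False using assms(3) by (simp add: measure_eq_0_null_sets)
  qed
  with assms show ?thesis by (simp add: convex_body_def)
qed

lemma tendsto_det:
  fixes A :: "nat \<Rightarrow> real ^ 'n ^ 'n"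
  assumes "\<And>i j. (\<lambda>n. A n $ i $ j) \<longlonglongrightarrow> B $ i $ j"
  shows "(\<lambda>n. det (A n)) \<longlonglongrightarrow> det B"
  unfolding det_def by (intro tendsto_intros assms)

theorem inertia_ratio_tendsto:
  fixes C :: "nat \<Rightarrow> (real ^ 'n) set"
  assumes C: "\<And>n. convex_body (C n)" "\<And>n. C n \<subseteq> cball 0 \<rho>" and K: "compact K" "convex K"
    and lim: "AE x in lborel. (\<lambda>n. indicator (C n) x :: real) \<longlonglongrightarrow> indicator K x"
    and vol: "0 < \<kappa>" "\<And>n. \<kappa> \<le> measure lborel (C n)"
  shows "convex_body K" "(\<lambda>n. inertia_ratio (C n)) \<longlonglongrightarrow> inertia_ratio K"
proof -
  have cC: "compact (C n)" for n using C by (simp add: convex_body_def)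
  note tends = set_integral_tendsto[OF cC C(2) K(1) lim]
  have V: "(\<lambda>n. measure lborel (C n)) \<longlonglongrightarrow> measure lborel K"
    using tends[of "\<lambda>_ _. 1::real" "\<lambda>_. 1" 1] by (simp add: set_lebesgue_integral_def)
  then have "\<kappa> \<le> measure lborel K" using vol by (intro LIMSEQ_le_const[OF V]) auto
  then have Vpos: "0 < measure lborel K" using vol by simp
  then show "convex_body K" by (rule convex_body_if_measure_pos[OF K])
  have "(\<lambda>n. LINT x:C n|lborel. x) \<longlonglongrightarrow> (LINT x:K|lborel. x)"
    by (rule tends[where M=\<rho>]) (auto intro: continuous_intros)
  then have b: "(\<lambda>n. barycentre (C n)) \<longlonglongrightarrow> barycentre K"
    unfolding barycentre_def using Vpos by (intro tendsto_intros V) auto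
  then have "bounded (range (\<lambda>n. barycentre (C n)))"
    by (intro convergent_imp_bounded)
  then obtain \<beta> where \<beta>: "norm (barycentre (C n)) \<le> \<beta>" for n by (auto simp: bounded_iff)
  have "(\<lambda>n. inertia_matrix (C n) $ i $ j) \<longlonglongrightarrow> inertia_matrix K $ i $ j" for i j
    unfolding inertia_matrix_def vec_lambda_beta
  proof (rule tends[where M="(\<rho> + \<beta>) * (\<rho> + \<beta>)"])
    show "(\<lambda>n. (x - barycentre (C n)) $ i * (x - barycentre (C n)) $ j)
        \<longlonglongrightarrow> (x - barycentre K) $ i * (x - barycentre K) $ j" for x
      by (intro tendsto_intros b)
    fix n x assume "x \<in> cball (0 :: real ^ 'n) \<rho>"
    then have "norm (x - barycentre (C n)) \<le> \<rho> + \<beta>"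
      using norm_triangle_ineq4[of x "barycentre (C n)"] \<beta>[of n] by simp
    then have "\<bar>(x - barycentre (C n)) $ i\<bar> \<le> \<rho> + \<beta>" for i
      using component_le_norm_cart[of "x - barycentre (C n)" i] by simp
    then show "norm ((x - barycentre (C n)) $ i * (x - barycentre (C n)) $ j) \<le> (\<rho> + \<beta>) * (\<rho> + \<beta>)"
      unfolding real_norm_def abs_mult by (intro mult_mono) (auto intro: order_trans[OF abs_ge_zero])
  qed (auto intro!: continuous_intros)
  then have "(\<lambda>n. det (inertia_matrix (C n))) \<longlonglongrightarrow> det (inertia_matrix K)" by (rule tendsto_det)
  then show "(\<lambda>n. inertia_ratio (C n)) \<longlonglongrightarrow> inertia_ratio K"
    unfolding inertia_ratio_def using Vpos by (intro tendsto_intros V) auto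
qed

text \<open>Choose vectors from an interior point \<open>x0\<close> to points of \<open>K\<close> that span a parallelepiped of largest
volume, and map them to the unit vectors. By Cramer's rule a coordinate of a point of \<open>K\<close> with
respect to these vectors is a quotient of two such volumes, so it lies between \<open>-1\<close> and \<open>1\<close>.\<close>

lemma ex_normalized_position:
  fixes K :: "(real ^ 'n) set"
  assumes K: "convex_body K"
  obtains a and A :: "real ^ 'n ^ 'n" where "det A \<noteq> 0" "(\<lambda>x. a + A *v x) ` K \<subseteq> cbox (- 1) 1"
    "convex hull (insert 0 Basis) \<subseteq> (\<lambda>x. a + A *v x) ` K"
proof -
  have cK: "compact K" "convex K" "interior K \<noteq> {}" using K by (auto simp: convex_body_def)
  obtain x0 e where x0: "e > 0" "ball x0 e \<subseteq> K" using cK(3) mem_interior by (metis ex_in_conv)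
  define M where "M = {X :: real ^ 'n ^ 'n. \<forall>i. x0 + X $ i \<in> K}"
  have "closed M"
    unfolding M_def
  proof (intro closed_Collect_all)
    fix i
    have "{X :: real ^ 'n ^ 'n. x0 + X $ i \<in> K} = (\<lambda>X. x0 + X $ i) -` K" by auto
    also have "closed \<dots>" by (intro closed_vimage compact_imp_closed cK continuous_intros)
    finally show "closed {X :: real ^ 'n ^ 'n. x0 + X $ i \<in> K}" .
  qed
  moreover have "bounded M"
  proof -
    obtain \<rho> where \<rho>: "\<And>x. x \<in> K \<Longrightarrow> norm x \<le> \<rho>"
      using compact_imp_bounded[OF cK(1)] by (auto simp: bounded_iff)
    have "norm X \<le> of_nat CARD('n) * (\<rho> + norm x0)" if "X \<in> M" for X
    proof -
      have "norm (X $ i) \<le> \<rho> + norm x0" for i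
        using norm_triangle_ineq4[of "x0 + X $ i" x0] \<rho>[of "x0 + X $ i"] that by (simp add: M_def)
      then have "(\<Sum>i\<in>UNIV. norm (X $ i)) \<le> of_nat CARD('n) * (\<rho> + norm x0)" by (intro sum_bounded_above) auto
      moreover have "norm X \<le> (\<Sum>i\<in>UNIV. norm (X $ i))" by (simp add: norm_vec_def L2_set_le_sum)
      ultimately show ?thesis by simp
    qed
    then show ?thesis by (auto simp: bounded_iff)
  qed
  ultimately have "compact M" by (simp add: compact_eq_bounded_closed)
  moreover have E: "(e / 2) *\<^sub>R mat 1 \<in> M"
  proof -
    have "x0 + ((e / 2) *\<^sub>R mat 1 :: real ^ 'n ^ 'n) $ i \<in> ball x0 e" for i
    proof -
      have "((e / 2) *\<^sub>R mat 1 :: real ^ 'n ^ 'n) $ i = (e / 2) *\<^sub>R axis i 1"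
        by (simp add: vec_eq_iff mat_def axis_def)
      then show ?thesis using x0(1) by (simp add: dist_norm)
    qed
    then show ?thesis using x0(2) by (auto simp: M_def)
  qed
  moreover have "continuous_on M (\<lambda>X. \<bar>det X\<bar>)" unfolding det_def by (intro continuous_intros)
  ultimately obtain X where X: "X \<in> M" "\<And>Y. Y \<in> M \<Longrightarrow> \<bar>det Y\<bar> \<le> \<bar>det X\<bar>"
    using continuous_attains_sup[of M "\<lambda>X. \<bar>det X\<bar>"] by blast
  have dX: "det X \<noteq> 0"
  proof -
    have "\<bar>det ((e / 2) *\<^sub>R mat 1 :: real ^ 'n ^ 'n)\<bar> > 0" using x0(1) by (simp add: det_scaleR_mat1)
    then show ?thesis using X(2)[OF E] by auto
  qed
  define Y where "Y = transpose X"
  have dY: "det Y \<noteq> 0" using dX by (simp add: Y_def)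
  then obtain A where A: "A ** Y = mat 1" "Y ** A = mat 1"
    unfolding invertible_det_nz[symmetric] invertible_def by blast
  have "det A * det Y = 1" using A(1) by (metis det_I det_mul)
  then have dA: "det A \<noteq> 0" by auto
  have AY: "A *v (Y *v x) = x" and YA: "Y *v (A *v x) = x" for x
    using A by (simp_all add: matrix_vector_mul_assoc)
  define a where "a = - (A *v x0)"
  let ?T = "\<lambda>x. a + A *v x"
  have T: "?T x = A *v (x - x0)" for x by (simp add: a_def matrix_vector_mult_diff_distrib)
  have "?T x \<in> cbox (- 1) 1" if x: "x \<in> K" for x
  proof -
    let ?c = "A *v (x - x0)"
    have "\<bar>?c $ k\<bar> \<le> 1" for k
    proof -
      let ?X = "(\<chi> i. if i = k then x - x0 else X $ i) :: real ^ 'n ^ 'n"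
      have "?X \<in> M" using X(1) x by (simp add: M_def)
      have eq: "transpose ?X = (\<chi> i j. if j = k then (x - x0) $ i else Y $ i $ j)"
        by (auto simp: vec_eq_iff transpose_def Y_def)
      have "det ?X = det (\<chi> i j. if j = k then (x - x0) $ i else Y $ i $ j)"
        unfolding eq[symmetric] by (rule det_transpose[symmetric])
      moreover have c: "?c = (\<chi> k. det (\<chi> i j. if j = k then (x - x0) $ i else Y $ i $ j) / det Y)"
        using cramer[OF dY, of ?c "x - x0"] YA by simp
      have "?c $ k = det (\<chi> i j. if j = k then (x - x0) $ i else Y $ i $ j) / det Y"
        by (subst c) (rule vec_lambda_beta)
      ultimately have "\<bar>?c $ k\<bar> = \<bar>det ?X\<bar> / \<bar>det X\<bar>" by (simp add: Y_def)
      then show ?thesis using X(2)[OF \<open>?X \<in> M\<close>] dX by simp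
    qed
    then have "- 1 \<le> ?c $ k \<and> ?c $ k \<le> 1" for k by (smt (verit))
    then show ?thesis unfolding T mem_box_cart by simp
  qed
  moreover have "convex hull (insert 0 Basis) \<subseteq> ?T ` K"
  proof (rule hull_minimal)
    show "convex (?T ` K)" using convex_body_affine_image[OF K dA] by (simp add: convex_body_def)
    have "?T x0 = 0" unfolding T by simp
    moreover have "x0 \<in> K" using x0 by auto
    ultimately have "0 \<in> ?T ` K" by (rule image_eqI[OF sym])
    moreover have "axis i 1 \<in> ?T ` K" for i
    proof -
      have "?T (x0 + X $ i) = A *v (Y *v axis i 1)"
        unfolding T by (simp add: matrix_vector_mult_basis column_def Y_def transpose_def vec_lambda_eta)
      then have "?T (x0 + X $ i) = axis i 1" by (simp only: AY)
      moreover have "x0 + X $ i \<in> K" using X(1) by (simp add: M_def)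
      ultimately show ?thesis by (rule image_eqI[OF sym])
    qed
    ultimately show "insert 0 Basis \<subseteq> ?T ` K" by (auto simp: Basis_vec_def)
  qed
  ultimately show thesis using that[OF dA, of a] by blast
qed

text \<open>By affine invariance only bodies between the standard simplex and the cube need to be considered.
The simplex keeps the volumes away from \<open>0\<close>, so the limit of such bodies is again a convex body.\<close>

theorem compact_inertia_ratios: "compact (inertia_ratio ` {K :: (real ^ 'n) set. convex_body K})"
  unfolding compact_eq_seq_compact_metric seq_compact_def
proof (intro allI impI)
  fix f :: "nat \<Rightarrow> real" assume f: "\<forall>n. f n \<in> inertia_ratio ` {K :: (real ^ 'n) set. convex_body K}"
  let ?\<Delta> = "convex hull (insert 0 Basis) :: (real ^ 'n) set"
  have "\<exists>K :: (real ^ 'n) set. convex_body K \<and> K \<subseteq> cbox (- 1) 1 \<and> ?\<Delta> \<subseteq> K \<and> f n = inertia_ratio K" for n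
  proof -
    obtain K0 :: "(real ^ 'n) set" where K0: "convex_body K0" "f n = inertia_ratio K0" using f by blast
    obtain a and A :: "real ^ 'n ^ 'n" where A: "det A \<noteq> 0" "(\<lambda>x. a + A *v x) ` K0 \<subseteq> cbox (- 1) 1"
        "?\<Delta> \<subseteq> (\<lambda>x. a + A *v x) ` K0"
      by (rule ex_normalized_position[OF K0(1)])
    then show ?thesis
      using convex_body_affine_image[OF K0(1) A(1)] inertia_ratio_affine_image[OF K0(1) A(1)] K0(2)
      by (intro exI[of _ "(\<lambda>x. a + A *v x) ` K0"]) simp
  qed
  then obtain C :: "nat \<Rightarrow> (real ^ 'n) set" where C: "\<And>n. convex_body (C n)" "\<And>n. C n \<subseteq> cbox (- 1) 1"
      "\<And>n. ?\<Delta> \<subseteq> C n" "\<And>n. f n = inertia_ratio (C n)"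
    by metis
  obtain \<rho> where \<rho>: "cbox (- 1) (1 :: real ^ 'n) \<subseteq> cball 0 \<rho>"
    using bounded_cbox[of "- 1" "1 :: real ^ 'n"] by (auto simp: bounded_iff subset_iff)
  have bd: "C n \<subseteq> cball 0 \<rho>" for n using C(2) \<rho> by blast
  have cC: "compact (C n)" "convex (C n)" "C n \<noteq> {}" for n using C(1)[of n] by (auto simp: convex_body_def)
  obtain r K where r: "strict_mono (r :: nat \<Rightarrow> nat)" and K: "compact K" "convex K" "K \<subseteq> cball 0 \<rho>"
    and lim: "AE x in lborel. (\<lambda>n. indicator (C (r n)) x :: real) \<longlonglongrightarrow> indicator K x"
    by (rule convex_selection[OF cC bd])
  have D: "compact ?\<Delta>" by (intro finite_imp_compact_convex_hull) auto
  have "interior ?\<Delta> \<noteq> {}" using interior_std_simplex_nonempty by blast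
  then have Dpos: "0 < measure lborel ?\<Delta>" by (rule measure_pos_if_interior[OF D])
  have vol: "measure lborel ?\<Delta> \<le> measure lborel (C (r n))" for n
    using C(3) cC(1) D emeasure_compact_finite
    by (intro measure_mono_fmeasurable) (auto simp: fmeasurable_def borel_compact)
  note conv = inertia_ratio_tendsto[of "\<lambda>n. C (r n)", OF C(1) bd K(1,2) lim Dpos vol]
  have "inertia_ratio K \<in> inertia_ratio ` {K :: (real ^ 'n) set. convex_body K}" using conv(1) by blast
  moreover have "(f \<circ> r) \<longlonglongrightarrow> inertia_ratio K" using conv(2) by (simp add: o_def C(4))
  ultimately show "\<exists>l\<in>inertia_ratio ` {K :: (real ^ 'n) set. convex_body K}. \<exists>r. strict_mono r \<and> (f \<circ> r) \<longlonglongrightarrow> l"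
    using r by blast
qed

theorem max_isotropic_constant_attained:
  "\<exists>K :: (real ^ 'n) set. convex_body K \<and> max_isotropic_constant TYPE(real ^ 'n) = isotropic_constant K \<and>
     (\<forall>K' :: (real ^ 'n) set. convex_body K' \<longrightarrow> isotropic_constant K' \<le> isotropic_constant K)"
proof -
  have "convex_body (cball (0 :: real ^ 'n) 1)" by (simp add: convex_body_def)
  then have "inertia_ratio ` {K :: (real ^ 'n) set. convex_body K} \<noteq> {}" by blast
  then obtain K :: "(real ^ 'n) set" where K: "convex_body K"
    and max: "\<And>K' :: (real ^ 'n) set. convex_body K' \<Longrightarrow> inertia_ratio K' \<le> inertia_ratio K"
    using compact_attains_sup[OF compact_inertia_ratios] by blast
  have le: "isotropic_constant K' \<le> isotropic_constant K" if "convex_body K'" for K' :: "(real ^ 'n) set"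
    using max[OF that] by (simp add: isotropic_constant_eq K that)
  have "max_isotropic_constant TYPE(real ^ 'n) = isotropic_constant K"
    unfolding max_isotropic_constant_def by (rule Greatest_equality) (use K le in auto)
  with K le show ?thesis by blast
qed

section \<open>Comparison of the section quotient with the isotropic constant\<close>

theorem theorem1p1:
  shows "(\<forall>K :: (real ^ 'n) set. centered_convex_body K \<longrightarrow>
            Lambda_tilde K \<le> (2 * sqrt 3 * isotropic_constant K) ^ CARD('n)) \<and>
         (sqrt 2 * max_isotropic_constant TYPE(real ^ 'n)) ^ CARD('n)
            \<le> Lambda_tilde_sup TYPE(real ^ 'n) \<and>
         Lambda_tilde_sup TYPE(real ^ 'n)
            \<le> (2 * sqrt 3 * max_isotropic_constant TYPE(real ^ 'n)) ^ CARD('n)"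
proof -
  let ?n = "CARD('n)" and ?L = "max_isotropic_constant TYPE(real ^ 'n)"
  let ?S = "{K :: (real ^ 'n) set. centered_convex_body K}"
  have upper: "Lambda_tilde K \<le> (2 * sqrt 3 * isotropic_constant K) ^ ?n"
    if K: "centered_convex_body K" for K :: "(real ^ 'n) set"
  proof -
    obtain Q where Q: "orthogonal_matrix Q"
      "measure lborel K ^ (?n - 1) / (\<Prod>i\<in>UNIV. section_function K (Q $ i) 0)
          \<le> (2 * sqrt 3 * isotropic_constant K) ^ ?n"
      by (rule principal_axes_section_product[OF K])
    have "Lambda_tilde K \<le> section_quotient K Q"
      by (rule Lambda_tilde_eq[OF K]) (use Q(1) in blast)
    with Q(2) show ?thesis by (simp add: section_quotient_def)
  qed
  obtain M :: "(real ^ 'n) set" where M: "convex_body M" "?L = isotropic_constant M"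
    and max: "\<forall>K :: (real ^ 'n) set. convex_body K \<longrightarrow> isotropic_constant K \<le> isotropic_constant M"
    using max_isotropic_constant_attained[where ?'n = 'n] by blast
  have bound: "Lambda_tilde K \<le> (2 * sqrt 3 * ?L) ^ ?n" if K: "centered_convex_body K"
      for K :: "(real ^ 'n) set"
  proof -
    have K': "convex_body K" using K by (simp add: centered_convex_body_def)
    have "(2 * sqrt 3 * isotropic_constant K) ^ ?n \<le> (2 * sqrt 3 * ?L) ^ ?n"
      using max K' M(2) isotropic_constant_pos[OF K'] by (intro power_mono mult_left_mono) auto
    with upper[OF K] show ?thesis by simp
  qed
  obtain K :: "(real ^ 'n) set" where iso: "isotropic_with K (isotropic_constant M)"
    by (rule isotropic_image_with_constant[OF M(1)])
  then have K: "K \<in> ?S" by (simp add: isotropic_with_def)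
  then obtain Q where Q: "orthogonal_matrix Q" "Lambda_tilde K = section_quotient K Q"
    using Lambda_tilde_eq[of K] by auto
  have "(sqrt 2 * ?L) ^ ?n \<le> Lambda_tilde K"
    using isotropic_section_product[OF iso Q(1)] by (simp add: Q(2) section_quotient_def M(2))
  also have "Lambda_tilde K \<le> Lambda_tilde_sup TYPE(real ^ 'n)"
    unfolding Lambda_tilde_sup_def using bound by (intro cSUP_upper K bdd_aboveI2) auto
  finally have lower: "(sqrt 2 * ?L) ^ ?n \<le> Lambda_tilde_sup TYPE(real ^ 'n)" .
  have "Lambda_tilde_sup TYPE(real ^ 'n) \<le> (2 * sqrt 3 * ?L) ^ ?n"
    unfolding Lambda_tilde_sup_def using K bound by (intro cSUP_least) auto
  with upper lower show ?thesis by blast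
qed

end
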